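(* Consider a sequence, indexed by the sample size $n$, of Gaussian regression problems and posterior distributions over models as described in the context (all of $X$, $p=|F|$, $T$, $\alpha$, $\beta_T$, $\sigma_T^2$ may depend on $n$). Write $\tau_T=1/\sigma_T^2$ and $\beta_{\min}=\min_{i\in T}|\beta_i|$. Assume the following. (1) Design matrix. (i) All columns $X_i$, $i\in F$, are standardized (centered, i.e. $\mathbb 1'X_i=0$), with $\|X_i\|_2^2=n$. (ii) There is a constant $\zeta_{\min}>0$, not depending on $n$, such that $\min_{\emptyset\ne A\subseteq F}\nu_{\min}\left(\frac1n X_A'X_A\right)\ge\zeta_{\min}$, where $\nu_{\min}$ denotes the smallest eigenvalue. (iii) For $Z\sim N(0,I_{n\times n})$, $$\mathbb{E}\left[\max_{T\subseteq B\subset F}\ \max_{k\in F\setminus B}\frac{|\langle (I-H_B)X_k,Z\rangle|}{\sqrt n}\right]\le\frac12\sqrt{\frac{\zeta_{\min}}{2}\log(\log n)}.$$ (2) Mean structure. $\lim_{n\to\infty}\frac{\|X_T\beta_T\|_2^2}{n\sigma_T^2}=C_1$ for a finite positive constant $C_1$. (3) Growth of the full model. $\lim_{n\to\infty}\frac{|F|}{n}=f<1$. (4) Minimum signal. $\tau_T\|\beta_T\|_2^2=O(1)$, and there are finite positive constants $C_2,C_3$, not depending on $n$, with $\frac{C_2}{|T|}\le\tau_T\beta_{\min}^2\le\frac{C_3}{|T|}$. Suppose moreover that $|T|=\frac{n}{\log n}$ (up to rounding to an integer) and that $$C_2>\frac{10}{\zeta_{\min}}.$$ Then $\lim_{n\to\infty}\Pr(M_T\mid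 y)=1$ with probability at least $1-(\log n)^{-1/4}$. That is, there is a deterministic sequence $\eta_n\to0$ such that for all sufficiently large $n$, with probability at least $1-(\log n)^{-1/4}$ over the draw of $y$ from the true model, $\Pr(M_T\mid y)\ge1-\eta_n$.
   Context: Data. For each $n$, $y\in\mathbb R^n$ and $X\in\mathbb R^{n\times p}$ is a deterministic design matrix with columns $X_1,\dots,X_p$. Write $F=\{1,\dots,p\}$ for the index set of the full model. For $A\subseteq F$, $X_A$ is the submatrix of columns indexed by $A$, $\beta_A$ the corresponding subvector of $\beta$, $|A|$ the cardinality of $A$, and $H_A$ the orthogonal projection matrix onto the column span of $X_A$. $\mathbb 1$ is the all-ones vector. The data are generated by the true model $M_T$: $$y=\alpha\mathbb 1+X_T\beta_T+\epsilon,\qquad \epsilon\sim N(0,\sigma_T^2I_{n\times n}),$$ where $T=\{i\in F:\beta_i\ne0\}$, $\alpha\in\mathbb{R}$ and $\sigma_T^2>0$. Models and priors. The candidate models are $M_A$, $A\subseteq F$, where $M_A$ contains the intercept and the predictors in $A$. The prior on models is the truncated Poisson prior with fixed rate $\lambda>0$: $$\pi(M_A)\propto\frac{\lambda^{|A|}e^{-\lambda}}{|A|!}\binom{p}{|A|}^{-1},\qquad A\subseteq F.$$ Within a model, $(\alpha,\sigma^2)$ has the improper prior density $1/\sigma^2$; $\beta_A\mid\sigma^2,\omega\sim N\left(0,\frac{\sigma^2}{\omega}(X_A'X_A)^{-1}\right)$; and $\omega$ has a Beta-prime distribution with shape parameters $\frac12$ and $\frac{n-d_A-1}{2}$, where $d_A=|A|+1$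 is the number of regression coefficients of $M_A$ including the intercept. Let $R_A^2=\frac{y'(H_A^{+}-H_1)y}{y'(I-H_1)y}$ be the coefficient of determination, where $H_A^{+}$ is the orthogonal projection onto the span of $\mathbb 1$ and the columns of $X_A$, and $H_1$ is the orthogonal projection onto the span of $\mathbb 1$. The resulting Bayes factor of $M_A$ against $M_T$ is $$BF_{A:T}=\frac{(1-R_T^2)^{\frac{n-d_T-1}{2}}}{(1-R_A^2)^{\frac{n-d_A-1}{2}}}\cdot\frac{\Gamma\left(\frac{d_A}{2}\right)\Gamma\left(\frac{n-d_A}{2}\right)}{\Gamma\left(\frac{d_T}{2}\right)\Gamma\left(\frac{n-d_T}{2}\right)}.$$ The posterior probability of the true model is $$\Pr(M_T\mid y)=\left(\sum_{A\subseteq F}BF_{A:T}\,\frac{\pi(M_A)}{\pi(M_T)}\right)^{-1}$$ (for $n$ large enough that $|F|+2<n$, so that all quantities are defined). *)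

theory Defs
  imports
    "HOL-Probability.Probability"
    "HOL-Library.Landau_Symbols"
    "Jordan_Normal_Form.VS_Connect"
    "Jordan_Normal_Form.DL_Submatrix"
    "Jordan_Normal_Form.Spectral_Radius"
begin

(* The analysis library and the matrix library both provide these notations;
   the ones of Jordan_Normal_Form are meant throughout. *)
no_notation inner (infix "\<bullet>" 70)
unbundle no vec_syntax

(* Since the dimensions vary with the sample size, vectors and matrices are those of
   Jordan_Normal_Form.  Indices start at 0: the full model is {..<p}, and the predictor
   with index i is col X i. *)

definition subcols :: "real mat \<Rightarrow> nat set \<Rightarrow> real mat" where
  "subcols X A = submatrix X UNIV A"

(* pick A enumerates A increasingly, as in submatrix, so that the entries of
   subvec b A are aligned with the columns of subcols X A. *)
definition subvec :: "real Matrix.vec \<Rightarrow> nat set \<Rightarrow> real Matrix.vec" where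
  "subvec b A = Matrix.vec (card A) (\<lambda>i. b $ pick A i)"

definition ones :: "nat \<Rightarrow> real Matrix.vec" where
  "ones n = Matrix.vec n (\<lambda>_. 1)"

definition min_eigenvalue :: "real mat \<Rightarrow> real" where
  "min_eigenvalue M = Min (spectrum M)"

definition orth_proj :: "nat \<Rightarrow> real Matrix.vec set \<Rightarrow> real mat" where
  "orth_proj n S = (THE H. H \<in> carrier_mat n n \<and>
     (\<forall>v\<in>carrier_vec n. H *\<^sub>v v \<in> S \<and> (\<forall>u\<in>S. u \<bullet> (v - H *\<^sub>v v) = 0)))"

abbreviation real_span :: "nat \<Rightarrow> real Matrix.vec set \<Rightarrow> real Matrix.vec set" where
  "real_span n \<equiv> LinearCombinations.module.span class_ring (module_vec TYPE(real) n)"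

definition proj_model :: "nat \<Rightarrow> real mat \<Rightarrow> nat set \<Rightarrow> real mat" where
  "proj_model n X A = orth_proj n (real_span n (set (cols (subcols X A))))"

definition proj_model_int :: "nat \<Rightarrow> real mat \<Rightarrow> nat set \<Rightarrow> real mat" where
  "proj_model_int n X A = orth_proj n (real_span n (insert (ones n) (set (cols (subcols X A)))))"

definition proj_one :: "nat \<Rightarrow> real mat" where
  "proj_one n = orth_proj n (real_span n {ones n})"

definition R_squared :: "nat \<Rightarrow> real mat \<Rightarrow> real Matrix.vec \<Rightarrow> nat set \<Rightarrow> real" where
  "R_squared n X y A =
     (y \<bullet> ((proj_model_int n X A - proj_one n) *\<^sub>v y)) / (y \<bullet> ((1\<^sub>m n - proj_one n) *\<^sub>v y))"

(* A Poisson(lam) weight for the model size, truncated to {0..p} and spread evenly over the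
   models of that size. *)
definition prior_weight :: "real \<Rightarrow> nat \<Rightarrow> nat set \<Rightarrow> real" where
  "prior_weight lam p A =
     lam ^ card A * exp (- lam) / fact (card A) * inverse (real (p choose card A))"

definition model_prior :: "real \<Rightarrow> nat \<Rightarrow> nat set \<Rightarrow> real" where
  "model_prior lam p A = prior_weight lam p A / (\<Sum>B\<in>Pow {..<p}. prior_weight lam p B)"

definition num_coeffs :: "nat set \<Rightarrow> nat" where
  "num_coeffs A = card A + 1"

(* Closed form of the Bayes factor of model A against model T when (alpha, sigma^2) has the
   improper density 1 / sigma^2 in each model, beta_A given (sigma^2, omega) is
   N(0, sigma^2 / omega * (X_A' X_A)^{-1}), and omega is Beta-prime distributed with shape
   parameters 1/2 and (n - d_A - 1) / 2, where d_A = num_coeffs A. *)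
definition bayes_factor ::
  "nat \<Rightarrow> real mat \<Rightarrow> real Matrix.vec \<Rightarrow> nat set \<Rightarrow> nat set \<Rightarrow> real" where
  "bayes_factor n X y A T =
     ((1 - R_squared n X y T) powr ((real n - real (num_coeffs T) - 1) / 2)
       / (1 - R_squared n X y A) powr ((real n - real (num_coeffs A) - 1) / 2))
     * ((Gamma (real (num_coeffs A) / 2) * Gamma ((real n - real (num_coeffs A)) / 2))
       / (Gamma (real (num_coeffs T) / 2) * Gamma ((real n - real (num_coeffs T)) / 2)))"

definition posterior_prob ::
  "real \<Rightarrow> nat \<Rightarrow> nat \<Rightarrow> real mat \<Rightarrow> real Matrix.vec \<Rightarrow> nat set \<Rightarrow> real" where
  "posterior_prob lam n p X y T =
     inverse (\<Sum>A\<in>Pow {..<p}. bayes_factor n X y A T * (model_prior lam p A / model_prior lam p T))"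

(* normal_density takes the standard deviation, so this is N(0, s^2 I). *)
definition gaussian_noise :: "nat \<Rightarrow> real \<Rightarrow> (nat \<Rightarrow> real) measure" where
  "gaussian_noise n s = Pi\<^sub>M {..<n} (\<lambda>_. density lborel (\<lambda>x. ennreal (normal_density 0 s x)))"

definition response ::
  "nat \<Rightarrow> real mat \<Rightarrow> nat set \<Rightarrow> real \<Rightarrow> real Matrix.vec \<Rightarrow> (nat \<Rightarrow> real) \<Rightarrow> real Matrix.vec" where
  "response n X T a b e = a \<cdot>\<^sub>v ones n + subcols X T *\<^sub>v subvec b T + Matrix.vec n e"

end

theory Submission
  imports Defs "HOL-Real_Asymp.Real_Asymp"
begin

text \<open>The posterior probability of the true model is the inverse of \<open>\<Sum>A. W A\<close>, where the weight \<open>W A\<close> is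
the Bayes factor of \<open>A\<close> against \<open>T\<close> times the prior ratio, so that \<open>W T = 1\<close>. It has to be shown that the
other weights have a vanishing sum. Write \<open>L = ln n\<close>, \<open>t = |T|\<close> (about \<open>n / L\<close>) and \<open>N\<close> for the number of
predictors outside \<open>T\<close>.

The bound on the expected maximal correlation makes \<open>N\<close> tiny. If the predictors outside \<open>T\<close> are added one
after the other, their residuals are orthogonal and, by the eigenvalue condition, have length at least
\<open>sqrt (\<zeta> n)\<close>. So the maximum dominates \<open>sqrt \<zeta>\<close> times the maximum of \<open>N\<close> independent standard Gaussians,
which a second moment argument for \<open>\<Sum>exp (a g)\<close> bounds below, and \<open>N \<le> L powr (4/25)\<close> follows
(\<open>extra_predictors_le\<close>).

Models that contain \<open>T\<close> and \<open>j\<close> more predictors: the prior ratio cancels their number up to \<open>1 / j!\<close>, the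
Gamma ratio is of order \<open>L powr (-j/2)\<close>, and the residual sum of squares falls by \<open>\<sigma>\<^sup>2\<close> times a chi-square
variable with at most \<open>j\<close> degrees of freedom. A union bound over all sets of extra predictors is affordable
because there are at most \<open>N ^ j\<close> of size \<open>j\<close>; it shows that the fall is at most \<open>(94/100) j \<sigma>\<^sup>2 ln L\<close>, and the
gain \<open>L powr (j * 94/196)\<close> in likelihood stays below the price \<open>L powr (j/2)\<close>
(\<open>overfit_prob\<close>, \<open>overfit_weight\<close>).

Models that miss \<open>i \<ge> 1\<close> true predictors: the residual sum of squares exceeds that of the full model by
at least \<open>\<sigma>\<^sup>2 V\<close> with \<open>V = (sqrt D + g)\<^sup>2\<close>, \<open>g\<close> standard Gaussian and \<open>D \<ge> 10 i n / t\<close>, about \<open>10 i L\<close>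
(\<open>rho_misfit\<close>). For each \<open>i\<close> there are \<open>(t choose i) * 2 ^ N\<close> of them, too many for a uniform bound on
\<open>g\<close>. Instead Markov's inequality is applied to the square root of the sum of weights, which is at most the sum of the square
roots (\<open>underfit_prob\<close>). For this the power law \<open>(1 + V / n) powr (-n/2)\<close> is replaced by an exponential in \<open>V\<close>,
with one rate if \<open>i \<le> t/5\<close> and a smaller one otherwise (\<open>power_law_le_exp\<close>, \<open>rate\<close>); in both ranges the
constant 10 beats the number of models by a power of \<open>n\<close> (\<open>underfit_moment_term_le\<close>).

Apart from the length of the noise vector, whose coordinates are independent, every Gaussian quantity is
estimated through the Laplace transform of a linear form of the noise. For squared projections a Gaussian
average linearizes the square, for exponentials of negative squares a tangent line does. So neither rotation
invariance nor chi-square densities enter.\<close>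

section \<open>Gaussian noise: Laplace transforms and tail bounds\<close>

text \<open>The head is the newest vector, so that a system is extended by consing and induction over the list
removes one vector at a time.\<close>

fun orthonormal :: "nat \<Rightarrow> real Matrix.vec list \<Rightarrow> bool" where
  "orthonormal n [] = True"
| "orthonormal n (u # us) =
     (u \<in> carrier_vec n \<and> u \<bullet> u = 1 \<and> (\<forall>v\<in>set us. u \<bullet> v = 0) \<and> orthonormal n us)"

definition energy :: "real Matrix.vec list \<Rightarrow> real Matrix.vec \<Rightarrow> real" where
  "energy us y = (\<Sum>u\<leftarrow>us. (u \<bullet> y)\<^sup>2)"

lemma energy_simps [simp]:
  "energy [] y = 0" "energy (u # us) y = (u \<bullet> y)\<^sup>2 + energy us y"
  "energy (us @ vs) y = energy us y + energy vs y"
  by (simp_all add: energy_def)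

lemma energy_nonneg [simp]: "0 \<le> energy us y"
  unfolding energy_def by (induction us) auto

lemma orthonormal_carrier: "orthonormal n us \<Longrightarrow> set us \<subseteq> carrier_vec n"
  by (induction us) auto

abbreviation normal_measure :: "real \<Rightarrow> real measure" where
  "normal_measure s \<equiv> density lborel (\<lambda>x. ennreal (normal_density 0 s x))"

text \<open>Both one-dimensional Laplace transforms are computed by completing a normal density: the integrand is a
multiple of another normal density, which integrates to one.\<close>

lemma nn_integral_normal_measure:
  assumes "0 < s" "0 < s'" "0 \<le> c" and [measurable]: "g \<in> borel_measurable borel"
    and "\<And>x. normal_density 0 s x * g x = c * normal_density m s' x" "\<And>x. 0 \<le> g x"
  shows "(\<integral>\<^sup>+x. ennreal (g x) \<partial>normal_measure s) = ennreal c"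
proof -
  have "(\<integral>\<^sup>+x. ennreal (g x) \<partial>normal_measure s) =
      (\<integral>\<^sup>+x. ennreal (normal_density 0 s x) * ennreal (g x) \<partial>lborel)"
    by (subst nn_integral_density) auto
  also have "\<dots> = (\<integral>\<^sup>+x. ennreal c * ennreal (normal_density m s' x) \<partial>lborel)"
    by (intro nn_integral_cong) (use assms in \<open>simp add: ennreal_mult'[symmetric]\<close>)
  also have "\<dots> = ennreal c * (\<integral>\<^sup>+x. ennreal (normal_density m s' x) \<partial>lborel)"
    by (intro nn_integral_cmult) auto
  also have "(\<integral>\<^sup>+x. ennreal (normal_density m s' x) \<partial>lborel) = 1"
    using assms by (subst nn_integral_eq_integral) auto
  finally show ?thesis by simp
qed

lemma nn_integral_normal_exp:
  assumes "0 < s"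
  shows "(\<integral>\<^sup>+x. ennreal (exp (a * x)) \<partial>normal_measure s) = ennreal (exp (a\<^sup>2 * s\<^sup>2 / 2))"
proof (rule nn_integral_normal_measure[where m = "a * s\<^sup>2" and s' = s])
  fix x
  have "- (x\<^sup>2) / (2 * s\<^sup>2) + a * x = a\<^sup>2 * s\<^sup>2 / 2 - (x - a * s\<^sup>2)\<^sup>2 / (2 * s\<^sup>2)"
    using assms by (simp add: field_simps power2_eq_square)
  then show "normal_density 0 s x * exp (a * x) = exp (a\<^sup>2 * s\<^sup>2 / 2) * normal_density (a * s\<^sup>2) s x"
    unfolding normal_density_def by (simp add: exp_add[symmetric])
qed (use assms in auto)

lemma nn_integral_normal_exp_square:
  assumes "0 < s" "2 * q * s\<^sup>2 < 1"
  shows "(\<integral>\<^sup>+x. ennreal (exp (q * x\<^sup>2)) \<partial>normal_measure s) = ennreal (1 / sqrt (1 - 2 * q * s\<^sup>2))"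
proof (rule nn_integral_normal_measure[where m = 0 and s' = "s / sqrt (1 - 2 * q * s\<^sup>2)"])
  fix x
  let ?d = "1 - 2 * q * s\<^sup>2"
  have d: "0 < ?d" using assms by simp
  have "- (x\<^sup>2) / (2 * s\<^sup>2) + q * x\<^sup>2 = - (x\<^sup>2) / (2 * (s / sqrt ?d)\<^sup>2)"
    using assms d by (simp add: field_simps power2_eq_square)
  moreover have "1 / sqrt (2 * pi * s\<^sup>2) = 1 / sqrt ?d * (1 / sqrt (2 * pi * (s / sqrt ?d)\<^sup>2))"
    using assms d by (simp add: real_sqrt_mult real_sqrt_divide power_divide)
  ultimately show "normal_density 0 s x * exp (q * x\<^sup>2) = 1 / sqrt ?d * normal_density 0 (s / sqrt ?d) x"
    unfolding normal_density_def by (simp add: exp_add[symmetric])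
qed (use assms in auto)

lemma product_normal: "0 < s \<Longrightarrow> product_prob_space (\<lambda>_::nat. normal_measure s)"
  by (simp add: prob_space_normal_density product_prob_spaceI)

lemma prob_space_gaussian_noise: "0 < s \<Longrightarrow> prob_space (gaussian_noise n s)"
  unfolding gaussian_noise_def by (intro prob_space_PiM prob_space_normal_density)

lemma measurable_noise_component:
  "i < n \<Longrightarrow> (\<lambda>e. e i) \<in> borel_measurable (gaussian_noise n s)"
proof -
  assume "i < n"
  then have "(\<lambda>e. e i) \<in> gaussian_noise n s \<rightarrow>\<^sub>M normal_measure s"
    unfolding gaussian_noise_def by (intro measurable_component_singleton) simp
  also have "gaussian_noise n s \<rightarrow>\<^sub>M normal_measure s = borel_measurable (gaussian_noise n s)"
    by (rule measurable_cong_sets) auto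
  finally show ?thesis .
qed

lemma dot_vec: "a \<in> carrier_vec n \<Longrightarrow> a \<bullet> Matrix.vec n e = (\<Sum>i<n. a $ i * e i)"
  by (auto simp: scalar_prod_def lessThan_atLeast0)

lemma measurable_noise_dot [measurable]:
  "(\<lambda>e. a \<bullet> Matrix.vec n e) \<in> borel_measurable (gaussian_noise n s)"
proof -
  have "(\<lambda>e. a \<bullet> Matrix.vec n e) = (\<lambda>e. \<Sum>i<n. a $ i * e i)"
    by (auto simp: scalar_prod_def lessThan_atLeast0)
  then show ?thesis using measurable_noise_component by (auto intro!: borel_measurable_sum borel_measurable_times)
qed

lemma measurable_noise_sumsq [measurable]:
  "(\<lambda>e. \<Sum>i<n. (e i)\<^sup>2) \<in> borel_measurable (gaussian_noise n s)"
  by (intro borel_measurable_sum borel_measurable_power measurable_noise_component) simp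

lemma nn_integral_noise_prod:
  assumes "0 < s" "\<And>i. i < n \<Longrightarrow> g i \<in> borel_measurable borel"
  shows "(\<integral>\<^sup>+e. (\<Prod>i<n. g i (e i)) \<partial>gaussian_noise n s) = (\<Prod>i<n. \<integral>\<^sup>+x. g i x \<partial>normal_measure s)"
proof -
  interpret product_prob_space "\<lambda>_::nat. normal_measure s" by (rule product_normal[OF assms(1)])
  show ?thesis unfolding gaussian_noise_def
    by (rule product_nn_integral_prod) (use assms in auto)
qed

lemma noise_laplace:
  assumes "0 < s" "a \<in> carrier_vec n"
  shows "(\<integral>\<^sup>+e. ennreal (exp (a \<bullet> Matrix.vec n e)) \<partial>gaussian_noise n s) = ennreal (exp (s\<^sup>2 * (a \<bullet> a) / 2))"
proof -
  have "(\<integral>\<^sup>+e. ennreal (exp (a \<bullet> Matrix.vec n e)) \<partial>gaussian_noise n s) =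
     (\<integral>\<^sup>+e. (\<Prod>i<n. ennreal (exp (a $ i * e i))) \<partial>gaussian_noise n s)"
    by (intro nn_integral_cong) (simp add: dot_vec[OF assms(2)] exp_sum prod_ennreal)
  also have "\<dots> = (\<Prod>i<n. ennreal (exp ((a $ i)\<^sup>2 * s\<^sup>2 / 2)))"
    by (subst nn_integral_noise_prod) (use assms in \<open>auto simp: nn_integral_normal_exp\<close>)
  also have "\<dots> = ennreal (exp (\<Sum>i<n. (a $ i)\<^sup>2 * s\<^sup>2 / 2))"
    by (simp add: prod_ennreal exp_sum)
  also have "(\<Sum>i<n. (a $ i)\<^sup>2 * s\<^sup>2 / 2) = s\<^sup>2 * (a \<bullet> a) / 2"
    using assms by (auto simp: scalar_prod_def lessThan_atLeast0 sum_distrib_left sum_divide_distrib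
       power2_eq_square intro!: sum.cong)
  finally show ?thesis .
qed

lemma noise_square_laplace:
  assumes "0 < s" "2 * q * s\<^sup>2 < 1"
  shows "(\<integral>\<^sup>+e. ennreal (exp (q * (\<Sum>i<n. (e i)\<^sup>2))) \<partial>gaussian_noise n s)
    = ennreal (1 / sqrt (1 - 2 * q * s\<^sup>2) ^ n)"
proof -
  have "(\<integral>\<^sup>+e. ennreal (exp (q * (\<Sum>i<n. (e i)\<^sup>2))) \<partial>gaussian_noise n s) =
     (\<integral>\<^sup>+e. (\<Prod>i<n. ennreal (exp (q * (e i)\<^sup>2))) \<partial>gaussian_noise n s)"
    by (intro nn_integral_cong) (simp add: exp_sum prod_ennreal sum_distrib_left)
  also have "\<dots> = (\<Prod>i<n. ennreal (1 / sqrt (1 - 2 * q * s\<^sup>2)))"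
    by (subst nn_integral_noise_prod) (use assms in \<open>auto simp: nn_integral_normal_exp_square\<close>)
  also have "\<dots> = ennreal (1 / sqrt (1 - 2 * q * s\<^sup>2) ^ n)"
    using assms by (simp add: ennreal_power power_one_over)
  finally show ?thesis .
qed

text \<open>This is the Laplace transform of a chi-square variable, together with an independent linear form. Averaging
over a standard Gaussian \<open>w\<close> turns \<open>exp (q x\<^sup>2)\<close> into the mean of \<open>exp (sqrt (2 q) w x)\<close>, so that one vector \<open>u\<close> of
the system after the other is absorbed into the linear form \<open>a\<close>. Orthogonality of \<open>a\<close> to the remaining
vectors is preserved, which is why \<open>a\<close> is generalized in the induction.\<close>

lemma noise_energy_laplace:
  assumes "0 < s" "0 \<le> q" "2 * q * s\<^sup>2 < 1" "orthonormal n us" "a \<in> carrier_vec n"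
    "\<And>u. u \<in> set us \<Longrightarrow> u \<bullet> a = 0"
  shows "(\<integral>\<^sup>+e. ennreal (exp (a \<bullet> Matrix.vec n e + q * energy us (Matrix.vec n e))) \<partial>gaussian_noise n s)
     = ennreal (exp (s\<^sup>2 * (a \<bullet> a) / 2) / sqrt (1 - 2 * q * s\<^sup>2) ^ length us)"
  using assms(4-6)
proof (induction us arbitrary: a)
  case Nil
  then show ?case using noise_laplace[OF assms(1)] by simp
next
  case (Cons u us a)
  let ?G = "gaussian_noise n s" and ?N = "normal_measure 1" and ?r = "sqrt (2 * q)"
  let ?b = "\<lambda>w. a + (?r * w) \<cdot>\<^sub>v u"
  let ?C = "sqrt (1 - 2 * q * s\<^sup>2) ^ length us"
  have u: "u \<in> carrier_vec n" "u \<bullet> u = 1" "\<And>v. v \<in> set us \<Longrightarrow> u \<bullet> v = 0" "orthonormal n us" "u \<bullet> a = 0"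
    and a: "a \<in> carrier_vec n" using Cons.prems by auto
  have us: "v \<in> carrier_vec n" if "v \<in> set us" for v using that orthonormal_carrier[OF u(4)] by auto
  interpret G: prob_space ?G by (rule prob_space_gaussian_noise) (rule assms)
  interpret N: prob_space ?N by (rule prob_space_normal_density) simp
  interpret P: pair_sigma_finite ?N ?G ..
  have m [measurable]: "(\<lambda>e. energy vs (Matrix.vec n e)) \<in> borel_measurable ?G" for vs
    unfolding energy_def by (induction vs) auto
  have ev: "exp (a \<bullet> Matrix.vec n e + q * energy (u # us) (Matrix.vec n e)) =
     exp (q * (u \<bullet> Matrix.vec n e)\<^sup>2) * exp (a \<bullet> Matrix.vec n e + q * energy us (Matrix.vec n e))" for e
    by (simp add: exp_add[symmetric] algebra_simps)
  \<comment> \<open>The square is linearized by a Gaussian average.\<close>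
  have hs: "ennreal (exp (q * x\<^sup>2)) = (\<integral>\<^sup>+w. ennreal (exp (?r * x * w)) \<partial>?N)" for x
    using assms by (subst nn_integral_normal_exp) (auto simp: power_mult_distrib)
  have comb: "ennreal (exp (?r * (u \<bullet> Matrix.vec n e) * w)) * ennreal (exp (a \<bullet> Matrix.vec n e + q * energy us (Matrix.vec n e)))
     = ennreal (exp (?b w \<bullet> Matrix.vec n e + q * energy us (Matrix.vec n e)))" for e w
    using u a by (simp add: ennreal_mult'[symmetric] exp_add[symmetric] add_scalar_prod_distrib[of _ n] algebra_simps)
  have bb: "?b w \<bullet> ?b w = a \<bullet> a + 2 * q * w\<^sup>2" for w
    using u a assms(2) comm_scalar_prod[of a n u]
    by (simp add: add_scalar_prod_distrib[of _ n] scalar_prod_add_distrib[of _ n] power2_eq_square algebra_simps)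
  have "(\<integral>\<^sup>+e. ennreal (exp (a \<bullet> Matrix.vec n e + q * energy (u # us) (Matrix.vec n e))) \<partial>?G)
     = (\<integral>\<^sup>+e. (\<integral>\<^sup>+w. ennreal (exp (?r * (u \<bullet> Matrix.vec n e) * w)) * ennreal (exp (a \<bullet> Matrix.vec n e + q * energy us (Matrix.vec n e))) \<partial>?N) \<partial>?G)"
    unfolding ev by (intro nn_integral_cong, subst nn_integral_multc) (auto simp: hs ennreal_mult)
  also have "\<dots> = (\<integral>\<^sup>+w. (\<integral>\<^sup>+e. ennreal (exp (?r * (u \<bullet> Matrix.vec n e) * w)) * ennreal (exp (a \<bullet> Matrix.vec n e + q * energy us (Matrix.vec n e))) \<partial>?G) \<partial>?N)"
    by (rule P.Fubini') measurable
  also have "\<dots> = (\<integral>\<^sup>+w. ennreal (exp (s\<^sup>2 * (?b w \<bullet> ?b w) / 2) / ?C) \<partial>?N)"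
    unfolding comb
  proof (intro nn_integral_cong Cons.IH u(4))
    fix w v assume "v \<in> set us"
    then show "v \<bullet> ?b w = 0" using us[of v] u(1,3) a Cons.prems(3)[of v] comm_scalar_prod[of u n v]
      by (simp add: scalar_prod_add_distrib[of _ n])
  qed (use u a in simp)
  also have "\<dots> = (\<integral>\<^sup>+w. ennreal (exp (s\<^sup>2 * (a \<bullet> a) / 2) / ?C) * ennreal (exp ((q * s\<^sup>2) * w\<^sup>2)) \<partial>?N)"
    unfolding bb using assms
    by (intro nn_integral_cong) (simp add: ennreal_mult'[symmetric] exp_add[symmetric] algebra_simps add_divide_distrib)
  also have "\<dots> = ennreal (exp (s\<^sup>2 * (a \<bullet> a) / 2) / ?C) * (\<integral>\<^sup>+w. ennreal (exp ((q * s\<^sup>2) * w\<^sup>2)) \<partial>?N)"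
    by (intro nn_integral_cmult) measurable
  also have "(\<integral>\<^sup>+w. ennreal (exp ((q * s\<^sup>2) * w\<^sup>2)) \<partial>?N) = ennreal (1 / sqrt (1 - 2 * q * s\<^sup>2))"
    using assms nn_integral_normal_exp_square[of 1 "q * s\<^sup>2"] by (simp add: mult.assoc)
  finally show ?case using assms by (simp add: ennreal_mult'[symmetric] field_simps)
qed


lemma (in prob_space) markov_nn_integral:
  assumes [measurable]: "X \<in> borel_measurable M" and nonneg: "\<And>x. 0 \<le> X x"
    and B: "(\<integral>\<^sup>+x. ennreal (X x) \<partial>M) \<le> ennreal B" "0 \<le> B" and c: "0 < c"
  shows "prob {x \<in> space M. c \<le> X x} \<le> B / c"
proof -
  have "emeasure M {x \<in> space M. c \<le> X x} = emeasure M {x \<in> space M. 1 \<le> ennreal (1 / c) * ennreal (X x)}"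
    using c nonneg by (intro arg_cong[where f = "emeasure M"] Collect_cong)
      (auto simp: ennreal_mult'[symmetric] field_simps simp del: ennreal_1 simp flip: ennreal_1)
  also have "\<dots> \<le> ennreal (1 / c) * (\<integral>\<^sup>+x. ennreal (X x) * indicator (space M) x \<partial>M)"
    using nn_integral_Markov_inequality[of "\<lambda>x. ennreal (X x)" "space M" M "ennreal (1 / c)"] by simp
  also have "(\<integral>\<^sup>+x. ennreal (X x) * indicator (space M) x \<partial>M) = (\<integral>\<^sup>+x. ennreal (X x) \<partial>M)"
    by (intro nn_integral_cong) simp
  also have "ennreal (1 / c) * (\<integral>\<^sup>+x. ennreal (X x) \<partial>M) \<le> ennreal (1 / c) * ennreal B"
    using B by (intro mult_left_mono) auto
  also have "\<dots> = ennreal (B / c)" using c B by (simp add: ennreal_mult'[symmetric])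
  finally show ?thesis using B c by (simp add: emeasure_eq_measure)
qed

lemma measurable_noise_energy [measurable]:
  "(\<lambda>e. energy us (Matrix.vec n e)) \<in> borel_measurable (gaussian_noise n s)"
  unfolding energy_def by (induction us) auto

lemma noise_energy_tail:
  assumes "0 < s" "0 < q" "2 * q < 1" "orthonormal n us"
  shows "measure (gaussian_noise n s) {e \<in> space (gaussian_noise n s). c * s\<^sup>2 \<le> energy us (Matrix.vec n e)}
    \<le> exp (- q * c) / sqrt (1 - 2 * q) ^ length us"
proof -
  interpret prob_space "gaussian_noise n s" by (rule prob_space_gaussian_noise) fact
  have "prob {e \<in> space (gaussian_noise n s). c * s\<^sup>2 \<le> energy us (Matrix.vec n e)}
    = prob {e \<in> space (gaussian_noise n s). exp (q * c) \<le> exp (q / s\<^sup>2 * energy us (Matrix.vec n e))}"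
    using assms by (intro arg_cong[where f = prob] Collect_cong) (auto simp: field_simps)
  also have "\<dots> \<le> 1 / sqrt (1 - 2 * q) ^ length us / exp (q * c)"
    using noise_energy_laplace[of s "q / s\<^sup>2" n us "0\<^sub>v n"] assms orthonormal_carrier[OF assms(4)]
    by (intro markov_nn_integral) (auto simp: subset_eq)
  finally show ?thesis by (simp add: exp_minus field_simps)
qed

lemma noise_sumsq_upper_tail:
  assumes "0 < s" "0 < q" "2 * q < 1"
  shows "measure (gaussian_noise n s) {e \<in> space (gaussian_noise n s). c * s\<^sup>2 \<le> (\<Sum>i<n. (e i)\<^sup>2)}
    \<le> exp (- q * c) / sqrt (1 - 2 * q) ^ n"
proof -
  interpret prob_space "gaussian_noise n s" by (rule prob_space_gaussian_noise) fact
  have "prob {e \<in> space (gaussian_noise n s). c * s\<^sup>2 \<le> (\<Sum>i<n. (e i)\<^sup>2)}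
    = prob {e \<in> space (gaussian_noise n s). exp (q * c) \<le> exp (q / s\<^sup>2 * (\<Sum>i<n. (e i)\<^sup>2))}"
    using assms by (intro arg_cong[where f = prob] Collect_cong) (auto simp: field_simps)
  also have "\<dots> \<le> 1 / sqrt (1 - 2 * q) ^ n / exp (q * c)"
    using noise_square_laplace[of s "q / s\<^sup>2" n] assms
    by (intro markov_nn_integral) auto
  finally show ?thesis by (simp add: exp_minus field_simps)
qed

lemma noise_sumsq_lower_tail:
  assumes "0 < s" "0 < q"
  shows "measure (gaussian_noise n s) {e \<in> space (gaussian_noise n s). (\<Sum>i<n. (e i)\<^sup>2) \<le> c * s\<^sup>2}
    \<le> exp (q * c) / sqrt (1 + 2 * q) ^ n"
proof -
  interpret prob_space "gaussian_noise n s" by (rule prob_space_gaussian_noise) fact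
  have "prob {e \<in> space (gaussian_noise n s). (\<Sum>i<n. (e i)\<^sup>2) \<le> c * s\<^sup>2}
    = prob {e \<in> space (gaussian_noise n s). exp (- q * c) \<le> exp (- q / s\<^sup>2 * (\<Sum>i<n. (e i)\<^sup>2))}"
    using assms by (intro arg_cong[where f = prob] Collect_cong) (auto simp: field_simps)
  also have "\<dots> \<le> 1 / sqrt (1 + 2 * q) ^ n / exp (- q * c)"
    using noise_square_laplace[of s "- q / s\<^sup>2" n] assms
    by (intro markov_nn_integral) auto
  finally show ?thesis by (simp add: exp_minus field_simps)
qed

text \<open>A square lies above its tangent lines: \<open>- q x\<^sup>2 \<le> - 2 q a x + q a\<^sup>2\<close> for every \<open>a\<close>. With the best \<open>a\<close> the Laplace
transform of the linear form already gives the exponent of the exact noncentral chi-square formula.\<close>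

lemma noise_shifted_square_laplace:
  assumes "0 < s" "0 \<le> q" "u \<in> carrier_vec n" "u \<bullet> u = 1"
  shows "(\<integral>\<^sup>+e. ennreal (exp (- q * (d + u \<bullet> Matrix.vec n e)\<^sup>2 / s\<^sup>2)) \<partial>gaussian_noise n s)
    \<le> ennreal (exp (- q * d\<^sup>2 / s\<^sup>2 / (1 + 2 * q)))"
proof -
  \<comment> \<open>The tangent point that minimizes the resulting exponent.\<close>
  define a where "a = d / (1 + 2 * q)"
  define v where "v = (- 2 * q * a / s\<^sup>2) \<cdot>\<^sub>v u"
  define k where "k = - 2 * q * a * d / s\<^sup>2 + q * a\<^sup>2 / s\<^sup>2"
  have v: "v \<in> carrier_vec n" "v \<bullet> v = (2 * q * a / s\<^sup>2)\<^sup>2" using assms by (auto simp: v_def power2_eq_square)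
  have pt: "- q * (d + x)\<^sup>2 / s\<^sup>2 \<le> k + (- 2 * q * a / s\<^sup>2) * x" for x
  proof -
    have "0 \<le> q / s\<^sup>2 * (d + x - a)\<^sup>2" using assms by simp
    also have "\<dots> = k + (- 2 * q * a / s\<^sup>2) * x - (- q * (d + x)\<^sup>2 / s\<^sup>2)"
      using assms by (simp add: k_def field_simps power2_eq_square)
    finally show ?thesis by simp
  qed
  have "(\<integral>\<^sup>+e. ennreal (exp (- q * (d + u \<bullet> Matrix.vec n e)\<^sup>2 / s\<^sup>2)) \<partial>gaussian_noise n s)
    \<le> (\<integral>\<^sup>+e. ennreal (exp k) * ennreal (exp (v \<bullet> Matrix.vec n e)) \<partial>gaussian_noise n s)"
    using pt assms by (intro nn_integral_mono) (auto simp: v_def ennreal_mult'[symmetric] exp_add[symmetric])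
  also have "\<dots> = ennreal (exp (k + s\<^sup>2 * (v \<bullet> v) / 2))"
    using v assms by (subst nn_integral_cmult) (auto simp: noise_laplace ennreal_mult'[symmetric] exp_add[symmetric])
  also have "k + s\<^sup>2 * (v \<bullet> v) / 2 = (- 2 * q * a * d + q * a\<^sup>2 * (1 + 2 * q)) / s\<^sup>2"
    using assms unfolding v(2) k_def by (simp add: field_simps power2_eq_square)
  also have "- 2 * q * a * d + q * a\<^sup>2 * (1 + 2 * q) = - q * d\<^sup>2 / (1 + 2 * q)"
    using assms unfolding a_def by (simp add: divide_simps power2_eq_square)
  finally show ?thesis by (simp add: mult.commute)
qed

lemma has_bochner_integral_noise_laplace:
  assumes "0 < s" "a \<in> carrier_vec n"
  shows "has_bochner_integral (gaussian_noise n s) (\<lambda>e. exp (a \<bullet> Matrix.vec n e)) (exp (s\<^sup>2 * (a \<bullet> a) / 2))"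
  using noise_laplace[OF assms] by (intro has_bochner_integral_nn_integral) auto

text \<open>Chebyshev's inequality. Linear forms along orthonormal directions are uncorrelated after
exponentiation, because the Laplace transform factorizes.\<close>

lemma noise_exp_sum_concentration:
  fixes u :: "nat \<Rightarrow> real Matrix.vec" and a :: real
  assumes u: "\<And>i. i < N \<Longrightarrow> u i \<in> carrier_vec n"
      "\<And>i j. i < N \<Longrightarrow> j < N \<Longrightarrow> u i \<bullet> u j = (if i = j then 1 else 0)"
    and N: "0 < N"
  defines "S \<equiv> \<lambda>e. \<Sum>i<N. exp (a * (u i \<bullet> Matrix.vec n e))"
    and "\<mu> \<equiv> real N * exp (a\<^sup>2 / 2)"
  shows "measure (gaussian_noise n 1) {e \<in> space (gaussian_noise n 1). \<mu> / 2 \<le> \<bar>S e - \<mu>\<bar>} \<le> 4 * exp (a\<^sup>2) / N"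
proof -
  let ?G = "gaussian_noise n 1"
  interpret prob_space ?G by (rule prob_space_gaussian_noise) simp
  have "has_bochner_integral ?G (\<lambda>e. \<Sum>i<N. exp ((a \<cdot>\<^sub>v u i) \<bullet> Matrix.vec n e)) (\<Sum>i<N. exp (1\<^sup>2 * ((a \<cdot>\<^sub>v u i) \<bullet> (a \<cdot>\<^sub>v u i)) / 2))"
    by (intro has_bochner_integral_sum has_bochner_integral_noise_laplace) (use u in auto)
  also have "(\<Sum>i<N. exp (1\<^sup>2 * ((a \<cdot>\<^sub>v u i) \<bullet> (a \<cdot>\<^sub>v u i)) / 2)) = \<mu>"
  proof -
    have "(a \<cdot>\<^sub>v u i) \<bullet> (a \<cdot>\<^sub>v u i) = a\<^sup>2" if "i < N" for i
      using u(1)[OF that] u(2)[OF that that] by (simp add: power2_eq_square)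
    then show ?thesis by (simp add: \<mu>_def)
  qed
  also have "(\<lambda>e. \<Sum>i<N. exp ((a \<cdot>\<^sub>v u i) \<bullet> Matrix.vec n e)) = S"
    unfolding S_def using u by (intro ext sum.cong) auto
  finally have S1: "has_bochner_integral ?G S \<mu>" .
  define K where "K = (\<Sum>i<N. \<Sum>j<N. exp (a\<^sup>2 * (1 + (if i = j then 1 else 0))))"
  have "has_bochner_integral ?G (\<lambda>e. \<Sum>i<N. \<Sum>j<N. exp ((a \<cdot>\<^sub>v u i + a \<cdot>\<^sub>v u j) \<bullet> Matrix.vec n e))
     (\<Sum>i<N. \<Sum>j<N. exp (1\<^sup>2 * ((a \<cdot>\<^sub>v u i + a \<cdot>\<^sub>v u j) \<bullet> (a \<cdot>\<^sub>v u i + a \<cdot>\<^sub>v u j)) / 2))"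
    by (intro has_bochner_integral_sum has_bochner_integral_noise_laplace) (use u in auto)
  also have "(\<Sum>i<N. \<Sum>j<N. exp (1\<^sup>2 * ((a \<cdot>\<^sub>v u i + a \<cdot>\<^sub>v u j) \<bullet> (a \<cdot>\<^sub>v u i + a \<cdot>\<^sub>v u j)) / 2)) = K"
  proof -
    have "(a \<cdot>\<^sub>v u i + a \<cdot>\<^sub>v u j) \<bullet> (a \<cdot>\<^sub>v u i + a \<cdot>\<^sub>v u j) / 2 = a\<^sup>2 * (1 + (if i = j then 1 else 0))"
      if "i < N" "j < N" for i j
      using u(1)[OF that(1)] u(1)[OF that(2)] u(2)[OF that] u(2)[OF that(2,1)] u(2)[OF that(1,1)] u(2)[OF that(2,2)]
      by (simp add: add_scalar_prod_distrib[of _ n] scalar_prod_add_distrib[of _ n] power2_eq_square algebra_simps)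
    then show ?thesis unfolding K_def by (intro sum.cong) auto
  qed
  also have "(\<lambda>e. \<Sum>i<N. \<Sum>j<N. exp ((a \<cdot>\<^sub>v u i + a \<cdot>\<^sub>v u j) \<bullet> Matrix.vec n e)) = (\<lambda>e. (S e)\<^sup>2)"
    unfolding S_def power2_eq_square sum_product using u
    by (intro ext sum.cong) (auto simp: add_scalar_prod_distrib[of _ n] exp_add)
  finally have S2: "has_bochner_integral ?G (\<lambda>e. (S e)\<^sup>2) K" .
  have "K \<le> (\<Sum>i<N. (\<Sum>j<N. exp (a\<^sup>2)) + exp (2 * a\<^sup>2))"
    unfolding K_def
  proof (rule sum_mono)
    fix i assume "i \<in> {..<N}"
    have "(\<Sum>j<N. exp (a\<^sup>2 * (1 + (if i = j then 1 else 0)))) \<le> (\<Sum>j<N. exp (a\<^sup>2) + (if i = j then exp (2 * a\<^sup>2) else 0))"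
      by (intro sum_mono) (auto simp: algebra_simps)
    also have "\<dots> = (\<Sum>j<N. exp (a\<^sup>2)) + exp (2 * a\<^sup>2)"
      using \<open>i \<in> {..<N}\<close> by (simp add: sum.distrib sum.delta')
    finally show "(\<Sum>j<N. exp (a\<^sup>2 * (1 + (if i = j then 1 else 0)))) \<le> (\<Sum>j<N. exp (a\<^sup>2)) + exp (2 * a\<^sup>2)" .
  qed
  also have "\<dots> = \<mu>\<^sup>2 + N * exp (2 * a\<^sup>2)"
    by (simp add: \<mu>_def power_mult_distrib exp_double[symmetric] sum.distrib power2_eq_square algebra_simps exp_add[symmetric])
  finally have K: "K \<le> \<mu>\<^sup>2 + N * exp (2 * a\<^sup>2)" .
  have \<mu>: "0 < \<mu>" using N by (simp add: \<mu>_def)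
  have meas: "S \<in> borel_measurable ?G" and int: "integrable ?G S" "integrable ?G (\<lambda>e. (S e)\<^sup>2)"
    and E: "expectation S = \<mu>" "expectation (\<lambda>e. (S e)\<^sup>2) = K"
    using S1 S2 by (auto simp: has_bochner_integral_iff)
  have "prob {e \<in> space ?G. \<mu> / 2 \<le> \<bar>S e - expectation S\<bar>} \<le> variance S / (\<mu> / 2)\<^sup>2"
    by (rule Chebyshev_inequality) (use meas int \<mu> in auto)
  also have "variance S = K - \<mu>\<^sup>2" using int E by (subst variance_eq) auto
  also have "(K - \<mu>\<^sup>2) / (\<mu> / 2)\<^sup>2 \<le> (N * exp (2 * a\<^sup>2)) / (\<mu> / 2)\<^sup>2"
    using K by (intro divide_right_mono) auto
  also have "\<dots> = 4 * exp (a\<^sup>2) / N"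
    using N by (simp add: \<mu>_def power_mult_distrib power_divide exp_double[symmetric] field_simps power2_eq_square exp_add[symmetric])
  finally show ?thesis using E by simp
qed

text \<open>If all values were below \<open>m\<close>, then \<open>\<Sum>exp (a g) \<le> exp ((a - b) m) * \<Sum>exp (b g)\<close>. But both sums are close to
their means, which differ by the factor \<open>exp ((a\<^sup>2 - b\<^sup>2) / 2)\<close>; hence \<open>m\<close> is at least about \<open>(a + b) / 2\<close>. Using
two exponents that are close to each other loses much less than comparing one sum with its number of terms.\<close>

lemma noise_orthonormal_max_lower_bound:
  fixes u :: "nat \<Rightarrow> real Matrix.vec" and a b :: real
  assumes u: "\<And>i. i < N \<Longrightarrow> u i \<in> carrier_vec n"
      "\<And>i j. i < N \<Longrightarrow> j < N \<Longrightarrow> u i \<bullet> u j = (if i = j then 1 else 0)"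
    and N: "0 < N" and ab: "0 \<le> b" "b < a"
  defines "m \<equiv> (a + b) / 2 - ln 3 / (a - b)"
  shows "measure (gaussian_noise n 1) {e \<in> space (gaussian_noise n 1). \<exists>i<N. m \<le> u i \<bullet> Matrix.vec n e}
      \<ge> 1 - 8 * exp (a\<^sup>2) / N"
proof -
  let ?G = "gaussian_noise n 1"
  interpret prob_space ?G by (rule prob_space_gaussian_noise) simp
  define S where "S = (\<lambda>c e. \<Sum>i<N. exp (c * (u i \<bullet> Matrix.vec n e)))"
  define \<mu> where "\<mu> = (\<lambda>c::real. real N * exp (c\<^sup>2 / 2))"
  define B where "B = (\<lambda>c. {e \<in> space ?G. \<mu> c / 2 \<le> \<bar>S c e - \<mu> c\<bar>})"
  have B: "prob (B c) \<le> 4 * exp (c\<^sup>2) / N" for c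
    unfolding B_def S_def \<mu>_def by (rule noise_exp_sum_concentration[OF u N])
  have [measurable]: "S c \<in> borel_measurable ?G" for c unfolding S_def by measurable
  have Bm: "B c \<in> events" for c unfolding B_def by measurable
  have cover: "space ?G - (B a \<union> B b) \<subseteq> {e \<in> space ?G. \<exists>i<N. m \<le> u i \<bullet> Matrix.vec n e}"
  proof
    fix e assume e: "e \<in> space ?G - (B a \<union> B b)"
    have mu: "0 < \<mu> c" for c using N by (simp add: \<mu>_def)
    have lo: "\<mu> a / 2 < S a e" and hi: "S b e < 3 / 2 * \<mu> b"
      using e mu[of a] mu[of b] by (auto simp: B_def abs_if field_simps split: if_splits)
    have "\<exists>i<N. m \<le> u i \<bullet> Matrix.vec n e"
    proof (rule ccontr)
      assume "\<not> ?thesis"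
      then have lt: "u i \<bullet> Matrix.vec n e < m" if "i < N" for i using that by force
      have "S a e \<le> exp ((a - b) * m) * S b e"
        unfolding S_def sum_distrib_left
      proof (rule sum_mono)
        fix i assume "i \<in> {..<N}"
        then have "(a - b) * (u i \<bullet> Matrix.vec n e) \<le> (a - b) * m" using lt[of i] ab by (intro mult_left_mono) auto
        then show "exp (a * (u i \<bullet> Matrix.vec n e)) \<le> exp ((a - b) * m) * exp (b * (u i \<bullet> Matrix.vec n e))"
          by (simp add: exp_add[symmetric] algebra_simps)
      qed
      also have "\<dots> < exp ((a - b) * m) * (3 / 2 * \<mu> b)" using hi by simp
      finally have "\<mu> a / 2 < exp ((a - b) * m) * (3 / 2 * \<mu> b)" using lo by simp
      then have "exp (a\<^sup>2 / 2) < 3 * exp ((a - b) * m + b\<^sup>2 / 2)"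
        using N by (simp add: \<mu>_def exp_add)
      also have "\<dots> = exp (ln 3 + ((a - b) * m + b\<^sup>2 / 2))" by (simp add: exp_add)
      also have "ln 3 + ((a - b) * m + b\<^sup>2 / 2) = a\<^sup>2 / 2"
        using ab unfolding m_def by (simp add: field_simps power2_eq_square)
      finally show False by simp
    qed
    then show "e \<in> {e \<in> space ?G. \<exists>i<N. m \<le> u i \<bullet> Matrix.vec n e}" using e by auto
  qed
  have "prob (B a \<union> B b) \<le> prob (B a) + prob (B b)" by (intro measure_Un_le Bm)
  also have "\<dots> \<le> 4 * exp (a\<^sup>2) / N + 4 * exp (b\<^sup>2) / N" by (intro add_mono B)
  also have "\<dots> \<le> 8 * exp (a\<^sup>2) / N"
  proof -
    have "exp (b\<^sup>2) \<le> exp (a\<^sup>2)" using ab by (simp add: power_mono)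
    then have "4 * exp (b\<^sup>2) / N \<le> 4 * exp (a\<^sup>2) / N" by (intro divide_right_mono) auto
    then show ?thesis by (simp add: field_simps)
  qed
  finally have "1 - 8 * exp (a\<^sup>2) / N \<le> prob (space ?G - (B a \<union> B b))"
    using Bm by (subst prob_compl) auto
  also have "\<dots> \<le> prob {e \<in> space ?G. \<exists>i<N. m \<le> u i \<bullet> Matrix.vec n e}"
    by (intro finite_measure_mono cover) measurable
  finally show ?thesis .
qed

section \<open>Spans and orthogonal projections\<close>

lemma dot_self: "(v::real Matrix.vec) \<bullet> v = (\<Sum>i<dim_vec v. (v $ i)\<^sup>2)"
  by (auto simp: scalar_prod_def lessThan_atLeast0 power2_eq_square)

lemma dot_self_nonneg [simp]: "0 \<le> (v::real Matrix.vec) \<bullet> v"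
  by (simp add: dot_self sum_nonneg)

lemma vec_diff_add: "a \<in> carrier_vec n \<Longrightarrow> b \<in> carrier_vec n \<Longrightarrow> (a - b) + b = (a::real Matrix.vec)"
  by (intro eq_vecI) auto

lemma vec_diff_split:
  "a \<in> carrier_vec n \<Longrightarrow> b \<in> carrier_vec n \<Longrightarrow> c \<in> carrier_vec n \<Longrightarrow> a - c = (a - b) + (b - (c::real Matrix.vec))"
  by (intro eq_vecI) auto

lemma vec_diff_cancel:
  "a \<in> carrier_vec n \<Longrightarrow> b \<in> carrier_vec n \<Longrightarrow> c \<in> carrier_vec n \<Longrightarrow> (c + a) - (c + b) = a - (b::real Matrix.vec)"
  by (intro eq_vecI) auto

lemma vec_diff_add_right:
  "a \<in> carrier_vec n \<Longrightarrow> b \<in> carrier_vec n \<Longrightarrow> c \<in> carrier_vec n \<Longrightarrow> a - (b + c) = (a - b) - (c::real Matrix.vec)"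
  by (intro eq_vecI) auto

lemma vec_diff_eq_0: "a \<in> carrier_vec n \<Longrightarrow> b \<in> carrier_vec n \<Longrightarrow> a - b = 0\<^sub>v n \<Longrightarrow> a = (b::real Matrix.vec)"
  using vec_diff_add[of a n b] by simp

lemma dot_self_eq_0:
  assumes "(v::real Matrix.vec) \<in> carrier_vec n" "v \<bullet> v = 0" shows "v = 0\<^sub>v n"
  using assms by (intro eq_vecI) (auto simp: dot_self sum_nonneg_eq_0_iff)

lemma vec_span_carrier:
  assumes "W \<subseteq> carrier_vec n" shows "real_span n W \<subseteq> carrier_vec n"
proof -
  interpret vec_space "TYPE(real)" n .
  show ?thesis by (rule span_is_subset2[OF assms])
qed

lemma vec_span_base:
  assumes "W \<subseteq> carrier_vec n" "w \<in> W" shows "w \<in> real_span n W"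
proof -
  interpret vec_space "TYPE(real)" n .
  show ?thesis using in_own_span[OF assms(1)] assms(2) by auto
qed

lemma vec_span_add:
  assumes "W \<subseteq> carrier_vec n" "x \<in> real_span n W" "y \<in> real_span n W"
  shows "x + y \<in> real_span n W"
proof -
  interpret vec_space "TYPE(real)" n .
  show ?thesis by (rule span_add1[OF assms])
qed

lemma vec_span_smult:
  assumes "W \<subseteq> carrier_vec n" "x \<in> real_span n W"
  shows "c \<cdot>\<^sub>v x \<in> real_span n W"
proof -
  interpret vec_space "TYPE(real)" n .
  show ?thesis by (rule smult_in_span[OF assms])
qed

lemma vec_span_diff:
  assumes "W \<subseteq> carrier_vec n" "x \<in> real_span n W" "y \<in> real_span n W"
  shows "x - y \<in> real_span n W"
proof -
  have "x \<in> carrier_vec n" "y \<in> carrier_vec n" using assms vec_span_carrier by auto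
  then have "x - y = x + (-1) \<cdot>\<^sub>v y" by auto
  then show ?thesis using vec_span_add[OF assms(1,2) vec_span_smult[OF assms(1,3)]] by metis
qed

lemma vec_span_mono: "W \<subseteq> W' \<Longrightarrow> real_span n W \<subseteq> real_span n W'"
proof -
  interpret vec_space "TYPE(real)" n .
  show "W \<subseteq> W' \<Longrightarrow> span W \<subseteq> span W'" by (rule span_is_monotone)
qed

lemma vec_span_subset:
  assumes "W' \<subseteq> carrier_vec n" "W \<subseteq> real_span n W'"
  shows "real_span n W \<subseteq> real_span n W'"
proof -
  interpret vec_space "TYPE(real)" n .
  show ?thesis by (rule span_subsetI[OF assms])
qed

text \<open>Linear properties extend from generators to the span because they define a submodule.\<close>

lemma vec_span_induct [consumes 2, case_names zero base add smult]:
  assumes W: "W \<subseteq> carrier_vec n" and x: "x \<in> real_span n W"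
    and "P (0\<^sub>v n)" "\<And>w. w \<in> W \<Longrightarrow> P w"
    and "\<And>x y. x \<in> carrier_vec n \<Longrightarrow> y \<in> carrier_vec n \<Longrightarrow> P x \<Longrightarrow> P y \<Longrightarrow> P (x + y)"
    and "\<And>c x. x \<in> carrier_vec n \<Longrightarrow> P x \<Longrightarrow> P (c \<cdot>\<^sub>v x)"
  shows "P x"
proof -
  interpret vec_space "TYPE(real)" n .
  have "submodule class_ring {x \<in> carrier_vec n. P x} V"
    using assms by (intro submodule.intro module_axioms) auto
  from span_is_subset[OF _ this, of W] assms show ?thesis by blast
qed

text \<open>The projection written in coordinates of an orthonormal system, as a witness for \<open>orth_proj\<close>.\<close>

definition proj_mat :: "nat \<Rightarrow> real Matrix.vec list \<Rightarrow> real mat" where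
  "proj_mat n us = Matrix.mat n n (\<lambda>(i, j). \<Sum>u\<leftarrow>us. u $ i * u $ j)"

lemma proj_mat_carrier [simp]: "proj_mat n us \<in> carrier_mat n n"
  by (simp add: proj_mat_def)

lemma proj_mat_Nil: "v \<in> carrier_vec n \<Longrightarrow> proj_mat n [] *\<^sub>v v = 0\<^sub>v n"
  by (auto simp: proj_mat_def mult_mat_vec_def scalar_prod_def)

lemma proj_mat_Cons:
  assumes "u \<in> carrier_vec n" "v \<in> carrier_vec n"
  shows "proj_mat n (u # us) *\<^sub>v v = (u \<bullet> v) \<cdot>\<^sub>v u + proj_mat n us *\<^sub>v v"
  using assms
  by (intro eq_vecI) (auto simp: proj_mat_def scalar_prod_def sum.distrib sum_distrib_left sum_distrib_right algebra_simps)

text \<open>The property by which \<open>orth_proj\<close> is described.\<close>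

definition is_projection :: "nat \<Rightarrow> real Matrix.vec set \<Rightarrow> real mat \<Rightarrow> bool" where
  "is_projection n S H \<longleftrightarrow> H \<in> carrier_mat n n \<and>
     (\<forall>v\<in>carrier_vec n. H *\<^sub>v v \<in> S \<and> (\<forall>u\<in>S. u \<bullet> (v - H *\<^sub>v v) = 0))"

lemma orthonormal_orth_span:
  assumes "set us \<subseteq> carrier_vec n" "x \<in> carrier_vec n" "\<And>u. u \<in> set us \<Longrightarrow> u \<bullet> x = 0"
    "z \<in> real_span n (set us)"
  shows "z \<bullet> x = 0"
  using assms(1,4) by (induction rule: vec_span_induct) (use assms in \<open>auto simp: add_scalar_prod_distrib[of _ n]\<close>)

lemma proj_mat_orthonormal:
  assumes "orthonormal n us" "v \<in> carrier_vec n"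
  shows "proj_mat n us *\<^sub>v v \<in> real_span n (set us)"
    "\<And>u. u \<in> set us \<Longrightarrow> u \<bullet> (proj_mat n us *\<^sub>v v) = u \<bullet> v"
    "v \<bullet> (proj_mat n us *\<^sub>v v) = energy us v"
proof -
  have "proj_mat n us *\<^sub>v v \<in> real_span n (set us) \<and> (\<forall>u\<in>set us. u \<bullet> (proj_mat n us *\<^sub>v v) = u \<bullet> v)
     \<and> v \<bullet> (proj_mat n us *\<^sub>v v) = energy us v"
    using assms(1)
  proof (induction us)
    case Nil
    interpret vec_space "TYPE(real)" n .
    show ?case using assms(2) span_zero[of "{}"] by (simp add: proj_mat_Nil)
  next
    case (Cons u us)
    let ?q = "proj_mat n us *\<^sub>v v"
    have IH: "?q \<in> real_span n (set us)" "\<And>w. w \<in> set us \<Longrightarrow> w \<bullet> ?q = w \<bullet> v" "v \<bullet> ?q = energy us v"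
      using Cons by auto
    have u: "u \<in> carrier_vec n" "u \<bullet> u = 1" "\<And>w. w \<in> set us \<Longrightarrow> u \<bullet> w = 0" and us: "set us \<subseteq> carrier_vec n"
      using Cons.prems orthonormal_carrier by auto
    have q: "?q \<in> carrier_vec n" by (rule mult_mat_vec_carrier[OF proj_mat_carrier assms(2)])
    have "set (u # us) \<subseteq> carrier_vec n" using u us by auto
    moreover have "?q \<in> real_span n (set (u # us))" using IH(1) vec_span_mono[of "set us" "set (u # us)" n] by auto
    ultimately have "(u \<bullet> v) \<cdot>\<^sub>v u + ?q \<in> real_span n (set (u # us))"
      by (intro vec_span_add[OF _ vec_span_smult[OF _ vec_span_base]]) simp_all
    moreover have uq: "?q \<bullet> u = 0"
    proof (rule orthonormal_orth_span[OF us u(1) _ IH(1)])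
      fix x assume "x \<in> set us"
      then show "x \<bullet> u = 0" using us u(1) u(3)[of x] comm_scalar_prod[of x n u] by auto
    qed
    have uq': "u \<bullet> ?q = 0" using uq comm_scalar_prod[OF u(1) q] by simp
    moreover have "w \<bullet> ((u \<bullet> v) \<cdot>\<^sub>v u + ?q) = w \<bullet> v" if "w \<in> set us" for w
    proof -
      have w: "w \<in> carrier_vec n" "w \<bullet> u = 0" using that us u comm_scalar_prod[of u n w] by auto
      show ?thesis using w u q IH(2)[OF that] by (simp add: scalar_prod_add_distrib[of _ n])
    qed
    moreover have "u \<bullet> ((u \<bullet> v) \<cdot>\<^sub>v u + ?q) = u \<bullet> v"
      using u q uq' by (simp add: scalar_prod_add_distrib[of _ n])
    moreover have "v \<bullet> ((u \<bullet> v) \<cdot>\<^sub>v u + ?q) = (u \<bullet> v)\<^sup>2 + energy us v"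
      using u q assms(2) IH(3) comm_scalar_prod[OF u(1) assms(2)]
      by (simp add: scalar_prod_add_distrib[of _ n] power2_eq_square)
    ultimately show ?case using u assms(2) by (auto simp: proj_mat_Cons)
  qed
  then show "proj_mat n us *\<^sub>v v \<in> real_span n (set us)"
    "\<And>u. u \<in> set us \<Longrightarrow> u \<bullet> (proj_mat n us *\<^sub>v v) = u \<bullet> v"
    "v \<bullet> (proj_mat n us *\<^sub>v v) = energy us v" by auto
qed

lemma is_projection_proj_mat:
  assumes "orthonormal n us"
  shows "is_projection n (real_span n (set us)) (proj_mat n us)"
  unfolding is_projection_def
proof (intro conjI ballI)
  note us = orthonormal_carrier[OF assms]
  fix v :: "real Matrix.vec" assume v: "v \<in> carrier_vec n"
  let ?q = "proj_mat n us *\<^sub>v v"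
  have q: "?q \<in> carrier_vec n" by (rule mult_mat_vec_carrier[OF proj_mat_carrier v])
  show "?q \<in> real_span n (set us)" by (rule proj_mat_orthonormal[OF assms v])
  fix z assume "z \<in> real_span n (set us)"
  then show "z \<bullet> (v - ?q) = 0"
  proof (rule orthonormal_orth_span[OF us, rotated -1])
    fix u assume "u \<in> set us"
    then have "u \<in> carrier_vec n" "u \<bullet> ?q = u \<bullet> v" using us proj_mat_orthonormal(2)[OF assms v] by auto
    then show "u \<bullet> (v - ?q) = 0" using v q by (simp add: scalar_prod_minus_distrib[of _ n])
  qed (use v q in auto)
qed simp

text \<open>The difference of the two images of a vector lies in the span and is orthogonal to itself.\<close>

lemma is_projection_unique:
  assumes W: "W \<subseteq> carrier_vec n" and "is_projection n (real_span n W) H" "is_projection n (real_span n W) H'"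
  shows "H = H'"
proof (rule eq_matI)
  have H: "H \<in> carrier_mat n n" "H' \<in> carrier_mat n n" using assms by (auto simp: is_projection_def)
  then show "dim_row H = dim_row H'" "dim_col H = dim_col H'" by auto
  fix i j assume ij: "i < dim_row H'" "j < dim_col H'"
  define v where "v = (unit_vec n j :: real Matrix.vec)"
  have v: "v \<in> carrier_vec n" by (simp add: v_def)
  let ?d = "H *\<^sub>v v - H' *\<^sub>v v"
  have d: "?d \<in> real_span n W" using assms v by (intro vec_span_diff) (auto simp: is_projection_def)
  have c: "H *\<^sub>v v \<in> carrier_vec n" "H' *\<^sub>v v \<in> carrier_vec n" using H v by auto
  have "?d \<bullet> (v - H *\<^sub>v v) = 0" "?d \<bullet> (v - H' *\<^sub>v v) = 0" using assms d v by (auto simp: is_projection_def)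
  then have "?d \<bullet> ?d = 0" using v c by (simp add: scalar_prod_minus_distrib[of _ n])
  then have "?d = 0\<^sub>v n" by (intro dot_self_eq_0) (use c in auto)
  then have "H *\<^sub>v v = H' *\<^sub>v v" by (rule vec_diff_eq_0[OF c])
  then have "(H *\<^sub>v v) $ i = (H' *\<^sub>v v) $ i" by simp
  then show "H $$ (i, j) = H' $$ (i, j)" using H ij by (auto simp: v_def)
qed

lemma orth_proj_eqI:
  assumes "W \<subseteq> carrier_vec n" "is_projection n (real_span n W) H"
  shows "orth_proj n (real_span n W) = H"
  unfolding orth_proj_def
  by (rule the_equality) (use assms is_projection_unique[OF assms(1)] in \<open>auto simp: is_projection_def\<close>)

text \<open>Gram-Schmidt. Keeping the old system as a tail of the new one makes the difference of two nested residual
sums of squares a sum of at most \<open>length ws\<close> squares.\<close>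

lemma extend_orthonormal:
  assumes "orthonormal n us" "set ws \<subseteq> carrier_vec n"
  shows "\<exists>vs. orthonormal n (vs @ us) \<and> length vs \<le> length ws \<and>
    real_span n (set (vs @ us)) = real_span n (set us \<union> set ws)"
  using assms(2)
proof (induction ws)
  case Nil
  then show ?case using assms by (intro exI[of _ "[]"]) auto
next
  case (Cons w ws)
  then obtain vs where vs: "orthonormal n (vs @ us)" "length vs \<le> length ws"
    "real_span n (set (vs @ us)) = real_span n (set us \<union> set ws)" by auto
  let ?W = "set us \<union> set (w # ws)"
  have Wc: "?W \<subseteq> carrier_vec n" using Cons.prems orthonormal_carrier[OF assms(1)] by auto
  have vc: "set (vs @ us) \<subseteq> carrier_vec n" by (rule orthonormal_carrier[OF vs(1)])
  let ?H = "proj_mat n (vs @ us)"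
  define r where "r = w - ?H *\<^sub>v w"
  have w: "w \<in> carrier_vec n" using Cons.prems by auto
  have Hw: "?H *\<^sub>v w \<in> carrier_vec n" by (rule mult_mat_vec_carrier[OF proj_mat_carrier w])
  have r: "r \<in> carrier_vec n" using w Hw by (simp add: r_def)
  have pr: "is_projection n (real_span n (set (vs @ us))) ?H" by (rule is_projection_proj_mat[OF vs(1)])
  then have Hin: "?H *\<^sub>v w \<in> real_span n (set (vs @ us))" and
    orth: "\<And>u. u \<in> real_span n (set (vs @ us)) \<Longrightarrow> u \<bullet> r = 0" using w by (auto simp: is_projection_def r_def)
  have sub: "real_span n (set (vs @ us)) \<subseteq> real_span n ?W" unfolding vs(3) by (rule vec_span_mono) auto
  have wW: "w \<in> real_span n ?W" using Wc by (intro vec_span_base) auto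
  have rW: "r \<in> real_span n ?W" unfolding r_def using Hin sub by (intro vec_span_diff Wc wW) auto
  have w_eq: "w = r + ?H *\<^sub>v w" unfolding r_def by (rule vec_diff_add[OF w Hw, symmetric])
  have base: "set us \<union> set ws \<subseteq> real_span n (set us \<union> set ws)" using Wc by (auto intro!: vec_span_base)
  show ?case
  proof (cases "r = 0\<^sub>v n")
    case True
    then have "w = ?H *\<^sub>v w" using w_eq Hw by auto
    then have "w \<in> real_span n (set (vs @ us))" using Hin by simp
    then have "?W \<subseteq> real_span n (set (vs @ us))" using base unfolding vs(3) by auto
    then have "real_span n ?W \<subseteq> real_span n (set (vs @ us))" by (rule vec_span_subset[OF vc])
    then show ?thesis using vs sub by (intro exI[of _ vs]) auto
  next
    case False
    then have rr: "r \<bullet> r > 0" using dot_self_nonneg[of r] dot_self_eq_0[OF r] by (metis less_eq_real_def)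
    define v where "v = (1 / sqrt (r \<bullet> r)) \<cdot>\<^sub>v r"
    have v: "v \<in> carrier_vec n" "v \<bullet> v = 1"
      using r rr by (auto simp: v_def field_simps)
    have vorth: "v \<bullet> x = 0" if "x \<in> set (vs @ us)" for x
    proof -
      have x: "x \<in> carrier_vec n" "x \<in> real_span n (set (vs @ us))" using that vc vec_span_base[OF vc that] by auto
      then have "r \<bullet> x = 0" using orth[of x] comm_scalar_prod[OF r x(1)] by simp
      then show ?thesis using x r by (simp add: v_def)
    qed
    have on: "orthonormal n ((v # vs) @ us)" using v vorth vs(1) by auto
    have vc': "set ((v # vs) @ us) \<subseteq> carrier_vec n" by (rule orthonormal_carrier[OF on])
    have "v \<in> real_span n ?W" unfolding v_def by (rule vec_span_smult[OF Wc rW])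
    moreover have "set (vs @ us) \<subseteq> real_span n ?W" using sub vec_span_base[OF vc] by auto
    ultimately have 1: "real_span n (set ((v # vs) @ us)) \<subseteq> real_span n ?W"
      by (intro vec_span_subset[OF Wc]) auto
    have mono: "real_span n (set (vs @ us)) \<subseteq> real_span n (set ((v # vs) @ us))" by (rule vec_span_mono) auto
    have "r = sqrt (r \<bullet> r) \<cdot>\<^sub>v v" using rr r by (simp add: v_def smult_smult_assoc)
    then have "r \<in> real_span n (set ((v # vs) @ us))"
      using vec_span_smult[OF vc' vec_span_base[OF vc', of v]] by (metis append_Cons list.set_intros(1))
    then have "w \<in> real_span n (set ((v # vs) @ us))"
      using w_eq vec_span_add[OF vc', of r "?H *\<^sub>v w"] Hin mono by auto
    then have "?W \<subseteq> real_span n (set ((v # vs) @ us))" using base mono unfolding vs(3) by auto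
    then have "real_span n ?W \<subseteq> real_span n (set ((v # vs) @ us))" by (rule vec_span_subset[OF vc'])
    then show ?thesis using on 1 vs(2) by (intro exI[of _ "v # vs"]) auto
  qed
qed


lemma span_orthonormal_basis:
  assumes "finite W" "W \<subseteq> carrier_vec n"
  obtains us where "orthonormal n us" "length us \<le> card W" "real_span n (set us) = real_span n W"
proof -
  obtain ws where ws: "set ws = W" "length ws = card W" using finite_distinct_list[OF assms(1)] distinct_card by metis
  obtain vs where "orthonormal n (vs @ [])" "length vs \<le> length ws" "real_span n (set (vs @ [])) = real_span n (set [] \<union> set ws)"
    using extend_orthonormal[of n "[]" ws] assms ws by auto
  then show thesis using that[of vs] ws by auto
qed

lemma is_projection_orth_proj:
  assumes "finite W" "W \<subseteq> carrier_vec n"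
  shows "is_projection n (real_span n W) (orth_proj n (real_span n W))"
proof -
  obtain us where "orthonormal n us" "real_span n (set us) = real_span n W"
    using span_orthonormal_basis[OF assms] by metis
  then have "is_projection n (real_span n W) (proj_mat n us)" using is_projection_proj_mat by metis
  then show ?thesis using orth_proj_eqI[OF assms(2)] by metis
qed

section \<open>Residual sums of squares\<close>

text \<open>Here the space is the span of \<open>W\<close>; it is written like the denominator of \<open>R_squared\<close>.\<close>

definition rss :: "nat \<Rightarrow> real Matrix.vec set \<Rightarrow> real Matrix.vec \<Rightarrow> real" where
  "rss n W y = y \<bullet> ((1\<^sub>m n - orth_proj n (real_span n W)) *\<^sub>v y)"

context
  fixes n :: nat and W :: "real Matrix.vec set"
  assumes fin: "finite W" and W: "W \<subseteq> carrier_vec n"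
begin

abbreviation (input) "Hproj \<equiv> orth_proj n (real_span n W)"

lemma orth_proj_carrier: "Hproj \<in> carrier_mat n n"
  using is_projection_orth_proj[OF fin W] by (auto simp: is_projection_def)

lemma orth_proj_vec: "v \<in> carrier_vec n \<Longrightarrow> Hproj *\<^sub>v v \<in> carrier_vec n"
  by (rule mult_mat_vec_carrier[OF orth_proj_carrier])

lemma orth_proj_in_span: "v \<in> carrier_vec n \<Longrightarrow> Hproj *\<^sub>v v \<in> real_span n W"
  using is_projection_orth_proj[OF fin W] by (auto simp: is_projection_def)

lemma residual_orth: "v \<in> carrier_vec n \<Longrightarrow> u \<in> real_span n W \<Longrightarrow> u \<bullet> (v - Hproj *\<^sub>v v) = 0"
  using is_projection_orth_proj[OF fin W] by (auto simp: is_projection_def)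

lemma residual_mat: "v \<in> carrier_vec n \<Longrightarrow> (1\<^sub>m n - Hproj) *\<^sub>v v = v - Hproj *\<^sub>v v"
  using orth_proj_carrier by (simp add: minus_mult_distrib_mat_vec[of _ n n])

lemma rss_eq:
  assumes y: "y \<in> carrier_vec n"
  shows "rss n W y = (y - Hproj *\<^sub>v y) \<bullet> (y - Hproj *\<^sub>v y)"
proof -
  have "(y - Hproj *\<^sub>v y) \<bullet> (y - Hproj *\<^sub>v y) = y \<bullet> (y - Hproj *\<^sub>v y) - (Hproj *\<^sub>v y) \<bullet> (y - Hproj *\<^sub>v y)"
    using y orth_proj_vec[OF y] by (simp add: minus_scalar_prod_distrib[of _ n])
  also have "(Hproj *\<^sub>v y) \<bullet> (y - Hproj *\<^sub>v y) = 0" by (rule residual_orth[OF y orth_proj_in_span[OF y]])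
  finally show ?thesis unfolding rss_def residual_mat[OF y] by simp
qed

lemma rss_minimal:
  assumes y: "y \<in> carrier_vec n" and w: "w \<in> real_span n W"
  shows "rss n W y \<le> (y - w) \<bullet> (y - w)"
proof -
  let ?r = "y - Hproj *\<^sub>v y" and ?d = "Hproj *\<^sub>v y - w"
  have wc: "w \<in> carrier_vec n" using w vec_span_carrier[OF W] by auto
  have c: "?r \<in> carrier_vec n" "?d \<in> carrier_vec n" using y wc orth_proj_vec[OF y] by auto
  have "?d \<in> real_span n W" by (intro vec_span_diff[OF W] orth_proj_in_span y w)
  then have dr: "?d \<bullet> ?r = 0" "?r \<bullet> ?d = 0" using residual_orth[OF y, of ?d] comm_scalar_prod[OF c] by auto
  have "y - w = ?r + ?d" by (rule vec_diff_split) (use y wc orth_proj_vec[OF y] in auto)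
  then have "(y - w) \<bullet> (y - w) = ?r \<bullet> ?r + ?d \<bullet> ?d"
    using c dr by (simp add: add_scalar_prod_distrib[of _ n] scalar_prod_add_distrib[of _ n])
  then show ?thesis using rss_eq[OF y] dot_self_nonneg[of ?d] by linarith
qed

lemma orth_proj_id:
  assumes w: "w \<in> real_span n W" shows "Hproj *\<^sub>v w = w"
proof -
  have wc: "w \<in> carrier_vec n" using w vec_span_carrier[OF W] by auto
  let ?r = "w - Hproj *\<^sub>v w"
  have "?r \<in> real_span n W" by (intro vec_span_diff[OF W] w orth_proj_in_span wc)
  then have "?r \<bullet> ?r = 0" by (rule residual_orth[OF wc])
  then have "?r = 0\<^sub>v n" by (intro dot_self_eq_0) (use wc orth_proj_vec[OF wc] in auto)
  then show ?thesis using vec_diff_eq_0[OF wc orth_proj_vec[OF wc]] by simp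
qed

lemma rss_shift:
  assumes w: "w \<in> real_span n W" and y: "y \<in> carrier_vec n"
  shows "rss n W (w + y) = rss n W y"
proof -
  have wc: "w \<in> carrier_vec n" using w vec_span_carrier[OF W] by auto
  have "Hproj *\<^sub>v (w + y) = w + Hproj *\<^sub>v y"
    using mult_add_distrib_mat_vec[OF orth_proj_carrier wc y] orth_proj_id[OF w] by simp
  then have "(w + y) - Hproj *\<^sub>v (w + y) = y - Hproj *\<^sub>v y"
    using vec_diff_cancel[OF y orth_proj_vec[OF y] wc] by simp
  then show ?thesis using wc y by (simp add: rss_eq)
qed

lemma rss_orthonormal:
  assumes "orthonormal n us" "real_span n (set us) = real_span n W" and y: "y \<in> carrier_vec n"
  shows "rss n W y = y \<bullet> y - energy us y"
proof -
  have H: "Hproj = proj_mat n us"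
    by (rule orth_proj_eqI[OF W]) (use is_projection_proj_mat[OF assms(1)] assms(2) in simp)
  show ?thesis unfolding rss_def residual_mat[OF y]
    using y orth_proj_vec[OF y] proj_mat_orthonormal(3)[OF assms(1) y] unfolding H
    by (simp add: scalar_prod_minus_distrib[of _ n])
qed

end

lemma rss_antimono:
  assumes "finite W" "W \<subseteq> carrier_vec n" "finite W'" "W' \<subseteq> carrier_vec n" "W \<subseteq> W'" "y \<in> carrier_vec n"
  shows "rss n W' y \<le> rss n W y"
  unfolding rss_eq[OF assms(1,2,6)]
  using orth_proj_in_span[OF assms(1,2,6)] vec_span_mono[OF assms(5)] by (intro rss_minimal assms) auto

lemma rss_le_dot:
  assumes "finite W" "W \<subseteq> carrier_vec n" "y \<in> carrier_vec n"
  shows "rss n W y \<le> y \<bullet> y"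
proof -
  interpret vec_space "TYPE(real)" n .
  show ?thesis using rss_minimal[OF assms, of "0\<^sub>v n"] span_zero[of W] assms(3) by simp
qed

text \<open>Compared with the fit on the smaller space, the larger space can in addition use the direction \<open>r\<close>, which is
orthogonal to the smaller space. Only one direction is used; it is the one along which the noise is shifted
when a true predictor is missing.\<close>

lemma rss_gain:
  assumes W: "finite W" "W \<subseteq> carrier_vec n" and W': "finite W'" "W' \<subseteq> carrier_vec n" "W \<subseteq> W'"
    and y: "y \<in> carrier_vec n" and m: "m \<in> real_span n W'"
  defines "r \<equiv> m - orth_proj n (real_span n W) *\<^sub>v m"
  assumes rr: "r \<bullet> r > 0"
  shows "rss n W' y + (r \<bullet> y)\<^sup>2 / (r \<bullet> r) \<le> rss n W y"
proof -
  let ?H = "orth_proj n (real_span n W)"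
  \<comment> \<open>The least squares coefficient of \<open>y\<close> along \<open>r\<close>.\<close>
  define c where "c = (r \<bullet> y) / (r \<bullet> r)"
  let ?z = "y - ?H *\<^sub>v y"
  have mc: "m \<in> carrier_vec n" using m vec_span_carrier[OF W'(2)] by auto
  have Hm: "?H *\<^sub>v m \<in> carrier_vec n" "?H *\<^sub>v y \<in> carrier_vec n" using orth_proj_vec[OF W] mc y by auto
  have rc: "r \<in> carrier_vec n" and zc: "?z \<in> carrier_vec n" using Hm mc y by (auto simp: r_def)
  have sub: "real_span n W \<subseteq> real_span n W'" by (rule vec_span_mono[OF W'(3)])
  have rS: "r \<in> real_span n W'" unfolding r_def using orth_proj_in_span[OF W mc] sub by (intro vec_span_diff[OF W'(2)] m) auto
  have "?H *\<^sub>v y + c \<cdot>\<^sub>v r \<in> real_span n W'"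
    using orth_proj_in_span[OF W y] sub by (intro vec_span_add[OF W'(2)] vec_span_smult[OF W'(2)] rS) auto
  from rss_minimal[OF W'(1,2) y this]
  have "rss n W' y \<le> (?z - c \<cdot>\<^sub>v r) \<bullet> (?z - c \<cdot>\<^sub>v r)"
  proof -
    have "y - (?H *\<^sub>v y + c \<cdot>\<^sub>v r) = ?z - c \<cdot>\<^sub>v r" by (rule vec_diff_add_right) (use y Hm rc in auto)
    then show ?thesis using \<open>rss n W' y \<le> _\<close> by simp
  qed
  also have "\<dots> = ?z \<bullet> ?z - 2 * c * (r \<bullet> ?z) + c\<^sup>2 * (r \<bullet> r)"
    using zc rc comm_scalar_prod[OF zc rc]
    by (simp add: minus_scalar_prod_distrib[of _ n] scalar_prod_minus_distrib[of _ n] power2_eq_square algebra_simps)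
  also have "r \<bullet> ?z = r \<bullet> y"
  proof -
    have "(?H *\<^sub>v y) \<bullet> r = 0" unfolding r_def by (rule residual_orth[OF W mc orth_proj_in_span[OF W y]])
    then show ?thesis using rc y Hm comm_scalar_prod[OF rc Hm(2)] by (simp add: scalar_prod_minus_distrib[of _ n])
  qed
  also have "?z \<bullet> ?z = rss n W y" by (rule rss_eq[OF W y, symmetric])
  also have "rss n W y - 2 * c * (r \<bullet> y) + c\<^sup>2 * (r \<bullet> r) = rss n W y - (r \<bullet> y)\<^sup>2 / (r \<bullet> r)"
    using rr by (simp add: c_def field_simps power2_eq_square)
  finally show ?thesis by simp
qed

text \<open>The vectors depend on the two spaces only and not on \<open>y\<close>, so that the chi-square bound applies to them.\<close>

lemma rss_diff_energy:
  assumes W: "finite W" "W \<subseteq> carrier_vec n" and V: "finite V" "V \<subseteq> carrier_vec n"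
  shows "\<exists>vs. orthonormal n vs \<and> length vs \<le> card V \<and>
    (\<forall>y\<in>carrier_vec n. rss n W y - rss n (W \<union> V) y = energy vs y)"
proof -
  obtain us where us: "orthonormal n us" "real_span n (set us) = real_span n W"
    using span_orthonormal_basis[OF W] by metis
  obtain ws where ws: "set ws = V" "length ws = card V" using finite_distinct_list[OF V(1)] distinct_card by metis
  then obtain vs where vs: "orthonormal n (vs @ us)" "length vs \<le> card V"
    "real_span n (set (vs @ us)) = real_span n (set us \<union> V)"
    using extend_orthonormal[OF us(1), of ws] V by metis
  note usc = orthonormal_carrier[OF us(1)]
  have Vb: "set us \<union> V \<subseteq> carrier_vec n" "W \<union> V \<subseteq> carrier_vec n" using usc V W by auto
  have "set us \<subseteq> real_span n (W \<union> V)" using vec_span_base[OF usc] us(2) vec_span_mono[of W "W \<union> V" n] by blast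
  moreover have "V \<subseteq> real_span n (W \<union> V)" "V \<subseteq> real_span n (set us \<union> V)" using vec_span_base[OF Vb(2)] vec_span_base[OF Vb(1)] by auto
  moreover have "W \<subseteq> real_span n (set us \<union> V)" using vec_span_base[OF W(2)] us(2) vec_span_mono[of "set us" "set us \<union> V" n] by blast
  ultimately have "real_span n (set us \<union> V) = real_span n (W \<union> V)"
    by (intro equalityI vec_span_subset Vb Un_least)
  then have sp: "real_span n (set (vs @ us)) = real_span n (W \<union> V)" using vs(3) by simp
  have "orthonormal n vs" using vs(1) by (induction vs) auto
  moreover have "rss n W y - rss n (W \<union> V) y = energy vs y" if y: "y \<in> carrier_vec n" for y
    using rss_orthonormal[OF W us y] rss_orthonormal[OF _ Vb(2) vs(1) sp y] W V by simp
  ultimately show ?thesis using vs(2) by blast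
qed

section \<open>The smallest eigenvalue and submatrices of columns\<close>

lemma smult_mat_mult_vec:
  assumes "A \<in> carrier_mat nr nc" "v \<in> carrier_vec nc"
  shows "((k::real) \<cdot>\<^sub>m A) *\<^sub>v v = k \<cdot>\<^sub>v (A *\<^sub>v v)"
  using assms by (intro eq_vecI) (auto simp: scalar_prod_def sum_distrib_left mult.assoc)

lemma quadratic_form_bound:
  assumes M: "M \<in> carrier_mat n n" and x: "(x::real Matrix.vec) \<in> carrier_vec n"
  shows "\<bar>x \<bullet> (M *\<^sub>v x)\<bar> \<le> (\<Sum>i<n. \<Sum>j<n. \<bar>M $$ (i, j)\<bar>) * (x \<bullet> x)"
proof -
  have xi: "\<bar>x $ i\<bar> \<le> sqrt (x \<bullet> x)" if "i < n" for i
    using that x by (intro real_le_rsqrt) (auto simp: dot_self intro!: member_le_sum)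
  have "x \<bullet> (M *\<^sub>v x) = (\<Sum>i<n. \<Sum>j<n. x $ i * (M $$ (i, j) * x $ j))"
    using M x by (auto simp: scalar_prod_def lessThan_atLeast0 sum_distrib_left intro!: sum.cong)
  also have "\<bar>\<dots>\<bar> \<le> (\<Sum>i<n. \<Sum>j<n. \<bar>x $ i * (M $$ (i, j) * x $ j)\<bar>)"
    by (intro order_trans[OF sum_abs] sum_mono) simp
  also have "\<dots> \<le> (\<Sum>i<n. \<Sum>j<n. \<bar>M $$ (i, j)\<bar> * (x \<bullet> x))"
  proof (intro sum_mono)
    fix i j assume "i \<in> {..<n}" "j \<in> {..<n}"
    then have "\<bar>x $ i\<bar> * \<bar>x $ j\<bar> \<le> sqrt (x \<bullet> x) * sqrt (x \<bullet> x)" by (intro mult_mono xi) auto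
    then have "\<bar>M $$ (i, j)\<bar> * (\<bar>x $ i\<bar> * \<bar>x $ j\<bar>) \<le> \<bar>M $$ (i, j)\<bar> * (x \<bullet> x)" by (intro mult_left_mono) auto
    then show "\<bar>x $ i * (M $$ (i, j) * x $ j)\<bar> \<le> \<bar>M $$ (i, j)\<bar> * (x \<bullet> x)" by (simp add: abs_mult mult_ac)
  qed
  finally show ?thesis by (simp add: sum_distrib_right)
qed

lemma discriminant_le_0:
  fixes a b c :: real
  assumes nonneg: "\<And>t. 0 \<le> a - 2 * t * b + t\<^sup>2 * c" and c: "0 \<le> c"
  shows "b\<^sup>2 \<le> a * c"
proof (cases "c = 0")
  case True
  have "b = 0"
  proof (rule ccontr)
    assume "b \<noteq> 0"
    then show False using nonneg[of "(a + 1) / (2 * b)"] True by simp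
  qed
  then show ?thesis using True by simp
next
  case False
  then show ?thesis using nonneg[of "b / c"] c by (simp add: field_simps power2_eq_square)
qed

lemma psd_cauchy_schwarz:
  assumes B: "B \<in> carrier_mat n n" and sym: "B\<^sup>T = B"
    and psd: "\<And>x. x \<in> carrier_vec n \<Longrightarrow> 0 \<le> x \<bullet> (B *\<^sub>v x)"
    and x: "x \<in> carrier_vec n" and z: "(z::real Matrix.vec) \<in> carrier_vec n"
  shows "(x \<bullet> (B *\<^sub>v z))\<^sup>2 \<le> (x \<bullet> (B *\<^sub>v x)) * (z \<bullet> (B *\<^sub>v z))"
proof (rule discriminant_le_0)
  have Bx: "B *\<^sub>v x \<in> carrier_vec n" "B *\<^sub>v z \<in> carrier_vec n" using B x z by auto
  have zx: "z \<bullet> (B *\<^sub>v x) = x \<bullet> (B *\<^sub>v z)"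
    using transpose_vec_mult_scalar[OF B x z] comm_scalar_prod[OF x Bx(2)] unfolding sym by simp
  fix t :: real
  have "x - t \<cdot>\<^sub>v z \<in> carrier_vec n" using x z by auto
  from psd[OF this] show "0 \<le> x \<bullet> (B *\<^sub>v x) - 2 * t * (x \<bullet> (B *\<^sub>v z)) + t\<^sup>2 * (z \<bullet> (B *\<^sub>v z))"
    using x z Bx zx
    by (simp add: mult_minus_distrib_mat_vec[OF B] mult_mat_vec[OF B]
       minus_scalar_prod_distrib[of _ n] scalar_prod_minus_distrib[of _ n] power2_eq_square algebra_simps)
next
  show "0 \<le> z \<bullet> (B *\<^sub>v z)" by (rule psd[OF z])
qed

text \<open>The infimum \<open>\<mu>\<close> of the Rayleigh quotient is an eigenvalue: otherwise \<open>M - \<mu>\<close> has an inverse \<open>K\<close>, and the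
Cauchy-Schwarz inequality for the positive semidefinite form of \<open>M - \<mu>\<close>, applied to \<open>x\<close> and \<open>K x\<close>, bounds that
form away from 0 on unit vectors, against the choice of \<open>\<mu>\<close>. This replaces a compactness argument.\<close>

lemma rayleigh_min_eigenvalue:
  assumes M: "M \<in> carrier_mat n n" and sym: "M\<^sup>T = M" and n: "0 < n"
    and x: "(x::real Matrix.vec) \<in> carrier_vec n"
  shows "min_eigenvalue M * (x \<bullet> x) \<le> x \<bullet> (M *\<^sub>v x)"
proof -
  define Q where "Q = {x \<bullet> (M *\<^sub>v x) | x. x \<in> carrier_vec n \<and> x \<bullet> x = 1}"
  define \<mu> where "\<mu> = Inf Q"
  have "- (\<Sum>i<n. \<Sum>j<n. \<bar>M $$ (i, j)\<bar>) \<le> q" if "q \<in> Q" for q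
    using that quadratic_form_bound[OF M] by (force simp: Q_def abs_le_iff)
  then have bdd: "bdd_below Q" by (intro bdd_belowI)
  have ne: "Q \<noteq> {}" using n by (auto simp: Q_def intro!: exI[of _ "unit_vec n 0"])
  have ray: "\<mu> * (x \<bullet> x) \<le> x \<bullet> (M *\<^sub>v x)" if x: "x \<in> carrier_vec n" for x
  proof (cases "x \<bullet> x = 0")
    case True
    then show ?thesis using dot_self_eq_0[OF x True] M by auto
  next
    case False
    then have pos: "0 < x \<bullet> x" using dot_self_nonneg[of x] by linarith
    define w where "w = (1 / sqrt (x \<bullet> x)) \<cdot>\<^sub>v x"
    have "w \<bullet> w = 1" using x pos by (simp add: w_def)
    moreover have "w \<bullet> (M *\<^sub>v w) = x \<bullet> (M *\<^sub>v x) / (x \<bullet> x)"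
      using x pos M mult_mat_vec_carrier[OF M x] by (simp add: w_def mult_mat_vec[OF M])
    moreover have "w \<in> carrier_vec n" using x by (simp add: w_def)
    ultimately have "x \<bullet> (M *\<^sub>v x) / (x \<bullet> x) \<in> Q" by (force simp: Q_def)
    then have "\<mu> \<le> x \<bullet> (M *\<^sub>v x) / (x \<bullet> x)" unfolding \<mu>_def by (rule cInf_lower[OF _ bdd])
    then show ?thesis using pos by (simp add: field_simps)
  qed
  have ev: "eigenvalue M \<mu>"
  proof (rule ccontr)
    assume "\<not> eigenvalue M \<mu>"
    define B where "B = char_matrix M \<mu>"
    have B: "B \<in> carrier_mat n n" using M by (simp add: B_def)
    have "det B \<noteq> 0" using \<open>\<not> eigenvalue M \<mu>\<close> eigenvalue_det[OF M] by (simp add: B_def)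
    then obtain K where K: "K \<in> carrier_mat n n" "B * K = 1\<^sub>m n"
      using det_non_zero_imp_unit[OF B] by (auto simp: Units_def ring_mat_def)
    have symB: "B\<^sup>T = B"
    proof (rule eq_matI)
      fix i j assume ij: "i < dim_row B" "j < dim_col B"
      have "M $$ (j, i) = M $$ (i, j)" using arg_cong[OF sym, of "\<lambda>A. A $$ (i, j)"] ij B M by auto
      then show "B\<^sup>T $$ (i, j) = B $$ (i, j)" using ij B M by (auto simp: B_def char_matrix_def)
    qed (use B in auto)
    have Bx: "B *\<^sub>v x = M *\<^sub>v x - \<mu> \<cdot>\<^sub>v x" if "x \<in> carrier_vec n" for x
    proof -
      have "B *\<^sub>v x = M *\<^sub>v x + (- \<mu>) \<cdot>\<^sub>v x"
        using that M by (simp add: B_def char_matrix_def add_mult_distrib_mat_vec[of _ n n] smult_mat_mult_vec[of _ n n])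
      then show ?thesis using that mult_mat_vec_carrier[OF M that] by (intro eq_vecI) auto
    qed
    have qB: "x \<bullet> (B *\<^sub>v x) = x \<bullet> (M *\<^sub>v x) - \<mu> * (x \<bullet> x)" if "x \<in> carrier_vec n" for x
      using that mult_mat_vec_carrier[OF M that] by (simp add: Bx scalar_prod_minus_distrib[of _ n])
    \<comment> \<open>The summand 1 keeps the constant positive.\<close>
    define C where "C = (\<Sum>i<n. \<Sum>j<n. \<bar>K $$ (i, j)\<bar>) + 1"
    have C: "0 < C" unfolding C_def by (intro add_nonneg_pos sum_nonneg) auto
    have "\<mu> + 1 / C \<le> q" if "q \<in> Q" for q
    proof -
      from that obtain x where x: "x \<in> carrier_vec n" "x \<bullet> x = 1" "q = x \<bullet> (M *\<^sub>v x)" by (auto simp: Q_def)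
      let ?z = "K *\<^sub>v x"
      have z: "?z \<in> carrier_vec n" using K x by auto
      have "B *\<^sub>v ?z = x" using K B x by (simp add: assoc_mult_mat_vec[symmetric])
      moreover have "(x \<bullet> (B *\<^sub>v ?z))\<^sup>2 \<le> (x \<bullet> (B *\<^sub>v x)) * (?z \<bullet> (B *\<^sub>v ?z))"
        by (rule psd_cauchy_schwarz[OF B symB _ x(1) z]) (use ray qB in force)
      moreover have "?z \<bullet> x \<le> C"
        using quadratic_form_bound[OF K(1) x(1)] x(2) comm_scalar_prod[OF x(1) z] by (simp add: C_def)
      moreover have "0 \<le> x \<bullet> (B *\<^sub>v x)" using qB[OF x(1)] ray[OF x(1)] by simp
      ultimately have "1 \<le> (x \<bullet> (B *\<^sub>v x)) * C"
        using x(2) by (smt (verit) mult_left_mono one_power2)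
      then show ?thesis using qB[OF x(1)] x C by (simp add: field_simps)
    qed
    then have "\<mu> + 1 / C \<le> \<mu>" unfolding \<mu>_def by (intro cInf_greatest ne)
    then show False using C by simp
  qed
  have "min_eigenvalue M \<le> \<mu>" unfolding min_eigenvalue_def
    using ev card_finite_spectrum[OF M] by (intro Min_le) (auto simp: spectrum_def)
  then have "min_eigenvalue M * (x \<bullet> x) \<le> \<mu> * (x \<bullet> x)" by (intro mult_right_mono) auto
  also have "\<dots> \<le> x \<bullet> (M *\<^sub>v x)" by (rule ray[OF x])
  finally show ?thesis .
qed

lemma dim_subcols:
  assumes "X \<in> carrier_mat n p" "A \<subseteq> {..<p}"
  shows "subcols X A \<in> carrier_mat n (card A)"
proof -
  have "{j. j < p \<and> j \<in> A} = A" using assms by auto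
  then have "dim_col (subcols X A) = card A" "dim_row (subcols X A) = n"
    using assms(1) unfolding subcols_def dim_submatrix by simp_all
  then show ?thesis by (intro carrier_matI)
qed

lemma subcols_index:
  assumes "X \<in> carrier_mat n p" "A \<subseteq> {..<p}" "i < n" "j < card A"
  shows "subcols X A $$ (i, j) = X $$ (i, pick A j)"
proof -
  have "card {j. j < p \<and> j \<in> A} = card A" using assms(2) by (intro arg_cong[where f = card]) auto
  then have "j < card {j. j < dim_col X \<and> j \<in> A}" "i < card {i. i < dim_row X \<and> i \<in> UNIV}"
    using assms by simp_all
  then show ?thesis unfolding subcols_def by (simp add: submatrix_index pick_UNIV)
qed

lemma bij_betw_pick:
  assumes "finite A" shows "bij_betw (pick A) {..<card A} A"
proof -
  have inj: "inj_on (pick A) {..<card A}"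
    by (rule linorder_inj_onI) (use pick_mono_le[of _ A] in force)+
  have sub: "pick A ` {..<card A} \<subseteq> A" using pick_in_set_le by auto
  have "card (pick A ` {..<card A}) = card A" using card_image[OF inj] by simp
  then have "pick A ` {..<card A} = A" using card_subset_eq[OF assms sub] by simp
  then show ?thesis using inj by (simp add: bij_betw_def)
qed

lemma set_cols_subcols:
  assumes "X \<in> carrier_mat n p" "A \<subseteq> {..<p}"
  shows "set (cols (subcols X A)) = col X ` A"
proof -
  note d = dim_subcols[OF assms]
  have fin: "finite A" using assms(2) finite_subset by blast
  have "col (subcols X A) j = col X (pick A j)" if "j < card A" for j
  proof (rule eq_vecI)
    have "pick A j < p" using pick_in_set_le[OF that] assms(2) by auto
    then show "col (subcols X A) j $ i = col X (pick A j) $ i" if "i < dim_vec (col X (pick A j))" for i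
      using subcols_index[OF assms _ \<open>j < card A\<close>, of i] d that assms(1) \<open>j < card A\<close> by auto
  qed (use d assms in auto)
  then have "set (cols (subcols X A)) = (\<lambda>j. col X (pick A j)) ` {..<card A}"
    using d by (auto simp: cols_def)
  also have "\<dots> = col X ` (pick A ` {..<card A})" by (simp add: image_image)
  also have "pick A ` {..<card A} = A" using bij_betw_pick[OF fin] by (simp add: bij_betw_def)
  finally show ?thesis .
qed

lemma subcols_full:
  assumes "X \<in> carrier_mat n p" shows "subcols X {..<p} = X"
proof (rule eq_matI)
  have d: "subcols X {..<p} \<in> carrier_mat n p" using dim_subcols[OF assms order_refl] by simp
  fix i j assume "i < dim_row X" "j < dim_col X"
  then have ij: "i < n" "j < p" using assms by auto
  have "pick {..<p} j = j"
  proof -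
    have "{a \<in> {..<p}. a < j} = {..<j}" using ij by auto
    then show ?thesis using pick_card_in_set[of j "{..<p}"] ij by simp
  qed
  then show "subcols X {..<p} $$ (i, j) = X $$ (i, j)" using subcols_index[OF assms order_refl, of i j] ij by simp
qed (use assms dim_subcols[OF assms order_refl] in auto)

text \<open>This allows the true mean to be written with the full design matrix and a sparse coefficient vector, which
turns statements about submodels into statements about supports.\<close>

lemma subcols_mult_subvec:
  assumes X: "X \<in> carrier_mat n p" and A: "A \<subseteq> {..<p}" and b: "b \<in> carrier_vec p"
    and supp: "\<And>i. i < p \<Longrightarrow> i \<notin> A \<Longrightarrow> b $ i = 0"
  shows "subcols X A *\<^sub>v subvec b A = X *\<^sub>v b"
proof (rule eq_vecI)
  note d = dim_subcols[OF X A]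
  have fin: "finite A" using A finite_subset by blast
  fix i assume "i < dim_vec (X *\<^sub>v b)"
  then have i: "i < n" using X by simp
  have "(subcols X A *\<^sub>v subvec b A) $ i = (\<Sum>j<card A. X $$ (i, pick A j) * b $ pick A j)"
    using d i subcols_index[OF X A i] by (auto simp: scalar_prod_def subvec_def lessThan_atLeast0 intro!: sum.cong)
  also have "\<dots> = (\<Sum>k\<in>A. X $$ (i, k) * b $ k)"
    by (rule sum.reindex_bij_betw[OF bij_betw_pick[OF fin]])
  also have "\<dots> = (\<Sum>k<p. X $$ (i, k) * b $ k)"
    by (rule sum.mono_neutral_left) (use A supp in auto)
  also have "\<dots> = (X *\<^sub>v b) $ i"
    using X b i by (auto simp: scalar_prod_def lessThan_atLeast0 intro!: sum.cong)
  finally show "(subcols X A *\<^sub>v subvec b A) $ i = (X *\<^sub>v b) $ i" .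
qed (use dim_subcols[OF X A] X in auto)

text \<open>The eigenvalue condition is used for the full model; for submodels it is inherited through vectors with
smaller support.\<close>

lemma gram_lower_bound:
  assumes X: "X \<in> carrier_mat n p" and n: "0 < n" and p: "0 < p"
    and eigen: "\<zeta> \<le> min_eigenvalue ((1 / real n) \<cdot>\<^sub>m ((subcols X {..<p})\<^sup>T * subcols X {..<p}))"
    and b: "b \<in> carrier_vec p"
  shows "\<zeta> * real n * (b \<bullet> b) \<le> (X *\<^sub>v b) \<bullet> (X *\<^sub>v b)"
proof -
  let ?M = "(1 / real n) \<cdot>\<^sub>m (X\<^sup>T * X)"
  have M: "?M \<in> carrier_mat p p" and XT: "X\<^sup>T \<in> carrier_mat p n" using X by auto
  have "(X\<^sup>T * X)\<^sup>T = X\<^sup>T * X" using transpose_mult[OF XT X] by simp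
  then have sym: "?M\<^sup>T = ?M" using X by (intro eq_matI) (auto simp: transpose_mat_def mat_eq_iff)
  have "\<zeta> * (b \<bullet> b) \<le> min_eigenvalue ?M * (b \<bullet> b)"
    using eigen subcols_full[OF X] by (intro mult_right_mono) auto
  also have "\<dots> \<le> b \<bullet> (?M *\<^sub>v b)" by (rule rayleigh_min_eigenvalue[OF M sym p b])
  also have "?M *\<^sub>v b = (1 / real n) \<cdot>\<^sub>v (X\<^sup>T *\<^sub>v (X *\<^sub>v b))"
    using X b XT by (subst smult_mat_mult_vec[of _ p p]) auto
  also have "b \<bullet> \<dots> = (X *\<^sub>v b) \<bullet> (X *\<^sub>v b) / real n"
    using transpose_vec_mult_scalar[OF X b, of "X *\<^sub>v b"] X b XT
      comm_scalar_prod[of b p "X\<^sup>T *\<^sub>v (X *\<^sub>v b)"] by auto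
  finally show ?thesis using n by (simp add: field_simps)
qed

section \<open>The design matrix\<close>

locale design =
  fixes n p :: nat and X :: "real mat" and \<zeta> :: real
  assumes X: "X \<in> carrier_mat n p" and n_pos: "0 < n" and \<zeta>_pos: "0 < \<zeta>"
    and centered: "\<And>i. i < p \<Longrightarrow> ones n \<bullet> col X i = 0"
    and gram: "\<And>b. b \<in> carrier_vec p \<Longrightarrow> \<zeta> * real n * (b \<bullet> b) \<le> (X *\<^sub>v b) \<bullet> (X *\<^sub>v b)"
begin

text \<open>Model \<open>A\<close> without (\<open>cols0\<close>) and with (\<open>cols1\<close>) the intercept: the correlation condition refers to the former, the
coefficient of determination to the latter.\<close>

definition cols0 :: "nat set \<Rightarrow> real Matrix.vec set" where
  "cols0 A = col X ` A"

definition cols1 :: "nat set \<Rightarrow> real Matrix.vec set" where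
  "cols1 A = insert (ones n) (col X ` A)"

lemma ones_carrier [simp]: "ones n \<in> carrier_vec n"
  by (simp add: ones_def)

lemma col_carrier [simp]: "col X k \<in> carrier_vec n"
  using X by auto

lemma cols_carrier: "cols0 A \<subseteq> carrier_vec n" "cols1 A \<subseteq> carrier_vec n"
  by (auto simp: cols0_def cols1_def)

lemma finite_cols: "A \<subseteq> {..<p} \<Longrightarrow> finite (cols0 A)" "A \<subseteq> {..<p} \<Longrightarrow> finite (cols1 A)"
  using finite_subset by (auto simp: cols0_def cols1_def)

lemma mult_X_carrier [simp]: "b \<in> carrier_vec p \<Longrightarrow> X *\<^sub>v b \<in> carrier_vec n"
  using X by auto

lemma ones_orth: 
  assumes b: "b \<in> carrier_vec p" shows "ones n \<bullet> (X *\<^sub>v b) = 0"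
proof -
  have "X\<^sup>T *\<^sub>v ones n = 0\<^sub>v p"
  proof (rule eq_vecI)
    fix i assume "i < dim_vec (0\<^sub>v p :: real Matrix.vec)"
    then show "(X\<^sup>T *\<^sub>v ones n) $ i = 0\<^sub>v p $ i"
      using X centered[of i] comm_scalar_prod[OF ones_carrier col_carrier, of i] by simp
  qed (use X in auto)
  then show ?thesis using transpose_vec_mult_scalar[OF X b ones_carrier] b by simp
qed

lemma col_eq_mult_unit: "k < p \<Longrightarrow> col X k = X *\<^sub>v unit_vec p k"
  using X by (intro eq_vecI) auto

definition supported :: "nat set \<Rightarrow> real Matrix.vec \<Rightarrow> bool" where
  "supported A b \<longleftrightarrow> b \<in> carrier_vec p \<and> (\<forall>i<p. i \<notin> A \<longrightarrow> b $ i = 0)"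

lemma supported_closure:
  "supported A (0\<^sub>v p)" "k \<in> A \<Longrightarrow> k < p \<Longrightarrow> supported A (unit_vec p k)"
  "supported A b \<Longrightarrow> supported A b' \<Longrightarrow> supported A (b + b')" "supported A b \<Longrightarrow> supported A (c \<cdot>\<^sub>v b)"
  by (auto simp: supported_def)

lemma span_cols1_elim:
  assumes "x \<in> real_span n (cols1 A)" "A \<subseteq> {..<p}"
  shows "\<exists>c b. supported A b \<and> x = c \<cdot>\<^sub>v ones n + X *\<^sub>v b"
  using cols_carrier(2)[of A] assms(1)
proof (induction rule: vec_span_induct)
  case zero
  show ?case using X by (intro exI[of _ 0] exI[of _ "0\<^sub>v p"]) (auto simp: supported_closure ones_def)
next
  case (base w)
  then consider "w = ones n" | k where "k \<in> A" "w = col X k" by (auto simp: cols1_def)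
  then show ?case
  proof cases
    case 1
    then show ?thesis using X by (intro exI[of _ 1] exI[of _ "0\<^sub>v p"]) (auto simp: supported_closure ones_def)
  next
    case 2
    then have "k < p" using assms(2) by auto
    then show ?thesis using 2 col_eq_mult_unit[of k] X
      by (intro exI[of _ 0] exI[of _ "unit_vec p k"]) (auto simp: supported_closure ones_def)
  qed
next
  case (add x y)
  then obtain c b c' b' where *: "supported A b" "x = c \<cdot>\<^sub>v ones n + X *\<^sub>v b" "supported A b'" "y = c' \<cdot>\<^sub>v ones n + X *\<^sub>v b'"
    by blast
  have "b \<in> carrier_vec p" "b' \<in> carrier_vec p" using * by (auto simp: supported_def)
  then have "X *\<^sub>v (b + b') = X *\<^sub>v b + X *\<^sub>v b'" by (rule mult_add_distrib_mat_vec[OF X])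
  moreover have "dim_vec (X *\<^sub>v b) = n" "dim_vec (X *\<^sub>v b') = n" using X by auto
  ultimately have "x + y = (c + c') \<cdot>\<^sub>v ones n + X *\<^sub>v (b + b')"
    unfolding * by (intro eq_vecI) (auto simp: ones_def algebra_simps simp del: index_mult_mat_vec)
  then show ?case using supported_closure(3)[OF *(1,3)] by blast
next
  case (smult k x)
  then obtain c b where *: "supported A b" "x = c \<cdot>\<^sub>v ones n + X *\<^sub>v b" by blast
  have "b \<in> carrier_vec p" using * by (auto simp: supported_def)
  then have "X *\<^sub>v (k \<cdot>\<^sub>v b) = k \<cdot>\<^sub>v (X *\<^sub>v b)" by (rule mult_mat_vec[OF X])
  moreover have "dim_vec (X *\<^sub>v b) = n" using X by auto
  ultimately have "k \<cdot>\<^sub>v x = (k * c) \<cdot>\<^sub>v ones n + X *\<^sub>v (k \<cdot>\<^sub>v b)"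
    unfolding * by (intro eq_vecI) (auto simp: ones_def algebra_simps simp del: index_mult_mat_vec)
  then show ?case using supported_closure(4)[OF *(1)] by blast
qed

lemma span_cols01: "real_span n (cols0 A) \<subseteq> real_span n (cols1 A)"
  by (rule vec_span_mono) (auto simp: cols0_def cols1_def)

lemma mean_in_span:
  assumes "supported A b" shows "X *\<^sub>v b \<in> real_span n (cols0 A)"
proof -
  have b: "b \<in> carrier_vec p" using assms by (simp add: supported_def)
  interpret vec_space "TYPE(real)" n .
  have "X *\<^sub>v Matrix.vec p (\<lambda>i. if i < k then b $ i else 0) \<in> real_span n (cols0 A)" if "k \<le> p" for k
    using that
  proof (induction k)
    case 0
    have "Matrix.vec p (\<lambda>i. if i < 0 then b $ i else 0) = 0\<^sub>v p" by auto
    moreover have "X *\<^sub>v 0\<^sub>v p = 0\<^sub>v n" using X by (intro eq_vecI) auto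
    ultimately show ?case using span_zero[of "cols0 A"] by simp
  next
    case (Suc k)
    let ?w = "Matrix.vec p (\<lambda>i. if i < k then b $ i else 0)"
    have k: "k < p" using Suc by simp
    have "Matrix.vec p (\<lambda>i. if i < Suc k then b $ i else 0) = ?w + b $ k \<cdot>\<^sub>v unit_vec p k"
      using k by (intro eq_vecI) (auto simp: less_Suc_eq)
    then have eq: "X *\<^sub>v Matrix.vec p (\<lambda>i. if i < Suc k then b $ i else 0) = X *\<^sub>v ?w + b $ k \<cdot>\<^sub>v col X k"
      using mult_add_distrib_mat_vec[OF X, of ?w "b $ k \<cdot>\<^sub>v unit_vec p k"] mult_mat_vec[OF X, of "unit_vec p k" "b $ k"]
        col_eq_mult_unit[OF k] by simp
    have IH: "X *\<^sub>v ?w \<in> real_span n (cols0 A)" using Suc by simp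
    show ?case
    proof (cases "k \<in> A")
      case True
      then have "col X k \<in> real_span n (cols0 A)" using cols_carrier(1) by (intro vec_span_base) (auto simp: cols0_def)
      then show ?thesis unfolding eq by (intro vec_span_add[OF cols_carrier(1) IH] vec_span_smult[OF cols_carrier(1)])
    next
      case False
      then have "b $ k = 0" using assms k by (simp add: supported_def)
      moreover have "X *\<^sub>v ?w \<in> carrier_vec n" by simp
      ultimately have "X *\<^sub>v ?w + b $ k \<cdot>\<^sub>v col X k = X *\<^sub>v ?w" using X by (intro eq_vecI) auto
      then show ?thesis unfolding eq using IH by simp
    qed
  qed
  from this[of p] have "X *\<^sub>v Matrix.vec p (\<lambda>i. if i < p then b $ i else 0) \<in> real_span n (cols0 A)" by simp
  also have "Matrix.vec p (\<lambda>i. if i < p then b $ i else 0) = b" using b by (intro eq_vecI) auto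
  finally show ?thesis .
qed

text \<open>A vector of the span is \<open>c 1 + X b'\<close> with \<open>b'\<close> supported in \<open>A\<close>. The intercept part is orthogonal to the rest and
can only increase the distance, and \<open>b - b'\<close> agrees with \<open>b\<close> outside \<open>A\<close>.\<close>

lemma dist_span_lower_bound:
  assumes A: "A \<subseteq> {..<p}" and b: "b \<in> carrier_vec p" and w: "w \<in> real_span n (cols1 A)"
  shows "\<zeta> * real n * (\<Sum>i\<in>{..<p} - A. (b $ i)\<^sup>2) \<le> (X *\<^sub>v b - w) \<bullet> (X *\<^sub>v b - w)"
proof -
  obtain c b' where b': "supported A b'" "w = c \<cdot>\<^sub>v ones n + X *\<^sub>v b'" using span_cols1_elim[OF w A] by blast
  have b'c: "b' \<in> carrier_vec p" using b' by (simp add: supported_def)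
  let ?d = "b - b'" and ?o = "c \<cdot>\<^sub>v ones n"
  have d: "?d \<in> carrier_vec p" using b b'c by simp
  have Xd: "X *\<^sub>v ?d = X *\<^sub>v b - X *\<^sub>v b'" by (rule mult_minus_distrib_mat_vec[OF X b b'c])
  have z: "X *\<^sub>v ?d \<in> carrier_vec n" using d by simp
  have "X *\<^sub>v b - w = X *\<^sub>v ?d - ?o"
  proof -
    have "w = X *\<^sub>v b' + ?o" unfolding b'(2) using b'c by (intro comm_add_vec[of _ n]) auto
    then show ?thesis using vec_diff_add_right[of "X *\<^sub>v b" n "X *\<^sub>v b'" ?o] b b'c Xd by simp
  qed
  moreover have "(X *\<^sub>v ?d) \<bullet> ones n = 0" using ones_orth[OF d] comm_scalar_prod[OF z ones_carrier] by simp
  ultimately have "(X *\<^sub>v b - w) \<bullet> (X *\<^sub>v b - w) = (X *\<^sub>v ?d) \<bullet> (X *\<^sub>v ?d) + c\<^sup>2 * (ones n \<bullet> ones n)"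
    using z ones_orth[OF d] smult_scalar_prod_distrib[OF ones_carrier z, of c]
    by (simp add: minus_scalar_prod_distrib[of _ n] scalar_prod_minus_distrib[of _ n] power2_eq_square)
  then have "(X *\<^sub>v ?d) \<bullet> (X *\<^sub>v ?d) \<le> (X *\<^sub>v b - w) \<bullet> (X *\<^sub>v b - w)" by simp
  moreover have "\<zeta> * real n * (?d \<bullet> ?d) \<le> (X *\<^sub>v ?d) \<bullet> (X *\<^sub>v ?d)" by (rule gram[OF d])
  moreover have "\<zeta> * real n * (\<Sum>i\<in>{..<p} - A. (b $ i)\<^sup>2) \<le> \<zeta> * real n * (?d \<bullet> ?d)"
  proof (intro mult_left_mono)
    have "(\<Sum>i\<in>{..<p} - A. (b $ i)\<^sup>2) = (\<Sum>i\<in>{..<p} - A. (?d $ i)\<^sup>2)"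
      using b' b'c b by (intro sum.cong) (auto simp: supported_def)
    also have "\<dots> \<le> (\<Sum>i<p. (?d $ i)\<^sup>2)" by (intro sum_mono2) auto
    finally show "(\<Sum>i\<in>{..<p} - A. (b $ i)\<^sup>2) \<le> ?d \<bullet> ?d" using b'c by (simp add: dot_self)
  qed (use \<zeta>_pos in auto)
  ultimately show ?thesis by linarith
qed

abbreviation "proj0 A \<equiv> orth_proj n (real_span n (cols0 A))"
abbreviation "proj1 A \<equiv> orth_proj n (real_span n (cols1 A))"

lemma proj_model_eq: "A \<subseteq> {..<p} \<Longrightarrow> proj_model n X A = proj0 A"
  "A \<subseteq> {..<p} \<Longrightarrow> proj_model_int n X A = proj1 A"
  "proj_one n = proj1 {}"
  by (simp_all add: proj_model_def proj_model_int_def proj_one_def cols0_def cols1_def set_cols_subcols[OF X])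

lemma one_minus_R_squared:
  assumes A: "A \<subseteq> {..<p}" and y: "y \<in> carrier_vec n" and pos: "0 < rss n (cols1 {}) y"
  shows "1 - R_squared n X y A = rss n (cols1 A) y / rss n (cols1 {}) y"
proof -
  have H: "proj1 A \<in> carrier_mat n n" "proj1 {} \<in> carrier_mat n n"
    using orth_proj_carrier[OF finite_cols(2) cols_carrier(2)] A by auto
  have "(proj1 A - proj1 {}) *\<^sub>v y = proj1 A *\<^sub>v y - proj1 {} *\<^sub>v y"
    by (rule minus_mult_distrib_mat_vec[OF H y])
  then have "y \<bullet> ((proj1 A - proj1 {}) *\<^sub>v y) = y \<bullet> (proj1 A *\<^sub>v y) - y \<bullet> (proj1 {} *\<^sub>v y)"
    using y H by (simp add: scalar_prod_minus_distrib[of _ n])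
  moreover have "rss n (cols1 B) y = y \<bullet> y - y \<bullet> (proj1 B *\<^sub>v y)" if "B \<subseteq> {..<p}" for B
    using y orth_proj_carrier[OF finite_cols(2)[OF that] cols_carrier(2)]
    by (simp add: rss_def residual_mat[OF finite_cols(2)[OF that] cols_carrier(2) y] scalar_prod_minus_distrib[of _ n])
  from this[OF A] this[of "{}"]
  have "rss n (cols1 A) y = y \<bullet> y - y \<bullet> (proj1 A *\<^sub>v y)" "rss n (cols1 {}) y = y \<bullet> y - y \<bullet> (proj1 {} *\<^sub>v y)" by auto
  ultimately have "y \<bullet> ((proj1 A - proj1 {}) *\<^sub>v y) = rss n (cols1 {}) y - rss n (cols1 A) y" by simp
  then show ?thesis using pos
    unfolding R_squared_def proj_model_eq(2)[OF A] proj_model_eq(3) rss_def[symmetric]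
    by (simp add: field_simps)
qed

text \<open>Add the predictors outside \<open>T\<close> one by one and take the residual of each with respect to its predecessors and
\<open>T\<close>. All these residuals occur in the maximum of the correlation condition, and each is orthogonal to the
span in which the earlier ones lie.\<close>

lemma orthogonal_innovations:
  assumes T: "T \<subseteq> {..<p}"
  obtains B k where "\<And>i. i < card ({..<p} - T) \<Longrightarrow> T \<subseteq> B i \<and> B i \<subset> {..<p} \<and> k i \<in> {..<p} - B i"
    "\<And>i j. i < card ({..<p} - T) \<Longrightarrow> j < card ({..<p} - T) \<Longrightarrow> i \<noteq> j \<Longrightarrow>
       (col X (k i) - proj0 (B i) *\<^sub>v col X (k i)) \<bullet> (col X (k j) - proj0 (B j) *\<^sub>v col X (k j)) = 0"
proof -
  let ?N = "card ({..<p} - T)"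
  obtain ks where ks: "set ks = {..<p} - T" "distinct ks" using finite_distinct_list[of "{..<p} - T"] by auto
  then have len: "length ks = ?N" using distinct_card by metis
  define B where "B = (\<lambda>i. T \<union> set (take i ks))"
  define k where "k = (\<lambda>i. ks ! i)"
  have kin: "k i \<in> {..<p} - T" if "i < ?N" for i using that ks(1) len nth_mem[of i ks] by (auto simp: k_def)
  have knot: "k i \<notin> set (take i ks)" if "i < ?N" for i
    using that ks(2) len by (auto simp: k_def in_set_conv_nth nth_eq_iff_index_eq)
  have Bsub: "B i \<subseteq> {..<p}" for i using T ks(1) set_take_subset[of i ks] by (auto simp: B_def)
  have 1: "T \<subseteq> B i \<and> B i \<subset> {..<p} \<and> k i \<in> {..<p} - B i" if "i < ?N" for i
    using Bsub[of i] kin[OF that] knot[OF that] by (auto simp: B_def)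
  define v where "v = (\<lambda>i. col X (k i) - proj0 (B i) *\<^sub>v col X (k i))"
  have lt: "v i \<bullet> v j = 0" if "i < j" "j < ?N" for i j
  proof -
    note f = finite_cols(1)[OF Bsub] cols_carrier(1)
    have sub: "real_span n (cols0 (B i)) \<subseteq> real_span n (cols0 (B j))"
      using that set_take_subset_set_take[of i j ks] by (intro vec_span_mono) (auto simp: cols0_def B_def)
    have "k i \<in> B j" using that len by (auto simp: B_def k_def in_set_conv_nth intro!: exI[of _ i])
    then have "col X (k i) \<in> real_span n (cols0 (B j))" by (intro vec_span_base cols_carrier) (auto simp: cols0_def)
    then have "v i \<in> real_span n (cols0 (B j))" unfolding v_def
      using orth_proj_in_span[OF f, of "col X (k i)" i] sub by (intro vec_span_diff cols_carrier) auto
    from residual_orth[OF f col_carrier this] show ?thesis by (simp add: v_def)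
  qed
  have vc: "v i \<in> carrier_vec n" for i
    unfolding v_def using orth_proj_vec[OF finite_cols(1)[OF Bsub] cols_carrier(1)] by auto
  have 2: "v i \<bullet> v j = 0" if "i < ?N" "j < ?N" "i \<noteq> j" for i j
    using lt[of i j] lt[of j i] that comm_scalar_prod[OF vc vc, of i j] by (cases i j rule: linorder_cases) auto
  show thesis by (rule that[of B k]) (use 1 2 in \<open>auto simp: v_def\<close>)
qed

end

section \<open>The expected maximal correlation and exceptional noise\<close>

context design
begin

lemma residual_mult_eq:
  assumes "B \<subseteq> {..<p}"
  shows "(1\<^sub>m n - proj_model n X B) *\<^sub>v col X k = col X k - proj0 B *\<^sub>v col X k"
  unfolding proj_model_eq(1)[OF assms]
  by (rule residual_mat[OF finite_cols(1)[OF assms] cols_carrier(1) col_carrier])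

text \<open>The normalized innovations are orthonormal, and their lengths are at least \<open>sqrt (\<zeta> n)\<close>. The maximum has to be
shown integrable first, since otherwise its Bochner integral would be 0.\<close>

lemma expected_max_correlation_lower_bound:
  assumes T: "T \<subset> {..<p}" and ab: "0 \<le> b" "b < a"
  defines "N \<equiv> card ({..<p} - T)" and "m \<equiv> (a + b) / 2 - ln 3 / (a - b)"
  assumes m: "0 < m"
  shows "(1 - 8 * exp (a\<^sup>2) / N) * (sqrt \<zeta> * m) \<le>
    (\<integral>z. (MAX B\<in>{B. T \<subseteq> B \<and> B \<subset> {..<p}}. MAX k\<in>{..<p} - B.
            \<bar>((1\<^sub>m n - proj_model n X B) *\<^sub>v col X k) \<bullet> Matrix.vec n z\<bar> / sqrt (real n))
          \<partial>gaussian_noise n 1)" (is "_ \<le> (\<integral>z. ?M z \<partial>?G)")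
proof -
  interpret prob_space ?G by (rule prob_space_gaussian_noise) simp
  let ?BB = "{B. T \<subseteq> B \<and> B \<subset> {..<p}}"
  define res where "res = (\<lambda>B k. (1\<^sub>m n - proj_model n X B) *\<^sub>v col X k)"
  define g where "g = (\<lambda>B k z. \<bar>res B k \<bullet> Matrix.vec n z\<bar> / sqrt (real n))"
  have M_fun: "?M = (\<lambda>z. MAX B\<in>?BB. MAX k\<in>{..<p} - B. g B k z)" by (simp add: g_def res_def)
  have M_eq: "?M z = (MAX B\<in>?BB. MAX k\<in>{..<p} - B. g B k z)" for z by (simp add: g_def res_def)
  have finBB: "finite ?BB" by (rule finite_subset[of _ "Pow {..<p}"]) auto
  have neBB: "?BB \<noteq> {}" using T by auto
  have res: "res B k = col X k - proj0 B *\<^sub>v col X k" if "B \<subset> {..<p}" for B k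
    unfolding res_def using that by (intro residual_mult_eq) auto
  have resc: "res B k \<in> carrier_vec n" if "B \<subset> {..<p}" for B k
    unfolding res[OF that] using orth_proj_vec[OF finite_cols(1) cols_carrier(1)] that by auto
  have gm [measurable]: "g B k \<in> borel_measurable ?G" for B k unfolding g_def by measurable
  have Mm: "?M \<in> borel_measurable ?G" unfolding M_fun by (intro borel_measurable_Max finBB) auto
  have ne: "{..<p} - B \<noteq> {}" if "B \<in> ?BB" for B using that by auto
  have gM: "g B k z \<le> ?M z" if "B \<in> ?BB" "k \<in> {..<p} - B" for B k z
  proof -
    have "g B k z \<le> (MAX k\<in>{..<p} - B. g B k z)" using that by (intro Max_ge) auto
    also have "\<dots> \<le> ?M z" unfolding M_eq using that finBB by (intro Max_ge) auto
    finally show ?thesis .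
  qed
  have M0: "0 \<le> ?M z" for z
  proof -
    from neBB obtain B where B: "B \<in> ?BB" by auto
    with ne[OF B] obtain k where k: "k \<in> {..<p} - B" by auto
    have "0 \<le> g B k z" by (simp add: g_def)
    then show ?thesis using gM[OF B k, of z] by simp
  qed
  have intg: "integrable ?G (g B k)" if "B \<in> ?BB" for B k
  proof (rule Bochner_Integration.integrable_bound)
    let ?r = "res B k"
    have "?r \<in> carrier_vec n" using resc that by auto
    have lap: "integrable ?G (\<lambda>z. exp (v \<bullet> Matrix.vec n z))" if "v \<in> carrier_vec n" for v
      by (rule integrable.intros[OF has_bochner_integral_noise_laplace[of 1]]) (use that in auto)
    have "integrable ?G (\<lambda>z. exp (?r \<bullet> Matrix.vec n z))" by (rule lap) fact
    moreover have "integrable ?G (\<lambda>z. exp ((-1 \<cdot>\<^sub>v ?r) \<bullet> Matrix.vec n z))" by (rule lap) (use \<open>?r \<in> carrier_vec n\<close> in simp)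
    ultimately show "integrable ?G (\<lambda>z. (exp (?r \<bullet> Matrix.vec n z) + exp ((-1 \<cdot>\<^sub>v ?r) \<bullet> Matrix.vec n z)) / sqrt (real n))" by auto
    have *: "\<bar>x\<bar> \<le> exp x + exp (- x)" for x :: real
      using exp_ge_add_one_self[of x] exp_ge_add_one_self[of "- x"] exp_gt_zero[of x] exp_gt_zero[of "- x"] by linarith
    have "(-1 \<cdot>\<^sub>v ?r) \<bullet> Matrix.vec n z = - (?r \<bullet> Matrix.vec n z)" for z
      using \<open>?r \<in> carrier_vec n\<close> by simp
    then show "AE z in ?G. norm (g B k z) \<le> norm ((exp (?r \<bullet> Matrix.vec n z) + exp ((-1 \<cdot>\<^sub>v ?r) \<bullet> Matrix.vec n z)) / sqrt (real n))"
      using * by (auto simp: g_def intro!: divide_right_mono AE_I2)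
  qed (rule gm)
  have intM: "integrable ?G ?M"
  proof (rule Bochner_Integration.integrable_bound[OF _ Mm])
    show "integrable ?G (\<lambda>z. \<Sum>B\<in>?BB. \<Sum>k\<in>{..<p} - B. g B k z)"
      by (intro Bochner_Integration.integrable_sum intg)
    have "?M z \<le> (\<Sum>B\<in>?BB. \<Sum>k\<in>{..<p} - B. g B k z)" for z
    proof -
      have g0: "0 \<le> g B k z" for B k by (simp add: g_def)
      have "(MAX k\<in>{..<p} - B. g B k z) \<le> (\<Sum>B\<in>?BB. \<Sum>k\<in>{..<p} - B. g B k z)" if B: "B \<in> ?BB" for B
      proof -
        have "(MAX k\<in>{..<p} - B. g B k z) \<le> (\<Sum>k\<in>{..<p} - B. g B k z)"
          using ne[OF B] g0 by (subst Max_le_iff) (auto intro!: member_le_sum)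
        also have "\<dots> \<le> (\<Sum>B\<in>?BB. \<Sum>k\<in>{..<p} - B. g B k z)"
          using B finBB g0 by (intro member_le_sum[of B ?BB "\<lambda>B. \<Sum>k\<in>{..<p} - B. g B k z"]) (auto intro!: sum_nonneg)
        finally show ?thesis .
      qed
      then show ?thesis unfolding M_eq using neBB finBB by (subst Max_le_iff) auto
    qed
    then show "AE z in ?G. norm (?M z) \<le> norm (\<Sum>B\<in>?BB. \<Sum>k\<in>{..<p} - B. g B k z)"
      using M0 by (intro AE_I2) (smt (verit) real_norm_def)
  qed
  obtain B k where Bk: "\<And>i. i < N \<Longrightarrow> T \<subseteq> B i \<and> B i \<subset> {..<p} \<and> k i \<in> {..<p} - B i"
    "\<And>i j. i < N \<Longrightarrow> j < N \<Longrightarrow> i \<noteq> j \<Longrightarrow>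
       (col X (k i) - proj0 (B i) *\<^sub>v col X (k i)) \<bullet> (col X (k j) - proj0 (B j) *\<^sub>v col X (k j)) = 0"
    using orthogonal_innovations[of T] T unfolding N_def by blast
  define v where "v = (\<lambda>i. res (B i) (k i))"
  have vc: "v i \<in> carrier_vec n" if "i < N" for i unfolding v_def using Bk(1)[OF that] resc by auto
  have vv: "\<zeta> * real n \<le> v i \<bullet> v i" if "i < N" for i
  proof -
    note Bi = Bk(1)[OF that]
    have kp: "k i < p" and Bs: "B i \<subseteq> {..<p}" using Bi by auto
    have "proj0 (B i) *\<^sub>v col X (k i) \<in> real_span n (cols1 (B i))"
      using orth_proj_in_span[OF finite_cols(1)[OF Bs] cols_carrier(1) col_carrier] span_cols01 by auto
    from dist_span_lower_bound[OF Bs _ this, of "unit_vec p (k i)"]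
    have "\<zeta> * real n * (\<Sum>j\<in>{..<p} - B i. (unit_vec p (k i) $ j)\<^sup>2) \<le> v i \<bullet> v i"
      using Bi unfolding v_def by (simp add: res col_eq_mult_unit[OF kp])
    also have "(\<Sum>j\<in>{..<p} - B i. (unit_vec p (k i) $ j)\<^sup>2) = (\<Sum>j\<in>{..<p} - B i. if j = k i then 1 else 0 :: real)"
      using kp by (intro sum.cong) auto
    also have "\<dots> = 1" using Bi by (simp add: sum.delta)
    finally show ?thesis by simp
  qed
  have vpos: "0 < v i \<bullet> v i" if "i < N" for i
    using vv[OF that] mult_pos_pos[OF \<zeta>_pos, of "real n"] n_pos by simp
  define u where "u = (\<lambda>i. (1 / sqrt (v i \<bullet> v i)) \<cdot>\<^sub>v v i)"
  have uc: "u i \<in> carrier_vec n" if "i < N" for i using vc[OF that] by (simp add: u_def)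
  have uu: "u i \<bullet> u j = (if i = j then 1 else 0)" if "i < N" "j < N" for i j
  proof (cases "i = j")
    case True
    then show ?thesis using vc[OF that(1)] vpos[OF that(1)] by (simp add: u_def)
  next
    case False
    have "v i \<bullet> v j = 0" using Bk(2)[OF that False] Bk(1)[OF that(1)] Bk(1)[OF that(2)] by (simp add: v_def res)
    then show ?thesis using vc[OF that(1)] vc[OF that(2)] False by (simp add: u_def)
  qed
  have N: "0 < N" using T by (auto simp: N_def card_gt_0_iff)
  let ?E = "{e \<in> space ?G. \<exists>i<N. m \<le> u i \<bullet> Matrix.vec n e}"
  have pE: "1 - 8 * exp (a\<^sup>2) / N \<le> prob ?E"
    unfolding m_def by (rule noise_orthonormal_max_lower_bound[OF uc uu N ab])
  have Em: "?E \<in> events" by measurable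
  have EM: "sqrt \<zeta> * m * indicator ?E z \<le> ?M z" for z
  proof (cases "z \<in> ?E")
    case True
    then obtain i where i: "i < N" "m \<le> u i \<bullet> Matrix.vec n z" by auto
    have s: "sqrt \<zeta> * sqrt (real n) \<le> sqrt (v i \<bullet> v i)" using vv[OF i(1)] by (simp add: real_sqrt_mult[symmetric])
    have ue: "v i \<bullet> Matrix.vec n z = sqrt (v i \<bullet> v i) * (u i \<bullet> Matrix.vec n z)"
      using vc[OF i(1)] vpos[OF i(1)] by (simp add: u_def)
    have "sqrt \<zeta> * m * sqrt (real n) \<le> sqrt (v i \<bullet> v i) * (u i \<bullet> Matrix.vec n z)"
      using mult_mono[OF s i(2)] m by (simp add: mult_ac)
    also have "\<dots> \<le> \<bar>v i \<bullet> Matrix.vec n z\<bar>" unfolding ue by simp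
    finally have "sqrt \<zeta> * m \<le> g (B i) (k i) z"
      using n_pos by (simp add: g_def v_def field_simps)
    also have "\<dots> \<le> ?M z" using Bk(1)[OF i(1)] by (intro gM) auto
    finally show ?thesis using True by simp
  next
    case False
    then show ?thesis using M0[of z] by simp
  qed
  have "(1 - 8 * exp (a\<^sup>2) / N) * (sqrt \<zeta> * m) \<le> prob ?E * (sqrt \<zeta> * m)"
    using pE m \<zeta>_pos by (intro mult_right_mono) auto
  also have "\<dots> = (\<integral>z. sqrt \<zeta> * m * indicator ?E z \<partial>?G)" using Em by simp
  also have "\<dots> \<le> (\<integral>z. ?M z \<partial>?G)"
  proof (rule integral_mono[OF _ intM EM])
    show "integrable ?G (\<lambda>z. sqrt \<zeta> * m * indicator ?E z)"
      by (intro integrable_mult_right integrable_real_indicator Em) (simp add: emeasure_eq_measure)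
  qed
  finally show ?thesis .
qed

end

lemma sqrt_sum_le:
  assumes "finite I" "\<And>i. i \<in> I \<Longrightarrow> 0 \<le> f i"
  shows "sqrt (\<Sum>i\<in>I. f i) \<le> (\<Sum>i\<in>I. sqrt (f i))"
  using assms
proof (induction I rule: finite_induct)
  case (insert i I)
  have "sqrt (f i + sum f I) \<le> sqrt (f i) + sqrt (sum f I)"
    using insert by (intro sqrt_add_le_add_sqrt sum_nonneg) auto
  then show ?case using insert by auto
qed simp

text \<open>The number \<open>\<delta>\<close> is the least contribution of a true predictor to the unexplained variation, in units of the
noise variance.\<close>

locale regression = design +
  fixes T :: "nat set" and b :: "real Matrix.vec" and a s \<delta> :: real
  assumes T: "T \<subseteq> {..<p}" and b: "supported T b" and s_pos: "0 < s"
    and \<delta>_pos: "0 < \<delta>"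
    and signal: "\<And>i. i \<in> T \<Longrightarrow> \<delta> * s\<^sup>2 \<le> \<zeta> * real n * (b $ i)\<^sup>2"
begin

abbreviation "noise \<equiv> gaussian_noise n s"
abbreviation "underfitting \<equiv> {A. A \<subseteq> {..<p} \<and> \<not> T \<subseteq> A}"

definition resp :: "(nat \<Rightarrow> real) \<Rightarrow> real Matrix.vec" where
  "resp e = a \<cdot>\<^sub>v ones n + X *\<^sub>v b + Matrix.vec n e"

definition rho :: "nat set \<Rightarrow> (nat \<Rightarrow> real) \<Rightarrow> real" where
  "rho A e = rss n (cols1 A) (resp e) / s\<^sup>2"

lemma b_carrier [simp]: "b \<in> carrier_vec p" using b by (simp add: supported_def)

lemma resp_carrier [simp]: "resp e \<in> carrier_vec n" by (simp add: resp_def)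

lemma response_eq: "response n X T a b e = resp e"
  unfolding response_def resp_def
  using subcols_mult_subvec[OF X T b_carrier] b by (simp add: supported_def)

lemma mean_in_model:
  assumes "T \<subseteq> A" shows "a \<cdot>\<^sub>v ones n + X *\<^sub>v b \<in> real_span n (cols1 A)"
proof -
  have "supported A b" using b assms by (auto simp: supported_def)
  then have "X *\<^sub>v b \<in> real_span n (cols1 A)" using mean_in_span span_cols01 by blast
  moreover have "ones n \<in> real_span n (cols1 A)" by (intro vec_span_base cols_carrier) (simp add: cols1_def)
  ultimately show ?thesis by (intro vec_span_add[OF cols_carrier(2)] vec_span_smult[OF cols_carrier(2)])
qed

lemma rho_noise:
  assumes "T \<subseteq> A" "A \<subseteq> {..<p}" shows "rho A e = rss n (cols1 A) (Matrix.vec n e) / s\<^sup>2"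
  unfolding rho_def resp_def
  using rss_shift[OF finite_cols(2)[OF assms(2)] cols_carrier(2) mean_in_model[OF assms(1)]] by simp

lemma rho_antimono: "A \<subseteq> A' \<Longrightarrow> A' \<subseteq> {..<p} \<Longrightarrow> rho A' e \<le> rho A e"
  unfolding rho_def using s_pos
  by (intro divide_right_mono rss_antimono finite_cols cols_carrier resp_carrier) (auto simp: cols1_def)

lemma vec_dot_self: "Matrix.vec n (e :: nat \<Rightarrow> real) \<bullet> Matrix.vec n e = (\<Sum>i<n. (e i)\<^sup>2)"
  by (simp add: dot_self)

lemma rho_le_noise:
  assumes "T \<subseteq> A" "A \<subseteq> {..<p}" shows "rho A e \<le> (\<Sum>i<n. (e i)\<^sup>2) / s\<^sup>2"
  unfolding rho_noise[OF assms] vec_dot_self[symmetric]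
  using rss_le_dot[OF finite_cols(2)[OF assms(2)] cols_carrier(2)] by (intro divide_right_mono) auto

lemma rho_empty_le: "rho {} e \<le> 2 * ((X *\<^sub>v b) \<bullet> (X *\<^sub>v b)) / s\<^sup>2 + 2 * (\<Sum>i<n. (e i)\<^sup>2) / s\<^sup>2"
proof -
  let ?m = "X *\<^sub>v b" and ?e = "Matrix.vec n e"
  have m: "?m \<in> carrier_vec n" "?e \<in> carrier_vec n" by auto
  have "ones n \<in> real_span n (cols1 {})" by (intro vec_span_base cols_carrier) (simp add: cols1_def)
  then have "rss n (cols1 {}) (a \<cdot>\<^sub>v ones n + (?m + ?e)) = rss n (cols1 {}) (?m + ?e)"
    using m by (intro rss_shift[OF finite_cols(2) cols_carrier(2)] vec_span_smult[OF cols_carrier(2)]) auto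
  also have "a \<cdot>\<^sub>v ones n + (?m + ?e) = resp e"
    unfolding resp_def using m by (intro assoc_add_vec[symmetric]) auto
  also have "rss n (cols1 {}) (?m + ?e) \<le> (?m + ?e) \<bullet> (?m + ?e)"
    using m by (intro rss_le_dot finite_cols cols_carrier) auto
  also have "\<dots> \<le> 2 * (?m \<bullet> ?m) + 2 * (?e \<bullet> ?e)"
  proof -
    have "0 \<le> (?m - ?e) \<bullet> (?m - ?e)" by simp
    then show ?thesis using m comm_scalar_prod[OF m]
      by (simp add: minus_scalar_prod_distrib[of _ n] scalar_prod_minus_distrib[of _ n]
        add_scalar_prod_distrib[of _ n] scalar_prod_add_distrib[of _ n])
  qed
  finally have "rho {} e \<le> (2 * (?m \<bullet> ?m) + 2 * (?e \<bullet> ?e)) / s\<^sup>2"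
    unfolding rho_def by (intro divide_right_mono) auto
  then show ?thesis by (simp add: vec_dot_self add_divide_distrib)
qed

text \<open>Union bound over the sets of extra predictors. By Chernoff's bound a set \<open>J\<close> contributes at most the power
\<open>card J\<close> of one quantity, and the binomial theorem sums these powers.\<close>

lemma overfit_prob:
  fixes c q :: real
  assumes q: "0 < q" "2 * q < 1"
  shows "measure noise {e \<in> space noise. \<exists>J. J \<subseteq> {..<p} - T \<and> J \<noteq> {} \<and> c * card J \<le> rho T e - rho (T \<union> J) e}
     \<le> (1 + exp (- q * c) / sqrt (1 - 2 * q)) ^ card ({..<p} - T) - 1"
proof -
  interpret prob_space noise by (rule prob_space_gaussian_noise[OF s_pos])
  define x where "x = exp (- q * c) / sqrt (1 - 2 * q)"
  let ?N = "{..<p} - T"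
  let ?E = "\<lambda>J. {e \<in> space noise. c * card J \<le> rho T e - rho (T \<union> J) e}"
  have E: "?E J \<in> events \<and> prob (?E J) \<le> x ^ card J" if J: "J \<subseteq> ?N" for J
  proof -
    have fJ: "finite J" using J finite_subset by blast
    have sub: "T \<union> J \<subseteq> {..<p}" using J T by auto
    have cJ: "col X ` J \<subseteq> carrier_vec n" using col_carrier by blast
    obtain vs where vs: "orthonormal n vs" "length vs \<le> card (col X ` J)"
      "\<And>y. y \<in> carrier_vec n \<Longrightarrow> rss n (cols1 T) y - rss n (cols1 T \<union> col X ` J) y = energy vs y"
      using rss_diff_energy[OF finite_cols(2)[OF T] cols_carrier(2), of "col X ` J"] fJ cJ by blast
    have "cols1 T \<union> col X ` J = cols1 (T \<union> J)" by (auto simp: cols1_def)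
    then have rdiff: "rho T e - rho (T \<union> J) e = energy vs (Matrix.vec n e) / s\<^sup>2" for e
      using vs(3)[of "Matrix.vec n e"] T sub by (simp add: rho_noise diff_divide_distrib[symmetric])
    have eq: "?E J = {e \<in> space noise. (c * card J) * s\<^sup>2 \<le> energy vs (Matrix.vec n e)}"
      using s_pos unfolding rdiff by (simp add: pos_le_divide_eq)
    have len: "length vs \<le> card J" using vs(2) card_image_le[OF fJ, of "col X"] by simp
    have "prob (?E J) \<le> exp (- q * (c * card J)) / sqrt (1 - 2 * q) ^ length vs"
      unfolding eq by (rule noise_energy_tail[OF s_pos q vs(1)])
    also have "\<dots> \<le> exp (- q * (c * card J)) / sqrt (1 - 2 * q) ^ card J"
      using q len by (intro divide_left_mono power_decreasing) auto
    also have "\<dots> = x ^ card J"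
      by (simp add: x_def power_divide exp_of_nat_mult[symmetric] mult_ac)
    finally have "prob (?E J) \<le> x ^ card J" .
    moreover have "?E J \<in> events" unfolding eq by measurable
    ultimately show ?thesis by simp
  qed
  have x: "0 \<le> x" using q by (simp add: x_def)
  have "{e \<in> space noise. \<exists>J. J \<subseteq> ?N \<and> J \<noteq> {} \<and> c * card J \<le> rho T e - rho (T \<union> J) e} = (\<Union>J\<in>Pow ?N - {{}}. ?E J)"
    by auto
  then have "prob {e \<in> space noise. \<exists>J. J \<subseteq> ?N \<and> J \<noteq> {} \<and> c * card J \<le> rho T e - rho (T \<union> J) e}
    = prob (\<Union>J\<in>Pow ?N - {{}}. ?E J)" by simp
  also have "\<dots> \<le> (\<Sum>J\<in>Pow ?N - {{}}. prob (?E J))"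
  proof (rule finite_measure_subadditive_finite)
    show "?E ` (Pow ?N - {{}}) \<subseteq> events"
    proof (rule image_subsetI)
      fix J assume "J \<in> Pow ?N - {{}}"
      then have "J \<subseteq> ?N" by auto
      then show "?E J \<in> events" by (rule E[THEN conjunct1])
    qed
  qed simp
  also have "\<dots> \<le> (\<Sum>J\<in>Pow ?N - {{}}. x ^ card J)"
  proof (rule sum_mono)
    fix J assume "J \<in> Pow ?N - {{}}"
    then have "J \<subseteq> ?N" by auto
    then show "prob (?E J) \<le> x ^ card J" by (rule E[THEN conjunct2])
  qed
  also have "\<dots> = (\<Sum>J\<in>Pow ?N. x ^ card J) - 1"
    by (subst sum_diff1) auto
  also have "(\<Sum>J\<in>Pow ?N. x ^ card J) = (1 + x) ^ card ?N"
    using prod_add[of ?N "\<lambda>_. x" "\<lambda>_. 1"] by (simp add: add.commute)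
  finally show ?thesis by (simp add: x_def)
qed

text \<open>The full model removes from the squared length of the noise only the energy of at most \<open>p + 1\<close> directions, which
is negligible if \<open>p\<close> is small compared with \<open>n\<close>.\<close>

lemma rho_full_prob:
  fixes c d q :: real
  assumes q: "0 < q" "2 * q < 1" and c: "0 \<le> c"
  shows "measure noise {e \<in> space noise. rho {..<p} e \<le> c - d}
    \<le> exp (q * c) / sqrt (1 + 2 * q) ^ n + exp (- q * d) / sqrt (1 - 2 * q) ^ (p + 1)"
proof -
  interpret prob_space noise by (rule prob_space_gaussian_noise[OF s_pos])
  obtain us where us: "orthonormal n us" "length us \<le> card (cols1 {..<p})" "real_span n (set us) = real_span n (cols1 {..<p})"
    using span_orthonormal_basis[OF finite_cols(2)[OF order_refl] cols_carrier(2)] by metis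
  have "card (cols1 {..<p}) \<le> Suc (card (col X ` {..<p}))" unfolding cols1_def by (rule card_insert_le_m1) auto
  also have "\<dots> \<le> p + 1" using card_image_le[of "{..<p}" "col X"] by simp
  finally have len: "length us \<le> p + 1" using us(2) by simp
  have rho: "rho {..<p} e = ((\<Sum>i<n. (e i)\<^sup>2) - energy us (Matrix.vec n e)) / s\<^sup>2" for e
    using rss_orthonormal[OF finite_cols(2)[OF order_refl] cols_carrier(2) us(1,3), of "Matrix.vec n e"] T
    by (simp add: rho_noise vec_dot_self)
  let ?A = "{e \<in> space noise. (\<Sum>i<n. (e i)\<^sup>2) \<le> c * s\<^sup>2}"
  let ?B = "{e \<in> space noise. d * s\<^sup>2 \<le> energy us (Matrix.vec n e)}"
  have "{e \<in> space noise. rho {..<p} e \<le> c - d} \<subseteq> ?A \<union> ?B"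
    using s_pos by (auto simp: rho field_simps)
  then have "prob {e \<in> space noise. rho {..<p} e \<le> c - d} \<le> prob (?A \<union> ?B)"
    by (intro finite_measure_mono) auto
  also have "\<dots> \<le> prob ?A + prob ?B" by (intro measure_Un_le) auto
  also have "prob ?A \<le> exp (q * c) / sqrt (1 + 2 * q) ^ n" by (rule noise_sumsq_lower_tail[OF s_pos q(1)])
  also have "prob ?B \<le> exp (- q * d) / sqrt (1 - 2 * q) ^ length us" by (rule noise_energy_tail[OF s_pos q us(1)])
  also have "\<dots> \<le> exp (- q * d) / sqrt (1 - 2 * q) ^ (p + 1)"
    using q len by (intro divide_left_mono power_decreasing) auto
  finally show ?thesis by simp
qed

definition unexplained :: "nat set \<Rightarrow> real Matrix.vec" where
  "unexplained A = X *\<^sub>v b - proj1 A *\<^sub>v (X *\<^sub>v b)"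

text \<open>The squared component of the response along the unexplained part of the mean, in units of the noise variance:
noncentral chi-square with one degree of freedom.\<close>

definition misfit :: "nat set \<Rightarrow> (nat \<Rightarrow> real) \<Rightarrow> real" where
  "misfit A e = (sqrt (unexplained A \<bullet> unexplained A)
     + ((1 / sqrt (unexplained A \<bullet> unexplained A)) \<cdot>\<^sub>v unexplained A) \<bullet> Matrix.vec n e)\<^sup>2 / s\<^sup>2"

lemma unexplained_carrier:
  "A \<subseteq> {..<p} \<Longrightarrow> unexplained A \<in> carrier_vec n"
  unfolding unexplained_def using orth_proj_vec[OF finite_cols(2) cols_carrier(2)] by auto

lemma unexplained_lower_bound:
  assumes A: "A \<subseteq> {..<p}"
  shows "\<delta> * s\<^sup>2 * card (T - A) \<le> unexplained A \<bullet> unexplained A"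
proof -
  have "\<delta> * s\<^sup>2 * card (T - A) = (\<Sum>i\<in>T - A. \<delta> * s\<^sup>2)" by simp
  also have "\<dots> \<le> (\<Sum>i\<in>T - A. \<zeta> * real n * (b $ i)\<^sup>2)" by (intro sum_mono signal) auto
  also have "\<dots> \<le> (\<Sum>i\<in>{..<p} - A. \<zeta> * real n * (b $ i)\<^sup>2)"
    using T \<zeta>_pos by (intro sum_mono2) auto
  also have "\<dots> = \<zeta> * real n * (\<Sum>i\<in>{..<p} - A. (b $ i)\<^sup>2)" by (simp add: sum_distrib_left)
  also have "\<dots> \<le> unexplained A \<bullet> unexplained A"
    unfolding unexplained_def
    by (intro dist_span_lower_bound[OF A] orth_proj_in_span[OF finite_cols(2)[OF A] cols_carrier(2)]) auto
  finally show ?thesis .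
qed

lemma unexplained_pos:
  assumes "A \<subseteq> {..<p}" "\<not> T \<subseteq> A" shows "0 < unexplained A \<bullet> unexplained A"
proof -
  have "finite (T - A)" "T - A \<noteq> {}" using T assms finite_subset by (auto intro: finite_subset)
  then have "0 < \<delta> * s\<^sup>2 * card (T - A)" using \<delta>_pos s_pos by (simp add: card_gt_0_iff)
  then show ?thesis using unexplained_lower_bound[OF assms(1)] by linarith
qed

lemma rho_misfit:
  assumes A: "A \<subseteq> {..<p}" "\<not> T \<subseteq> A"
  shows "rho {..<p} e + misfit A e \<le> rho A e"
proof -
  let ?r = "unexplained A" and ?m = "X *\<^sub>v b" and ?e = "Matrix.vec n e"
  note f = finite_cols(2)[OF A(1)] cols_carrier(2)
  have r: "?r \<in> carrier_vec n" by (rule unexplained_carrier[OF A(1)])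
  have pos: "0 < ?r \<bullet> ?r" by (rule unexplained_pos[OF A])
  have "?m \<in> real_span n (cols1 {..<p})"
    using mean_in_span[of "{..<p}" b] span_cols01[of "{..<p}"] by (auto simp: supported_def)
  moreover have "cols1 A \<subseteq> cols1 {..<p}" using A by (auto simp: cols1_def)
  ultimately have gain: "rss n (cols1 {..<p}) (resp e) + (?r \<bullet> resp e)\<^sup>2 / (?r \<bullet> ?r) \<le> rss n (cols1 A) (resp e)"
    using pos unfolding unexplained_def
    by (intro rss_gain[OF f finite_cols(2)[OF order_refl] cols_carrier(2)]) auto
  have "ones n \<in> real_span n (cols1 A)" by (intro vec_span_base cols_carrier) (simp add: cols1_def)
  then have "ones n \<bullet> ?r = 0" unfolding unexplained_def by (intro residual_orth[OF f]) auto
  then have o: "?r \<bullet> ones n = 0" using comm_scalar_prod[OF r ones_carrier] by simp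
  have Hm: "proj1 A *\<^sub>v ?m \<in> carrier_vec n" by (rule orth_proj_vec[OF f]) simp
  have "(proj1 A *\<^sub>v ?m) \<bullet> ?r = 0" unfolding unexplained_def by (intro residual_orth[OF f] orth_proj_in_span[OF f]) auto
  then have "?r \<bullet> (proj1 A *\<^sub>v ?m) = 0" using comm_scalar_prod[OF r Hm] by simp
  moreover have "?r \<bullet> ?r = ?r \<bullet> ?m - ?r \<bullet> (proj1 A *\<^sub>v ?m)"
    using r Hm by (subst (2) unexplained_def) (simp add: scalar_prod_minus_distrib[of _ n])
  ultimately have m: "?r \<bullet> ?m = ?r \<bullet> ?r" by simp
  have "?r \<bullet> resp e = ?r \<bullet> ?r + ?r \<bullet> ?e"
    unfolding resp_def using r o m by (simp add: scalar_prod_add_distrib[of _ n])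
  moreover have "(sqrt (?r \<bullet> ?r) + ((1 / sqrt (?r \<bullet> ?r)) \<cdot>\<^sub>v ?r) \<bullet> ?e) = (?r \<bullet> ?r + ?r \<bullet> ?e) / sqrt (?r \<bullet> ?r)"
    using r pos by (simp add: field_simps)
  ultimately have "misfit A e = (?r \<bullet> resp e)\<^sup>2 / (?r \<bullet> ?r) / s\<^sup>2"
    unfolding misfit_def using pos by (simp add: power_divide)
  then show ?thesis
    using divide_right_mono[OF gain, of "s\<^sup>2"] by (simp add: rho_def add_divide_distrib)
qed

lemma measurable_misfit [measurable]: "misfit A \<in> borel_measurable noise"
  unfolding misfit_def by measurable

lemma misfit_nonneg [simp]: "0 \<le> misfit A e"
  by (simp add: misfit_def)

lemma misfit_laplace:
  assumes A: "A \<subseteq> {..<p}" "\<not> T \<subseteq> A" and q: "0 \<le> q"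
  shows "(\<integral>\<^sup>+e. ennreal (exp (- q * misfit A e)) \<partial>noise) \<le> ennreal (exp (- (q / (1 + 2 * q)) * (\<delta> * card (T - A))))"
proof -
  let ?r = "unexplained A"
  have r: "?r \<in> carrier_vec n" by (rule unexplained_carrier[OF A(1)])
  have pos: "0 < ?r \<bullet> ?r" by (rule unexplained_pos[OF A])
  have "(\<integral>\<^sup>+e. ennreal (exp (- q * misfit A e)) \<partial>noise) \<le> ennreal (exp (- q * (sqrt (?r \<bullet> ?r))\<^sup>2 / s\<^sup>2 / (1 + 2 * q)))"
    using noise_shifted_square_laplace[OF s_pos q, of "(1 / sqrt (?r \<bullet> ?r)) \<cdot>\<^sub>v ?r" n "sqrt (?r \<bullet> ?r)"] r pos
    unfolding misfit_def by simp
  also have "\<dots> \<le> ennreal (exp (- (q / (1 + 2 * q)) * (\<delta> * card (T - A))))"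
  proof -
    have "\<delta> * card (T - A) \<le> (?r \<bullet> ?r) / s\<^sup>2"
      using unexplained_lower_bound[OF A(1)] s_pos by (simp add: field_simps)
    then have "(q / (1 + 2 * q)) * (\<delta> * card (T - A)) \<le> (q / (1 + 2 * q)) * ((?r \<bullet> ?r) / s\<^sup>2)"
      using q by (intro mult_left_mono) auto
    then show ?thesis using pos by (intro ennreal_leI) (simp add: field_simps)
  qed
  finally show ?thesis .
qed

text \<open>Markov's inequality for the square root of the sum. First moments of likelihood ratios
are dominated by rare events and of order one even if the ratio is nearly always tiny; half moments are small,
and the square root of a sum is at most the sum of the square roots.\<close>

lemma underfit_prob:
  fixes U c :: "nat \<Rightarrow> real"
  assumes U: "\<And>i. 0 \<le> U i" and c: "\<And>i. 0 \<le> c i" and \<eta>: "0 < \<eta>"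
  defines "\<M> \<equiv> underfitting"
  shows "measure noise {e \<in> space noise. \<eta> \<le> (\<Sum>A\<in>\<M>. U (card (T - A)) * exp (- c (card (T - A)) * misfit A e))}
    \<le> (\<Sum>A\<in>\<M>. sqrt (U (card (T - A))) * exp (- (c (card (T - A)) / (2 * (1 + c (card (T - A))))) * (\<delta> * card (T - A)))) / sqrt \<eta>"
    (is "measure noise ?E \<le> (\<Sum>A\<in>\<M>. ?R A) / _")
proof -
  interpret prob_space noise by (rule prob_space_gaussian_noise[OF s_pos])
  have fin: "finite \<M>" unfolding \<M>_def by (rule finite_subset[of _ "Pow {..<p}"]) auto
  let ?f = "\<lambda>A e. U (card (T - A)) * exp (- c (card (T - A)) * misfit A e)"
  let ?h = "\<lambda>A e. sqrt (U (card (T - A))) * exp (- (c (card (T - A)) / 2) * misfit A e)"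
  have h: "sqrt (?f A e) = ?h A e" for A e
    by (simp add: real_sqrt_mult exp_half_le2 real_sqrt_unique power2_eq_square exp_add[symmetric])
  have hm: "?h A \<in> borel_measurable noise" for A by measurable
  have Hm: "(\<lambda>e. \<Sum>A\<in>\<M>. ?h A e) \<in> borel_measurable noise" by (intro borel_measurable_sum hm)
  have "?E \<subseteq> {e \<in> space noise. sqrt \<eta> \<le> (\<Sum>A\<in>\<M>. ?h A e)}"
  proof safe
    fix e assume "\<eta> \<le> (\<Sum>A\<in>\<M>. ?f A e)"
    then have "sqrt \<eta> \<le> sqrt (\<Sum>A\<in>\<M>. ?f A e)" by simp
    also have "\<dots> \<le> (\<Sum>A\<in>\<M>. sqrt (?f A e))" using U by (intro sqrt_sum_le fin) auto
    finally show "sqrt \<eta> \<le> (\<Sum>A\<in>\<M>. ?h A e)" unfolding h .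
  qed
  then have "prob ?E \<le> prob {e \<in> space noise. sqrt \<eta> \<le> (\<Sum>A\<in>\<M>. ?h A e)}"
    by (rule finite_measure_mono[OF _ borel_measurable_le[OF borel_measurable_const Hm]])
  also have "\<dots> \<le> (\<Sum>A\<in>\<M>. ?R A) / sqrt \<eta>"
  proof (rule markov_nn_integral[where X = "\<lambda>e. \<Sum>A\<in>\<M>. ?h A e", OF Hm])
    have "(\<integral>\<^sup>+e. ennreal (\<Sum>A\<in>\<M>. ?h A e) \<partial>noise) = (\<integral>\<^sup>+e. (\<Sum>A\<in>\<M>. ennreal (sqrt (U (card (T - A)))) * ennreal (exp (- (c (card (T - A)) / 2) * misfit A e))) \<partial>noise)"
      using U by (intro nn_integral_cong) (simp add: ennreal_mult'[symmetric])
    also have "\<dots> = (\<Sum>A\<in>\<M>. ennreal (sqrt (U (card (T - A)))) * (\<integral>\<^sup>+e. ennreal (exp (- (c (card (T - A)) / 2) * misfit A e)) \<partial>noise))"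
      by (subst nn_integral_sum) (auto simp: nn_integral_cmult)
    also have "\<dots> \<le> (\<Sum>A\<in>\<M>. ennreal (?R A))"
    proof (rule sum_mono)
      fix A assume "A \<in> \<M>"
      then have A: "A \<subseteq> {..<p}" "\<not> T \<subseteq> A" by (auto simp: \<M>_def)
      let ?c = "c (card (T - A))"
      have "(\<integral>\<^sup>+e. ennreal (exp (- (?c / 2) * misfit A e)) \<partial>noise) \<le> ennreal (exp (- ((?c / 2) / (1 + 2 * (?c / 2))) * (\<delta> * card (T - A))))"
        by (rule misfit_laplace[OF A]) (use c in simp)
      also have "(?c / 2) / (1 + 2 * (?c / 2)) = ?c / (2 * (1 + ?c))" using c[of "card (T - A)"] by (simp add: field_simps)
      finally show "ennreal (sqrt (U (card (T - A)))) * (\<integral>\<^sup>+e. ennreal (exp (- (?c / 2) * misfit A e)) \<partial>noise) \<le> ennreal (?R A)"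
        using U by (subst ennreal_mult) (auto intro!: mult_left_mono)
    qed
    also have "\<dots> = ennreal (\<Sum>A\<in>\<M>. ?R A)" using U by (intro sum_ennreal) auto
    finally show "(\<integral>\<^sup>+e. ennreal (\<Sum>A\<in>\<M>. ?h A e) \<partial>noise) \<le> ennreal (\<Sum>A\<in>\<M>. ?R A)" .
  qed (use U \<eta> in \<open>auto intro!: sum_nonneg divide_nonneg_nonneg\<close>)
  finally show ?thesis .
qed

end

section \<open>Prior ratios, Gamma ratios and elementary inequalities\<close>

lemma prior_weight_eq:
  assumes "card A \<le> p"
  shows "prior_weight lam p A = lam ^ card A * exp (- lam) * fact (p - card A) / fact p"
  unfolding prior_weight_def binomial_fact[OF assms, where 'a = real]
  by (simp add: field_simps)

lemma model_prior_ratio: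
  assumes "lam > 0" "A \<subseteq> {..<p}" "T \<subseteq> {..<p}"
  shows "model_prior lam p A / model_prior lam p T
    = (lam ^ card A / lam ^ card T) * (fact (p - card A) / fact (p - card T))"
proof -
  have c: "card A \<le> p" "card T \<le> p" using card_mono[OF _ assms(2)] card_mono[OF _ assms(3)] by auto
  have "0 < (\<Sum>B\<in>Pow {..<p}. prior_weight lam p B)"
  proof (rule sum_pos)
    fix B assume "B \<in> Pow {..<p}"
    then have "card B \<le> p" using card_mono[of "{..<p}" B] by simp
    then show "0 < prior_weight lam p B" using assms(1) by (simp add: prior_weight_eq)
  qed auto
  then show ?thesis unfolding model_prior_def using assms(1) c by (simp add: prior_weight_eq)
qed

text \<open>Log-convexity of the Gamma function at the midpoint of \<open>x\<close> and \<open>x + 1\<close>.\<close>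

lemma Gamma_half_step:
  assumes "(0::real) < x" shows "Gamma (x + 1 / 2) \<le> sqrt x * Gamma x"
proof -
  have "(ln \<circ> Gamma) ((1 - 1 / 2) *\<^sub>R x + (1 / 2) *\<^sub>R (x + 1)) \<le> (1 - 1 / 2) * (ln \<circ> Gamma) x + (1 / 2) * (ln \<circ> Gamma) (x + 1)"
    by (rule convex_onD[OF log_convex_Gamma_real]) (use assms in auto)
  also have "(1 - 1 / 2) *\<^sub>R x + (1 / 2) *\<^sub>R (x + 1) = x + 1 / 2" by (simp add: field_simps)
  finally have "2 * ln (Gamma (x + 1 / 2)) \<le> ln (Gamma x) + ln (Gamma (x + 1))" by simp
  also have "\<dots> = ln (Gamma x * Gamma (x + 1))" using assms by (subst ln_mult_pos) (auto intro!: Gamma_real_pos)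
  also have "Gamma x * Gamma (x + 1) = x * (Gamma x)\<^sup>2"
    using assms Gamma_plus1[of x] by (auto simp: power2_eq_square nonpos_Ints_def)
  also have "2 * ln (Gamma (x + 1 / 2)) = ln ((Gamma (x + 1 / 2))\<^sup>2)" using assms by (simp add: ln_realpow Gamma_real_pos)
  finally have "ln ((Gamma (x + 1 / 2))\<^sup>2) \<le> ln (x * (Gamma x)\<^sup>2)" .
  moreover have "0 < Gamma x" "0 < Gamma (x + 1 / 2)" using assms by (auto intro!: Gamma_real_pos)
  ultimately have "(Gamma (x + 1 / 2))\<^sup>2 \<le> x * (Gamma x)\<^sup>2" using assms by simp
  also have "\<dots> = (sqrt x * Gamma x)\<^sup>2" using assms by (simp add: power_mult_distrib)
  finally show ?thesis
    by (rule power2_le_imp_le) (use assms in \<open>auto intro!: mult_nonneg_nonneg less_imp_le Gamma_real_pos\<close>)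
qed

text \<open>The part of the Bayes factor that depends on the model only through its size \<open>a\<close>.\<close>

definition size_factor :: "nat \<Rightarrow> nat \<Rightarrow> real" where
  "size_factor n a = Gamma ((real a + 1) / 2) * Gamma ((real n - (real a + 1)) / 2)"

lemma size_factor_pos: "a + 1 < n \<Longrightarrow> 0 < size_factor n a"
  unfolding size_factor_def by (intro mult_pos_pos Gamma_real_pos) auto

lemma size_factor_up:
  assumes "a + 3 < n"
  shows "size_factor n (Suc a) \<le> sqrt ((real a + 1) / (real n - real a - 3)) * size_factor n a"
proof -
  define x where "x = (real a + 1) / 2"
  define w where "w = (real n - real a - 3) / 2"
  have pos: "0 < x" "0 < w" using assms by (auto simp: x_def w_def)
  have 1: "Gamma (x + 1 / 2) \<le> sqrt x * Gamma x" by (rule Gamma_half_step[OF pos(1)])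
  have "Gamma (w + 1 / 2) \<le> sqrt w * Gamma w" by (rule Gamma_half_step[OF pos(2)])
  also have "Gamma w = Gamma (w + 1) / w" using Gamma_plus1[of w] pos by (auto simp: nonpos_Ints_def)
  also have "sqrt w * (Gamma (w + 1) / w) = Gamma (w + 1) / sqrt w"
    using pos by (simp add: field_simps)
  finally have 2: "Gamma (w + 1 / 2) \<le> Gamma (w + 1) / sqrt w" .
  have "Gamma (x + 1 / 2) * Gamma (w + 1 / 2) \<le> (sqrt x * Gamma x) * (Gamma (w + 1) / sqrt w)"
    using pos by (intro mult_mono 1 2) (auto intro!: less_imp_le Gamma_real_pos mult_nonneg_nonneg)
  also have "\<dots> = sqrt (x / w) * (Gamma x * Gamma (w + 1))" by (simp add: real_sqrt_divide)
  also have "x / w = (real a + 1) / (real n - real a - 3)"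
  proof -
    have "(u / 2) / (v / 2) = u / v" for u v :: real by simp
    then show ?thesis unfolding x_def w_def .
  qed
  finally show ?thesis unfolding size_factor_def x_def w_def
    by (simp add: field_simps)
qed

lemma size_factor_down:
  assumes "a + 2 < n"
  shows "size_factor n a \<le> sqrt (2 * real n / (real a + 1)) * size_factor n (Suc a)"
proof -
  define x where "x = (real a + 1) / 2"
  define w where "w = (real n - real a - 2) / 2"
  have pos: "0 < x" "0 < w" and x: "1 / 2 \<le> x" using assms by (auto simp: x_def w_def)
  have "Gamma (x + 1 / 2 + 1 / 2) \<le> sqrt (x + 1 / 2) * Gamma (x + 1 / 2)" by (rule Gamma_half_step) (use pos in auto)
  also have "x + 1 / 2 + 1 / 2 = x + 1" by simp
  also have "Gamma (x + 1) = x * Gamma x" using Gamma_plus1[of x] pos by (auto simp: nonpos_Ints_def)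
  finally have "Gamma x \<le> sqrt (x + 1 / 2) * Gamma (x + 1 / 2) / x" using pos by (simp add: field_simps)
  also have "\<dots> \<le> sqrt (2 * x) * Gamma (x + 1 / 2) / x"
    using pos x by (intro divide_right_mono mult_right_mono) (auto intro!: less_imp_le Gamma_real_pos)
  also have "\<dots> = sqrt (2 / x) * Gamma (x + 1 / 2)"
    using pos by (simp add: real_sqrt_divide real_sqrt_mult field_simps)
  finally have 1: "Gamma x \<le> sqrt (2 / x) * Gamma (x + 1 / 2)" .
  have 2: "Gamma (w + 1 / 2) \<le> sqrt w * Gamma w" by (rule Gamma_half_step[OF pos(2)])
  have "Gamma x * Gamma (w + 1 / 2) \<le> (sqrt (2 / x) * Gamma (x + 1 / 2)) * (sqrt w * Gamma w)"
    using pos by (intro mult_mono 1 2) (auto intro!: less_imp_le Gamma_real_pos mult_nonneg_nonneg)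
  also have "\<dots> = sqrt (2 * w / x) * (Gamma (x + 1 / 2) * Gamma w)" by (simp add: real_sqrt_divide real_sqrt_mult)
  also have "\<dots> \<le> sqrt (2 * real n / (real a + 1)) * (Gamma (x + 1 / 2) * Gamma w)"
  proof (intro mult_right_mono)
    have "2 * w / x = 2 * (real n - real a - 2) / (real a + 1)"
    proof -
      have "2 * (u / 2) / (v / 2) = 2 * u / v" for u v :: real by simp
      then show ?thesis unfolding x_def w_def .
    qed
    also have "\<dots> \<le> 2 * real n / (real a + 1)" by (intro divide_right_mono) auto
    finally show "sqrt (2 * w / x) \<le> sqrt (2 * real n / (real a + 1))" by simp
  qed (use pos in \<open>auto intro!: less_imp_le Gamma_real_pos mult_pos_pos\<close>)
  finally show ?thesis unfolding size_factor_def x_def w_def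
    by (simp add: field_simps)
qed

lemma size_factor_down_iter:
  assumes "a + d + 1 < n"
  shows "size_factor n a \<le> sqrt ((2 * real n) ^ d * fact a / fact (a + d)) * size_factor n (a + d)"
  using assms
proof (induction d)
  case (Suc d)
  have "size_factor n a \<le> sqrt ((2 * real n) ^ d * fact a / fact (a + d)) * size_factor n (a + d)"
    by (rule Suc.IH) (use Suc.prems in simp)
  also have "\<dots> \<le> sqrt ((2 * real n) ^ d * fact a / fact (a + d)) * (sqrt (2 * real n / (real (a + d) + 1)) * size_factor n (Suc (a + d)))"
    using Suc.prems by (intro mult_left_mono size_factor_down) auto
  also have "\<dots> = sqrt (((2 * real n) ^ d * fact a / fact (a + d)) * (2 * real n / (real (a + d) + 1))) * size_factor n (a + Suc d)"
    by (simp add: real_sqrt_mult[symmetric])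
  also have "((2 * real n) ^ d * fact a / fact (a + d)) * (2 * real n / (real (a + d) + 1)) = (2 * real n) ^ Suc d * fact a / fact (a + Suc d)"
    by (simp add: field_simps)
  finally show ?case .
qed simp

lemma size_factor_up_iter:
  assumes "p + 2 < n" "t + d \<le> p" "real p / (real n - real p - 2) \<le> \<kappa>"
  shows "size_factor n (t + d) \<le> sqrt \<kappa> ^ d * size_factor n t"
  using assms(2)
proof (induction d)
  case (Suc d)
  have "0 \<le> real p / (real n - real p - 2)" using assms(1) by (intro divide_nonneg_nonneg) auto
  then have \<kappa>: "0 \<le> \<kappa>" using assms(3) by simp
  have "size_factor n (t + Suc d) \<le> sqrt ((real (t + d) + 1) / (real n - real (t + d) - 3)) * size_factor n (t + d)"
    using size_factor_up[of "t + d" n] Suc.prems assms(1) by simp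
  also have "\<dots> \<le> sqrt \<kappa> * (sqrt \<kappa> ^ d * size_factor n t)"
  proof (intro mult_mono Suc.IH)
    have "(real (t + d) + 1) / (real n - real (t + d) - 3) \<le> real p / (real n - real p - 2)"
      using Suc.prems assms(1) by (intro frac_le) auto
    then show "sqrt ((real (t + d) + 1) / (real n - real (t + d) - 3)) \<le> sqrt \<kappa>" using assms(3) by simp
  qed (use Suc.prems assms(1) \<kappa> size_factor_pos[of "t + d" n] in auto)
  finally show ?case by simp
qed simp

lemma fact_le_pow_mult_fact:
  assumes "r \<le> m" shows "(fact m :: real) \<le> real m ^ r * fact (m - r)"
proof -
  have "(fact m :: nat) = fact m div fact (m - r) * fact (m - r)"
    by (simp add: fact_dvd)
  also have "\<dots> \<le> m ^ r * fact (m - r)" by (intro mult_le_mono1 fact_div_fact_le_pow assms)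
  finally have "real (fact m) \<le> real (m ^ r * fact (m - r))" by (rule of_nat_mono)
  then show ?thesis by simp
qed

text \<open>Expressed with \<open>i\<close> missing predictors, this keeps the factor \<open>sqrt ((t - i)! / t!)\<close>, which later cancels the
square root of the number of ordered choices of the missing predictors.\<close>

lemma size_factor_underfit:
  assumes n: "p + 2 < n" and \<kappa>: "real p / (real n - real p - 2) \<le> 1"
    and a: "a + i = t + j" "a \<le> p" "i \<le> t" "t \<le> p"
  shows "size_factor n a / size_factor n t \<le> sqrt ((2 * real n) ^ i * fact (t - i) / fact t)"
proof (cases "a \<le> t")
  case True
  define d where "d = t - a"
  have t: "t = a + d" and i: "i = d + j" and ti: "a = (t - i) + j" using True a by (auto simp: d_def)
  have "size_factor n a \<le> sqrt ((2 * real n) ^ d * fact a / fact t) * size_factor n t"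
    using size_factor_down_iter[of a d n] n a unfolding t by simp
  then have "size_factor n a / size_factor n t \<le> sqrt ((2 * real n) ^ d * fact a / fact t)"
    using size_factor_pos[of t n] n a by (simp add: field_simps)
  also have "\<dots> \<le> sqrt ((2 * real n) ^ i * fact (t - i) / fact t)"
  proof -
    have "(fact a :: real) \<le> real a ^ j * fact (t - i)"
      using fact_le_pow_mult_fact[of j a] ti by simp
    also have "\<dots> \<le> (2 * real n) ^ j * fact (t - i)" using n a by (intro mult_right_mono power_mono) auto
    finally have "(2 * real n) ^ d * fact a / fact t \<le> (2 * real n) ^ d * ((2 * real n) ^ j * fact (t - i)) / fact t"
      by (intro divide_right_mono mult_left_mono) auto
    then show ?thesis by (simp add: i power_add mult_ac)
  qed
  finally show ?thesis .
next
  case False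
  define d where "d = a - t"
  have ad: "a = t + d" using False by (simp add: d_def)
  have "size_factor n a \<le> sqrt 1 ^ d * size_factor n t"
    unfolding ad by (rule size_factor_up_iter[OF n _ \<kappa>]) (use a ad in auto)
  then have "size_factor n a / size_factor n t \<le> 1"
    using size_factor_pos[of t n] n a by (simp add: field_simps)
  also have "1 \<le> sqrt ((2 * real n) ^ i * fact (t - i) / fact t)"
  proof -
    have "(fact t :: real) \<le> real t ^ i * fact (t - i)" by (rule fact_le_pow_mult_fact) (use a in simp)
    also have "\<dots> \<le> (2 * real n) ^ i * fact (t - i)" using n a by (intro mult_right_mono power_mono) auto
    finally show ?thesis by simp
  qed
  finally show ?thesis .
qed

text \<open>Concavity of the logarithm, in the form of convexity of the exponential function.\<close>

lemma ln_chord: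
  assumes "0 \<le> \<theta>" "\<theta> \<le> 1" "0 \<le> (k::real)"
  shows "\<theta> * ln (1 + k) \<le> ln (1 + \<theta> * k)"
proof -
  have "exp ((1 - \<theta>) *\<^sub>R 0 + \<theta> *\<^sub>R ln (1 + k)) \<le> (1 - \<theta>) * exp 0 + \<theta> * exp (ln (1 + k))"
    by (rule convex_onD[OF exp_convex]) (use assms in auto)
  then have "exp (\<theta> * ln (1 + k)) \<le> 1 + \<theta> * k" using assms by (simp add: algebra_simps)
  then show ?thesis using assms by (subst ln_ge_iff) (auto intro: add_pos_nonneg)
qed

text \<open>Up to \<open>V = k n\<close> the concave function \<open>ln (1 + V / r)\<close> lies above its chord, and beyond it is replaced by its value at
\<open>k n\<close>. An exponential is needed because its expectation is a Laplace transform. The constants 101/100 and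
495/1000 leave room for \<open>r\<close> and \<open>M\<close> to differ from their typical values \<open>n\<close> and \<open>n / 2\<close>.\<close>

lemma power_law_le_exp:
  fixes V r M n k c l :: real
  assumes V: "0 \<le> V" and r: "0 < r" "r \<le> 101 / 100 * n" and M: "495 / 1000 * n \<le> M" and n: "0 < n"
    and k: "0 < k" and c: "0 \<le> c" and l: "l \<le> ln (1 + k / (101 / 100))" "c * k \<le> 495 / 1000 * l"
  shows "(1 + V / r) powr (- M) \<le> exp (- c * V) + exp (- c * (k * n))"
proof -
  \<comment> \<open>Truncating \<open>V\<close> treats both ranges at once.\<close>
  define v where "v = min V (k * n)"
  have v: "0 \<le> v" "v \<le> V" "v \<le> k * n" using V k n by (auto simp: v_def)
  have "c * v \<le> M * ln (1 + v / (101 / 100 * n))"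
  proof -
    have l0: "0 \<le> l" using mult_nonneg_nonneg[of c k] l(2) c k by linarith
    have "c * v = (c * k) * (v / k)" using k by simp
    also have "\<dots> \<le> (495 / 1000 * l) * (v / k)" using l v k by (intro mult_right_mono) auto
    also have "\<dots> = (495 / 1000 * n) * (v / (k * n) * l)" using k n by (simp add: field_simps)
    also have "\<dots> \<le> M * (v / (k * n) * ln (1 + k / (101 / 100)))"
      using M l v k n l0 by (intro mult_mono mult_nonneg_nonneg mult_left_mono) auto
    also have "\<dots> \<le> M * ln (1 + v / (k * n) * (k / (101 / 100)))"
      using v k n M by (intro mult_left_mono ln_chord) auto
    also have "v / (k * n) * (k / (101 / 100)) = v / (101 / 100 * n)" using k by (simp add: field_simps)
    finally show ?thesis .
  qed
  also have "\<dots> \<le> M * ln (1 + V / r)"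
  proof -
    have "v / (101 / 100 * n) \<le> V / r" using v r by (intro frac_le) auto
    moreover have "0 \<le> v / (101 / 100 * n)" using v n by simp
    ultimately show ?thesis using M n by (intro mult_left_mono) auto
  qed
  finally have "(1 + V / r) powr (- M) \<le> exp (- c * v)"
    using V r by (simp add: powr_def add_pos_nonneg less_imp_neq[symmetric])
  also have "\<dots> \<le> exp (- c * V) + exp (- c * (k * n))" by (auto simp: v_def min_def)
  finally show ?thesis .
qed

text \<open>Numerical values for the two chords, from \<open>exp 1 < 272/100\<close> and \<open>exp x \<le> 1 / (1 - x)\<close>.\<close>

lemma ln_bounds: "106 / 100 \<le> ln (1 + 2 / (101 / 100) :: real)" "233 / 100 \<le> ln (1 + 10 / (101 / 100) :: real)"
proof -
  have e: "exp (1::real) \<le> 272 / 100" using e_less_272 by simp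
  have inv: "exp x \<le> 1 / (1 - x)" if "0 \<le> x" "x < 1" for x :: real
  proof -
    have "1 - x \<le> exp (- x)" using exp_ge_add_one_self[of "- x"] by simp
    then show ?thesis using that by (simp add: exp_minus field_simps)
  qed
  have "exp (106 / 100 :: real) = exp 1 * exp (6 / 100)" by (simp add: exp_add[symmetric])
  also have "\<dots> \<le> 272 / 100 * (1 / (1 - 6 / 100))" using inv[of "6 / 100"] by (intro mult_mono e) auto
  also have "\<dots> \<le> 1 + 2 / (101 / 100)" by simp
  finally show "106 / 100 \<le> ln (1 + 2 / (101 / 100) :: real)" by (subst ln_ge_iff) auto
  have "exp (233 / 100 :: real) = (exp 1 * exp 1) * (exp (165 / 1000) * exp (165 / 1000))" by (simp add: exp_add[symmetric])
  also have "\<dots> \<le> (272 / 100 * (272 / 100)) * ((1 / (1 - 165 / 1000)) * (1 / (1 - 165 / 1000)))"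
    using inv[of "165 / 1000"] by (intro mult_mono e) auto
  also have "\<dots> \<le> 1 + 10 / (101 / 100)" by simp
  finally show "233 / 100 \<le> ln (1 + 10 / (101 / 100) :: real)" by (subst ln_ge_iff) auto
qed

section \<open>Posterior weights outside the exceptional events\<close>

lemma sum_Pow_card:
  fixes g :: "nat \<Rightarrow> real"
  assumes "finite S"
  shows "(\<Sum>J\<in>Pow S. g (card J)) = (\<Sum>j\<le>card S. real (card S choose j) * g j)"
proof -
  have "(\<Sum>J\<in>Pow S. g (card J)) = (\<Sum>j\<in>{..card S}. \<Sum>J\<in>{J \<in> Pow S. card J = j}. g (card J))"
    by (rule sum.group[symmetric]) (use assms in \<open>auto intro: card_mono\<close>)
  also have "\<dots> = (\<Sum>j\<le>card S. \<Sum>J\<in>{J \<in> Pow S. card J = j}. g j)"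
    by (intro sum.cong) auto
  also have "\<dots> = (\<Sum>j\<le>card S. real (card S choose j) * g j)"
  proof (intro sum.cong refl)
    fix j
    have "card {J \<in> Pow S. card J = j} = card S choose j" using n_subsets[OF assms, of j] by simp
    then show "(\<Sum>J\<in>{J \<in> Pow S. card J = j}. g j) = real (card S choose j) * g j" by simp
  qed
  finally show ?thesis .
qed

text \<open>The prior ratio turns the number of models with \<open>j\<close> extra predictors into \<open>1 / j!\<close>.\<close>

lemma overfit_sum_le:
  fixes x :: real
  assumes "finite S" "0 \<le> x"
  shows "(\<Sum>J\<in>Pow S - {{}}. x ^ card J * (fact (card S - card J) / fact (card S))) \<le> exp x - 1"
proof -
  let ?g = "\<lambda>j. x ^ j * (fact (card S - j) / fact (card S)) :: real"
  have "(\<Sum>J\<in>Pow S - {{}}. ?g (card J)) = (\<Sum>J\<in>Pow S. ?g (card J)) - 1"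
    using assms(1) by (subst sum_diff1) auto
  also have "(\<Sum>J\<in>Pow S. ?g (card J)) = (\<Sum>j\<le>card S. real (card S choose j) * ?g j)"
    by (rule sum_Pow_card[OF assms(1)])
  also have "\<dots> = (\<Sum>j\<le>card S. x ^ j / fact j)"
    by (intro sum.cong) (auto simp: binomial_fact field_simps)
  also have "\<dots> \<le> (\<Sum>j. x ^ j / fact j)"
    using assms(2) summable_exp[of x] by (intro sum_le_suminf) (auto simp: field_simps)
  also have "\<dots> = exp x" by (simp add: exp_def scaleR_conv_of_real field_simps)
  finally show ?thesis by simp
qed

lemma ratio_powr_le_exp:
  fixes u v M :: real
  assumes "0 < v" "v \<le> u" "0 \<le> M"
  shows "(u / v) powr M \<le> exp (M * ((u - v) / v))"
proof -
  have "ln (u / v) \<le> u / v - 1" using assms by (intro ln_le_minus_one) auto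
  also have "\<dots> = (u - v) / v" using assms by (simp add: field_simps)
  finally have "M * ln (u / v) \<le> M * ((u - v) / v)" using assms by (intro mult_left_mono) auto
  then show ?thesis using assms by (simp add: powr_def)
qed

lemma one_le_max_inverse: "0 < (lam::real) \<Longrightarrow> 1 \<le> max lam (1 / lam)"
  by (cases "1 \<le> lam") (auto simp: le_max_iff_disj)

lemma power_quotient_le:
  fixes lam :: real
  assumes "0 < lam" "a + i = t + j"
  shows "lam ^ a / lam ^ t \<le> max lam (1 / lam) ^ (i + j)"
proof -
  define \<Lambda> where "\<Lambda> = max lam (1 / lam)"
  have \<Lambda>: "1 \<le> \<Lambda>" "lam \<le> \<Lambda>" "1 / lam \<le> \<Lambda>"
    using one_le_max_inverse[OF assms(1)] by (auto simp: \<Lambda>_def)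
  have "lam ^ a * lam ^ i = lam ^ t * lam ^ j" using assms(2) by (metis power_add)
  then have "lam ^ a / lam ^ t = lam ^ j * (1 / lam) ^ i"
    using assms(1) by (simp add: field_simps)
  also have "\<dots> \<le> \<Lambda> ^ j * \<Lambda> ^ i" using \<Lambda> assms(1) by (intro mult_mono power_mono) auto
  finally show ?thesis by (simp add: \<Lambda>_def power_add mult.commute)
qed

context regression
begin

abbreviation "N \<equiv> card ({..<p} - T)"

lemma finite_T: "finite T" using T finite_subset by auto

lemma card_T_N: "card T + N = p"
  using card_Diff_subset[OF finite_T T] card_mono[OF _ T] by simp

text \<open>A model is determined by the true predictors it misses and the extra ones it has.\<close>

lemma missing_sum:
  fixes h :: "nat \<Rightarrow> real"
  shows "(\<Sum>A\<in>underfitting. h (card (T - A))) = 2 ^ N * (\<Sum>i=1..card T. real (card T choose i) * h i)"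
proof -
  have "(\<Sum>A\<in>underfitting. h (card (T - A)))
    = (\<Sum>(I, J)\<in>(Pow T - {{}}) \<times> Pow ({..<p} - T). h (card I))"
    by (rule sum.reindex_bij_witness[of _ "\<lambda>(I, J). (T - I) \<union> J" "\<lambda>A. (T - A, A - T)"])
      (use T in \<open>auto intro!: arg_cong[where f = h] arg_cong[where f = card]\<close>)
  also have "\<dots> = (\<Sum>I\<in>Pow T - {{}}. \<Sum>J\<in>Pow ({..<p} - T). h (card I))"
    by (rule sum.cartesian_product[symmetric])
  also have "\<dots> = 2 ^ N * (\<Sum>I\<in>Pow T - {{}}. h (card I))"
    by (simp add: card_Pow sum_distrib_left)
  also have "(\<Sum>I\<in>Pow T - {{}}. h (card I)) = (\<Sum>I\<in>Pow T. h (card I)) - h 0"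
    using finite_T by (subst sum_diff1) auto
  also have "(\<Sum>I\<in>Pow T. h (card I)) = (\<Sum>i\<le>card T. real (card T choose i) * h i)"
    by (rule sum_Pow_card[OF finite_T])
  also have "\<dots> = h 0 + (\<Sum>i=1..card T. real (card T choose i) * h i)"
    by (simp add: atMost_atLeast0 sum.atLeast_Suc_atMost)
  finally show ?thesis by simp
qed

definition weight :: "real \<Rightarrow> nat set \<Rightarrow> (nat \<Rightarrow> real) \<Rightarrow> real" where
  "weight lam A e = bayes_factor n X (resp e) A T * (model_prior lam p A / model_prior lam p T)"

lemma posterior_eq: "posterior_prob lam n p X (resp e) T = inverse (\<Sum>A\<in>Pow {..<p}. weight lam A e)"
  by (simp add: posterior_prob_def weight_def)

lemma rho_pos:
  assumes "0 < rho {..<p} e" "A \<subseteq> {..<p}" shows "0 < rho A e"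
  using rho_antimono[OF assms(2) order_refl, of e] assms(1) by linarith

text \<open>The powers of the two coefficients of determination are regrouped so that the large exponent acts on the
quotient of the two residual sums of squares, and the difference of the sizes on a quotient that stays bounded.\<close>

lemma weight_eq:
  assumes lam: "lam > 0" and n: "p + 2 < n" and A: "A \<subseteq> {..<p}" and pos: "0 < rho {..<p} e"
  shows "weight lam A e = (rho T e / rho A e) powr ((real n - real (card A) - 2) / 2)
     * (rho T e / rho {} e) powr ((real (card A) - real (card T)) / 2)
     * (size_factor n (card A) / size_factor n (card T))
     * ((lam ^ card A / lam ^ card T) * (fact (p - card A) / fact N))"
proof -
  have r0: "0 < rho {} e" "0 < rho T e" "0 < rho A e" using rho_pos[OF pos] A T by auto
  then have "0 < rss n (cols1 {}) (resp e)" using s_pos by (simp add: rho_def zero_less_divide_iff)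
  then have R: "1 - R_squared n X (resp e) B = rho B e / rho {} e" if "B \<subseteq> {..<p}" for B
    using one_minus_R_squared[OF that resp_carrier] s_pos by (simp add: rho_def)
  let ?q = "rho T e / rho {} e" and ?qA = "rho A e / rho {} e"
  let ?MT = "(real n - real (card T) - 2) / 2" and ?MA = "(real n - real (card A) - 2) / 2"
  have "?q powr ?MT / ?qA powr ?MA = (?q / ?qA) powr ?MA * ?q powr (?MT - ?MA)"
    using r0 by (simp add: powr_divide powr_diff)
  also have "?q / ?qA = rho T e / rho A e" using r0 by simp
  also have "?MT - ?MA = (real (card A) - real (card T)) / 2" by (simp add: field_simps)
  finally have bf: "?q powr ?MT / ?qA powr ?MA = (rho T e / rho A e) powr ?MA * ?q powr ((real (card A) - real (card T)) / 2)" .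
  have M: "(real n - real (num_coeffs B) - 1) / 2 = (real n - real (card B) - 2) / 2" for B
    by (simp add: num_coeffs_def)
  have G: "Gamma (real (num_coeffs B) / 2) * Gamma ((real n - real (num_coeffs B)) / 2) = size_factor n (card B)" for B
    by (simp add: num_coeffs_def size_factor_def add.commute)
  have "p - card T = N" using card_T_N by simp
  then show ?thesis
    unfolding weight_def bayes_factor_def R[OF A] R[OF T] M G bf model_prior_ratio[OF lam A T] by simp
qed

lemma weight_true: "lam > 0 \<Longrightarrow> p + 2 < n \<Longrightarrow> 0 < rho {..<p} e \<Longrightarrow> weight lam T e = 1"
  using rho_pos[OF _ T, of e] rho_pos[of e "{}"] size_factor_pos[of "card T" n] card_T_N
    diff_add_inverse[of "card T" N]
  by (simp add: weight_eq[OF _ _ T])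

text \<open>Each additional predictor changes the Gamma ratio by at most \<open>sqrt \<kappa>\<close>; later \<open>\<kappa>\<close> is of order \<open>1 / ln n\<close>.\<close>

lemma overfit_weight:
  fixes c lam :: real
  assumes lam: "lam > 0" and n: "p + 2 < n" and \<kappa>: "real p / (real n - real p - 2) \<le> \<kappa>"
    and lo: "98 / 100 * real n \<le> rho {..<p} e"
    and J: "J \<subseteq> {..<p} - T" and gain: "rho T e - rho (T \<union> J) e \<le> c * card J" and c: "0 \<le> c"
  shows "weight lam (T \<union> J) e \<le> (exp (c / (196 / 100)) * sqrt \<kappa> * lam) ^ card J * (fact (N - card J) / fact N)"
proof -
  let ?A = "T \<union> J" and ?j = "card J"
  have A: "?A \<subseteq> {..<p}" using J T by auto
  have npos: "0 < real n" using n by simp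
  have pos: "0 < rho {..<p} e" using lo npos by (smt (verit) divide_pos_pos mult_pos_pos)
  note rp = rho_pos[OF pos A] rho_pos[OF pos T] rho_pos[OF pos, of "{}"]
  have fJ: "finite J" "T \<inter> J = {}" using J finite_subset by auto
  have cA: "card ?A = card T + ?j" using fJ finite_T by (simp add: card_Un_disjoint)
  have cp: "card T + ?j \<le> p" using card_mono[OF _ A] cA by simp
  have \<kappa>0: "0 \<le> \<kappa>"
  proof -
    have "0 \<le> real p / (real n - real p - 2)" using n by (intro divide_nonneg_nonneg) auto
    then show ?thesis using \<kappa> by simp
  qed
  let ?M = "(real n - real (card ?A) - 2) / 2"
  have M: "0 \<le> ?M" "?M \<le> real n / 2" using n cp cA by auto
  have mono: "rho ?A e \<le> rho T e" "rho {..<p} e \<le> rho ?A e" "rho T e \<le> rho {} e"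
    using A T by (auto intro!: rho_antimono)
  have "?M * ((rho T e - rho ?A e) / rho ?A e) \<le> real n / 2 * ((c * ?j) / (98 / 100 * real n))"
    using M gain mono lo npos c by (intro mult_mono frac_le) auto
  also have "\<dots> = real ?j * (c / (196 / 100))" using npos by simp
  finally have "exp (?M * ((rho T e - rho ?A e) / rho ?A e)) \<le> exp (c / (196 / 100)) ^ ?j"
    by (simp only: exp_le_cancel_iff exp_of_nat_mult[symmetric])
  moreover have "(rho T e / rho ?A e) powr ?M \<le> exp (?M * ((rho T e - rho ?A e) / rho ?A e))"
    using rp mono M by (intro ratio_powr_le_exp) auto
  ultimately have 1: "(rho T e / rho ?A e) powr ?M \<le> exp (c / (196 / 100)) ^ ?j" by linarith
  have 2: "(rho T e / rho {} e) powr ((real (card ?A) - real (card T)) / 2) \<le> 1"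
    using rp mono cA by (intro powr_le1) auto
  have 3: "size_factor n (card ?A) / size_factor n (card T) \<le> sqrt \<kappa> ^ ?j"
    using size_factor_up_iter[OF n cp \<kappa>] size_factor_pos[of "card T" n] n cp by (simp add: cA field_simps)
  have 4: "lam ^ card ?A / lam ^ card T = lam ^ ?j" using lam by (simp add: cA power_add)
  have 5: "p - card ?A = N - ?j" using card_T_N cA by simp
  have "weight lam ?A e \<le> exp (c / (196 / 100)) ^ ?j * 1 * sqrt \<kappa> ^ ?j * (lam ^ ?j * (fact (N - ?j) / fact N))"
    unfolding weight_eq[OF lam n A pos] 4 5
    using 1 2 3 lam \<kappa>0 size_factor_pos[of "card T" n] size_factor_pos[of "card ?A" n] n cp cA
    by (intro mult_mono) auto
  then show ?thesis by (simp add: power_mult_distrib mult_ac)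
qed

text \<open>The bound on the part of a weight that depends only on the number \<open>i\<close> of missing predictors. The base \<open>B\<close> collects
the factors per missing predictor and \<open>R\<close> those per extra predictor.\<close>

definition underfit_coeff :: "real \<Rightarrow> real \<Rightarrow> real \<Rightarrow> nat \<Rightarrow> real" where
  "underfit_coeff R B m i = R * B ^ i * fact i * sqrt (m ^ i * fact (card T - i) / fact (card T))"

text \<open>By \<open>rho_misfit\<close> the residual sum of squares is at least that of the full model plus the misfit. The passage from
\<open>rho T\<close> to that of the full model costs a factor per extra predictor, which is harmless since there are few.\<close>

lemma underfit_weight:
  fixes c lam :: real
  assumes lam: "lam > 0" and n: "p + 2 < n" and \<kappa>: "real p / (real n - real p - 2) \<le> 1"
    and lo: "98 / 100 * real n \<le> rho {..<p} e"
    and A: "A \<subseteq> {..<p}" "\<not> T \<subseteq> A"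
    and gain: "rho T e - rho {..<p} e \<le> c * N" and c: "0 \<le> c"
    and K: "rho {} e \<le> K * rho T e" "1 \<le> K"
  defines "\<Lambda> \<equiv> max lam (1 / lam)"
  shows "weight lam A e \<le> underfit_coeff ((exp (c / (196 / 100)) * \<Lambda> * 2) ^ N) (K * \<Lambda> * 2) (2 * real n) (card (T - A))
      * (1 + misfit A e / rho {..<p} e) powr (- ((real n - real (card A) - 2) / 2))"
proof -
  define i where "i = card (T - A)"
  define j where "j = card (A - T)"
  have fA: "finite A" using A finite_subset by auto
  have npos: "0 < real n" using n by simp
  have pos: "0 < rho {..<p} e" using lo npos by (smt (verit) divide_pos_pos mult_pos_pos)
  note rp = rho_pos[OF pos A(1)] rho_pos[OF pos T] rho_pos[OF pos, of "{}"]
  have "card A = card (A \<inter> T) + j" "card T = card (A \<inter> T) + i"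
    using card_Int_Diff[OF fA, of T] card_Int_Diff[OF finite_T, of A] by (auto simp: i_def j_def Int_commute)
  then have aij: "card A + i = card T + j" and it: "i \<le> card T" by auto
  have jN: "j \<le> N" unfolding j_def using A by (intro card_mono) auto
  have ap: "card A \<le> p" "card T \<le> p" using card_mono[OF _ A(1)] card_mono[OF _ T] by auto
  have \<Lambda>: "1 \<le> \<Lambda>" unfolding \<Lambda>_def by (rule one_le_max_inverse[OF lam])
  let ?M = "(real n - real (card A) - 2) / 2" and ?V = "misfit A e" and ?rF = "rho {..<p} e"
  have M: "0 \<le> ?M" "?M \<le> real n / 2" using n ap by auto
  have mono: "?rF \<le> rho T e" "rho T e \<le> rho {} e" using T by (auto intro!: rho_antimono)
  have V: "0 \<le> ?V" by simp
  have "rho T e / rho A e \<le> (rho T e / ?rF) * (1 / (1 + ?V / ?rF))"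
  proof -
    have "rho T e / rho A e \<le> rho T e / (?rF + ?V)"
    proof (rule divide_left_mono[OF rho_misfit[OF A]])
      show "0 \<le> rho T e" "0 < rho A e * (?rF + ?V)" using rp pos V by (simp_all add: add_pos_nonneg)
    qed
    also have "?rF + ?V = ?rF * (1 + ?V / ?rF)" using pos by (simp add: field_simps)
    finally show ?thesis by simp
  qed
  then have "(rho T e / rho A e) powr ?M \<le> ((rho T e / ?rF) * (1 / (1 + ?V / ?rF))) powr ?M"
    using rp M by (intro powr_mono2) auto
  also have "\<dots> = (rho T e / ?rF) powr ?M * (1 + ?V / ?rF) powr (- ?M)"
    using rp pos V by (simp add: powr_mult powr_divide powr_minus_divide)
  also have "\<dots> \<le> exp (c / (196 / 100)) ^ N * (1 + ?V / ?rF) powr (- ?M)"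
  proof (intro mult_right_mono)
    have "?M * ((rho T e - ?rF) / ?rF) \<le> real n / 2 * ((c * N) / (98 / 100 * real n))"
      using M gain mono lo npos c by (intro mult_mono frac_le) auto
    also have "\<dots> = real N * (c / (196 / 100))" using npos by simp
    finally have "exp (?M * ((rho T e - ?rF) / ?rF)) \<le> exp (c / (196 / 100)) ^ N"
      by (simp only: exp_le_cancel_iff exp_of_nat_mult[symmetric])
    moreover have "(rho T e / ?rF) powr ?M \<le> exp (?M * ((rho T e - ?rF) / ?rF))"
      using pos mono M by (intro ratio_powr_le_exp) auto
    ultimately show "(rho T e / ?rF) powr ?M \<le> exp (c / (196 / 100)) ^ N" by linarith
  qed simp
  finally have 1: "(rho T e / rho A e) powr ?M \<le> exp (c / (196 / 100)) ^ N * (1 + ?V / ?rF) powr (- ?M)" .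
  have 2: "(rho T e / rho {} e) powr ((real (card A) - real (card T)) / 2) \<le> K ^ i"
  proof (cases "card T \<le> card A")
    case True
    then have "(rho T e / rho {} e) powr ((real (card A) - real (card T)) / 2) \<le> 1"
      using rp mono by (intro powr_le1) auto
    then show ?thesis using one_le_power[OF K(2), of i] by linarith
  next
    case False
    let ?h = "(real (card T) - real (card A)) / 2"
    have "(rho T e / rho {} e) powr ((real (card A) - real (card T)) / 2) = (rho {} e / rho T e) powr ?h"
    proof -
      have e: "(real (card A) - real (card T)) / 2 = - ?h" by (simp add: field_simps)
      show ?thesis unfolding e powr_minus_divide using rp by (simp add: powr_divide)
    qed
    also have "\<dots> \<le> K powr ?h" using K rp False by (intro powr_mono2) (auto simp: field_simps)
    also have "\<dots> \<le> K powr real i" using K(2) aij by (intro powr_mono) auto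
    also have "\<dots> = K ^ i" using K(2) by (simp add: powr_realpow)
    finally show ?thesis .
  qed
  have 3: "size_factor n (card A) / size_factor n (card T) \<le> sqrt ((2 * real n) ^ i * fact (card T - i) / fact (card T))"
    by (rule size_factor_underfit[OF n \<kappa> aij ap(1) it ap(2)])
  have 4: "lam ^ card A / lam ^ card T \<le> \<Lambda> ^ i * \<Lambda> ^ N"
  proof -
    have "lam ^ card A / lam ^ card T \<le> \<Lambda> ^ (i + j)" unfolding \<Lambda>_def by (rule power_quotient_le[OF lam aij])
    also have "\<dots> \<le> \<Lambda> ^ (i + N)" using \<Lambda> jN by (intro power_increasing) auto
    finally show ?thesis by (simp add: power_add)
  qed
  have 5: "fact (p - card A) / fact N \<le> (2 ^ i * 2 ^ N * fact i :: real)"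
  proof -
    have "p - card A \<le> N + i" using aij card_T_N by simp
    then have "fact (p - card A) \<le> (fact (N + i) :: real)" by (rule fact_mono)
    also have "fact (N + i) = real ((N + i) choose i) * fact i * fact N"
      by (simp add: binomial_fact)
    also have "\<dots> \<le> 2 ^ (N + i) * fact i * fact N"
    proof (intro mult_right_mono)
      have "real ((N + i) choose i) \<le> real (2 ^ (N + i))" by (intro of_nat_mono binomial_le_pow2)
      then show "real ((N + i) choose i) \<le> 2 ^ (N + i)" by simp
    qed simp_all
    finally show ?thesis by (simp add: field_simps power_add)
  qed
  let ?S = "sqrt ((2 * real n) ^ i * fact (card T - i) / fact (card T))"
  have "weight lam A e \<le> (exp (c / (196 / 100)) ^ N * (1 + ?V / ?rF) powr (- ?M)) * K ^ i * ?S
      * ((\<Lambda> ^ i * \<Lambda> ^ N) * (2 ^ i * 2 ^ N * fact i))"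
    unfolding weight_eq[OF lam n A(1) pos]
    using lam size_factor_pos[of "card T" n] size_factor_pos[of "card A" n] n ap K \<Lambda>
    by (intro mult_mono 1 2 3 4 5 mult_nonneg_nonneg) auto
  also have "\<dots> = underfit_coeff ((exp (c / (196 / 100)) * \<Lambda> * 2) ^ N) (K * \<Lambda> * 2) (2 * real n) i * (1 + ?V / ?rF) powr (- ?M)"
    by (simp add: underfit_coeff_def power_mult_distrib mult_ac)
  finally show ?thesis unfolding i_def .
qed

text \<open>Rate and level of the exponential bound in \<open>power_law_le_exp\<close>. One chord does not suffice: a chord that reaches as far
as the misfit of models that miss most of \<open>T\<close> is too flat for models that miss few predictors, whose number is
of order \<open>n ^ i\<close> rather than \<open>2 ^ t\<close>.\<close>

definition rate :: "nat \<Rightarrow> real" where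
  "rate i = (if 5 * i \<le> card T then 26 / 100 else 115 / 1000)"

definition level :: "nat \<Rightarrow> real" where
  "level i = (if 5 * i \<le> card T then 2 else 10)"

lemma total_weight_le:
  fixes c lam :: real
  assumes lam: "lam > 0" and n: "real p + 2 \<le> real n / 100" "0 < n" and \<kappa>: "real p / (real n - real p - 2) \<le> \<kappa>" "\<kappa> \<le> 1"
    and lo: "98 / 100 * real n \<le> rho {..<p} e" and hi: "rho {..<p} e \<le> 101 / 100 * real n"
    and gain: "\<And>J. J \<subseteq> {..<p} - T \<Longrightarrow> J \<noteq> {} \<Longrightarrow> rho T e - rho (T \<union> J) e \<le> c * card J" and c: "0 \<le> c"
    and K: "rho {} e \<le> K * rho T e" "1 \<le> K"
  defines "\<Lambda> \<equiv> max lam (1 / lam)"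
  defines "U \<equiv> underfit_coeff ((exp (c / (196 / 100)) * \<Lambda> * 2) ^ N) (K * \<Lambda> * 2) (2 * real n)"
  assumes under: "(\<Sum>A\<in>underfitting. U (card (T - A)) * exp (- rate (card (T - A)) * misfit A e)) \<le> \<eta>"
  shows "(\<Sum>A\<in>Pow {..<p}. weight lam A e) \<le> exp (exp (c / (196 / 100)) * sqrt \<kappa> * lam) + \<eta>
     + 2 ^ N * (\<Sum>i=1..card T. real (card T choose i) * (U i * exp (- rate i * (level i * real n))))"
proof -
  let ?M = "underfitting" and ?S = "{..<p} - T"
  let ?x = "exp (c / (196 / 100)) * sqrt \<kappa> * lam"
  have n': "p + 2 < n" using n by linarith
  have npos: "0 < real n" using n by simp
  have pos: "0 < rho {..<p} e" using lo npos by (smt (verit) divide_pos_pos mult_pos_pos)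
  have \<kappa>0: "0 \<le> \<kappa>"
  proof -
    have "0 \<le> real p / (real n - real p - 2)" using n' by (intro divide_nonneg_nonneg) auto
    then show ?thesis using \<kappa> by simp
  qed
  have finM: "finite ?M" by (rule finite_subset[of _ "Pow {..<p}"]) auto
  have "Pow {..<p} = ?M \<union> {A. A \<subseteq> {..<p} \<and> T \<subseteq> A}" by auto
  then have "(\<Sum>A\<in>Pow {..<p}. weight lam A e) = (\<Sum>A\<in>?M. weight lam A e) + (\<Sum>A\<in>{A. A \<subseteq> {..<p} \<and> T \<subseteq> A}. weight lam A e)"
    using finM by (simp, subst sum.union_disjoint) (auto intro: finite_subset[of _ "Pow {..<p}"])
  also have "(\<Sum>A\<in>{A. A \<subseteq> {..<p} \<and> T \<subseteq> A}. weight lam A e) = (\<Sum>J\<in>Pow ?S. weight lam (T \<union> J) e)"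
    by (rule sum.reindex_bij_witness[of _ "\<lambda>J. T \<union> J" "\<lambda>A. A - T"]) (use T in \<open>auto simp: Un_absorb1\<close>)
  also have "\<dots> = 1 + (\<Sum>J\<in>Pow ?S - {{}}. weight lam (T \<union> J) e)"
    using weight_true[OF lam n' pos] by (subst sum.remove[of _ "{}"]) auto
  also have "(\<Sum>J\<in>Pow ?S - {{}}. weight lam (T \<union> J) e) \<le> (\<Sum>J\<in>Pow ?S - {{}}. ?x ^ card J * (fact (card ?S - card J) / fact (card ?S)))"
  proof (rule sum_mono)
    fix J assume "J \<in> Pow ?S - {{}}"
    then have "J \<subseteq> ?S" "J \<noteq> {}" by auto
    then show "weight lam (T \<union> J) e \<le> ?x ^ card J * (fact (card ?S - card J) / fact (card ?S))"
      by (intro overfit_weight[OF lam n' \<kappa>(1) lo _ gain c])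
  qed
  also have "\<dots> \<le> exp ?x - 1"
    using lam \<kappa>0 by (intro overfit_sum_le) auto
  also have "(\<Sum>A\<in>?M. weight lam A e) \<le> (\<Sum>A\<in>?M. U (card (T - A)) * exp (- rate (card (T - A)) * misfit A e)
      + U (card (T - A)) * exp (- rate (card (T - A)) * (level (card (T - A)) * real n)))"
  proof (rule sum_mono)
    fix A assume "A \<in> ?M"
    then have A: "A \<subseteq> {..<p}" "\<not> T \<subseteq> A" by auto
    let ?i = "card (T - A)"
    have gF: "rho T e - rho {..<p} e \<le> c * N"
    proof (cases "?S = {}")
      case True
      then have "T = {..<p}" using T by auto
      then show ?thesis by simp
    next
      case False
      have "T \<union> ?S = {..<p}" using T by auto
      then show ?thesis using gain[OF order_refl False] by simp
    qed
    have U0: "0 \<le> U ?i" unfolding U_def underfit_coeff_def using K lam by (auto simp: \<Lambda>_def)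
    have "weight lam A e \<le> U ?i * (1 + misfit A e / rho {..<p} e) powr (- ((real n - real (card A) - 2) / 2))"
      unfolding U_def \<Lambda>_def by (rule underfit_weight[OF lam n' _ lo A gF c K]) (use \<kappa> in simp)
    also have "\<dots> \<le> U ?i * (exp (- rate ?i * misfit A e) + exp (- rate ?i * (level ?i * real n)))"
    proof (intro mult_left_mono power_law_le_exp U0)
      have "card A \<le> p" using card_mono[OF _ A(1)] by simp
      then show "495 / 1000 * real n \<le> (real n - real (card A) - 2) / 2" using n by (simp add: field_simps)
      show "(if 5 * ?i \<le> card T then 106 / 100 else 233 / 100) \<le> ln (1 + level ?i / (101 / 100))"
        using ln_bounds by (simp add: level_def)
    qed (use pos hi npos in \<open>auto simp: rate_def level_def\<close>)
    finally show "weight lam A e \<le> U ?i * exp (- rate ?i * misfit A e) + U ?i * exp (- rate ?i * (level ?i * real n))"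
      by (simp add: algebra_simps)
  qed
  also have "\<dots> \<le> \<eta> + 2 ^ N * (\<Sum>i=1..card T. real (card T choose i) * (U i * exp (- rate i * (level i * real n))))"
    using under missing_sum[of "\<lambda>i. U i * exp (- rate i * (level i * real n))"] by (simp add: sum.distrib)
  finally show ?thesis by simp
qed

end

section \<open>Concentration of the posterior at a fixed sample size\<close>

lemma geometric_tail_le:
  fixes x :: real
  assumes "0 \<le> x" "x \<le> 1 / 2"
  shows "(\<Sum>i=1..m. x ^ i) \<le> 2 * x"
proof -
  have "(\<Sum>i=1..m. x ^ i) \<le> 2 * x - 2 * x ^ Suc m"
  proof (induction m)
    case (Suc m)
    have "x ^ Suc m * x \<le> x ^ Suc m * (1 / 2)" using assms by (intro mult_left_mono) auto
    moreover have "(\<Sum>i=1..Suc m. x ^ i) = (\<Sum>i=1..m. x ^ i) + x ^ Suc m" by simp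
    moreover have "x ^ Suc (Suc m) = x ^ Suc m * x" by simp
    ultimately show ?case using Suc.IH by linarith
  qed simp
  moreover have "0 \<le> x ^ Suc m" using assms by simp
  ultimately show ?thesis by linarith
qed

context regression
begin

text \<open>With \<open>f = t! / (t - i)!\<close> the product is \<open>R B ^ i sqrt (f m ^ i)\<close>, and \<open>f \<le> m ^ i\<close>.\<close>

lemma choose_underfit_coeff_le:
  assumes i: "i \<le> card T" and m: "real (card T) \<le> m" and RB: "0 \<le> R" "0 \<le> B"
  shows "real (card T choose i) * underfit_coeff R B m i \<le> R * (B * m) ^ i"
proof -
  let ?t = "card T"
  define f :: real where "f = fact ?t / fact (?t - i)"
  have f: "0 < f" by (simp add: f_def)
  have "f \<le> real ?t ^ i" using fact_le_pow_mult_fact[OF i] by (simp add: f_def field_simps)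
  also have "\<dots> \<le> m ^ i" using m by (intro power_mono) auto
  finally have fm: "f \<le> m ^ i" .
  have m0: "0 \<le> m" using m by linarith
  have "real (?t choose i) * fact i = f" using i by (simp add: binomial_fact f_def)
  moreover have "m ^ i * fact (?t - i) / fact ?t = m ^ i / f" by (simp add: f_def)
  ultimately have "real (?t choose i) * underfit_coeff R B m i = R * B ^ i * (f * sqrt (m ^ i / f))"
    unfolding underfit_coeff_def by (simp add: mult_ac)
  also have "f * sqrt (m ^ i / f) = sqrt (f * m ^ i)"
    using f by (simp add: real_sqrt_mult real_sqrt_divide field_simps)
  also have "\<dots> \<le> sqrt (m ^ i * m ^ i)" using fm m0 by (intro real_sqrt_le_mono mult_right_mono) auto
  also have "\<dots> = m ^ i" using m0 by simp
  finally show ?thesis using RB by (simp add: power_mult_distrib mult_left_mono mult.assoc)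
qed

lemma choose_sqrt_underfit_coeff_le:
  assumes i: "i \<le> card T" and m: "real (card T) \<le> m" and RB: "0 \<le> R" "0 \<le> B"
  shows "real (card T choose i) * sqrt (underfit_coeff R B m i) \<le> sqrt (real (card T choose i) * (R * (B * m) ^ i))"
proof -
  let ?C = "real (card T choose i)"
  have "?C * sqrt (underfit_coeff R B m i) = sqrt (?C * (?C * underfit_coeff R B m i))"
    by (simp add: real_sqrt_mult)
  also have "\<dots> \<le> sqrt (?C * (R * (B * m) ^ i))"
    by (intro real_sqrt_le_mono mult_left_mono choose_underfit_coeff_le[OF assms]) simp
  finally show ?thesis .
qed

text \<open>The number of models enters through the square root of the binomial coefficient: at most \<open>(2 n) ^ (i/2)\<close> in
general, but only \<open>32 ^ (i/2)\<close> if \<open>i > t/5\<close>, where the rate is smaller. In both cases the decay leaves a factor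
\<open>n powr (-1/100)\<close> per missing predictor.\<close>

lemma underfit_moment_term_le:
  assumes i: "1 \<le> i" "i \<le> card T" and n: "real (card T) \<le> 2 * real n" and RB: "0 \<le> R" "1 \<le> B"
    and \<delta>: "99 / 10 * ln (real n) \<le> \<delta>"
  shows "real (card T choose i) * (sqrt (underfit_coeff R B (2 * real n) i) * exp (- (rate i / (2 * (1 + rate i))) * (\<delta> * real i)))
    \<le> sqrt R * (8 * sqrt B * real n powr (- (1 / 100))) ^ i"
proof -
  let ?t = "card T" and ?n = "real n"
  have n1: "1 \<le> ?n" using n i n_pos by simp
  have L: "0 \<le> ln ?n" using n1 by simp
  have key: "sqrt (real (?t choose i)) * sqrt (B * (2 * ?n)) ^ i * exp (- (rate i / (2 * (1 + rate i))) * (\<delta> * real i))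
     \<le> (8 * sqrt B * ?n powr (- (1 / 100))) ^ i"
  proof (cases "5 * i \<le> ?t")
    case True
    have "real (?t choose i) \<le> real (?t ^ i)" by (intro of_nat_mono binomial_le_pow i)
    also have "real (?t ^ i) = real ?t ^ i" by simp
    also have "\<dots> \<le> (2 * ?n) ^ i" using n by (intro power_mono) auto
    finally have "sqrt (real (?t choose i)) \<le> sqrt ((2 * ?n) ^ i)" by (rule real_sqrt_le_mono)
    then have 1: "sqrt (real (?t choose i)) \<le> sqrt (2 * ?n) ^ i" by (simp only: real_sqrt_power)
    \<comment> \<open>The decay \<open>c / (2 (1 + c))\<close> for \<open>c = 26/100\<close> is \<open>26/252\<close>.\<close>
    have "102 / 100 * ln ?n \<le> (26 / 252) * (99 / 10 * ln ?n)" using L by simp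
    also have "\<dots> \<le> (26 / 252) * \<delta>" using \<delta> by simp
    finally have "exp (- (26 / 252) * \<delta>) \<le> ?n powr (- (102 / 100))" using n1 by (simp add: powr_def)
    then have "exp (- (26 / 252) * \<delta>) ^ i \<le> (?n powr (- (102 / 100))) ^ i" by (intro power_mono) auto
    then have 2: "exp (- (rate i / (2 * (1 + rate i))) * (\<delta> * real i)) \<le> (?n powr (- (102 / 100))) ^ i"
      using True by (simp add: rate_def exp_of_nat_mult[symmetric] mult_ac)
    have "sqrt (real (?t choose i)) * sqrt (B * (2 * ?n)) ^ i * exp (- (rate i / (2 * (1 + rate i))) * (\<delta> * real i))
      \<le> sqrt (2 * ?n) ^ i * sqrt (B * (2 * ?n)) ^ i * (?n powr (- (102 / 100))) ^ i"
      using RB n1 by (intro mult_mono 1 2) auto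
    also have "\<dots> = (sqrt (2 * ?n) * sqrt (B * (2 * ?n)) * ?n powr (- (102 / 100))) ^ i"
      by (simp add: power_mult_distrib)
    also have "sqrt (2 * ?n) * sqrt (B * (2 * ?n)) * ?n powr (- (102 / 100)) = 2 * sqrt B * (?n powr 1 * ?n powr (- (102 / 100)))"
    proof -
      have "sqrt (2 * ?n) * sqrt (B * (2 * ?n)) = sqrt ((2 * ?n)\<^sup>2 * B)"
        unfolding real_sqrt_mult[symmetric] power2_eq_square by (simp add: mult_ac)
      also have "\<dots> = 2 * ?n * sqrt B" unfolding real_sqrt_mult[of "(2 * ?n)\<^sup>2" B] real_sqrt_abs using n1 by simp
      finally show ?thesis using n1 by simp
    qed
    also have "?n powr 1 * ?n powr (- (102 / 100)) = ?n powr (- (2 / 100))" unfolding powr_add[symmetric] by simp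
    also have "(2 * sqrt B * ?n powr (- (2 / 100))) ^ i \<le> (8 * sqrt B * ?n powr (- (1 / 100))) ^ i"
      using n1 RB by (intro power_mono mult_mono powr_mono) auto
    finally show ?thesis .
  next
    case False
    have "real (?t choose i) \<le> real (2 ^ ?t)" by (intro of_nat_mono binomial_le_pow2)
    also have "\<dots> \<le> 2 ^ (5 * i)" using False by (simp add: power_increasing)
    also have "\<dots> = 32 ^ i" by (simp add: power_mult)
    finally have "sqrt (real (?t choose i)) \<le> sqrt (32 ^ i)" by simp
    then have 1: "sqrt (real (?t choose i)) \<le> sqrt 32 ^ i" by (simp add: real_sqrt_power)
    \<comment> \<open>The decay \<open>c / (2 (1 + c))\<close> for \<open>c = 115/1000\<close> is \<open>115/2230\<close>.\<close>
    have "51 / 100 * ln ?n \<le> (115 / 2230) * (99 / 10 * ln ?n)" using L by simp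
    also have "\<dots> \<le> (115 / 2230) * \<delta>" using \<delta> by simp
    finally have "exp (- (115 / 2230) * \<delta>) \<le> ?n powr (- (51 / 100))" using n1 by (simp add: powr_def)
    then have "exp (- (115 / 2230) * \<delta>) ^ i \<le> (?n powr (- (51 / 100))) ^ i" by (intro power_mono) auto
    then have 2: "exp (- (rate i / (2 * (1 + rate i))) * (\<delta> * real i)) \<le> (?n powr (- (51 / 100))) ^ i"
      using False by (simp add: rate_def exp_of_nat_mult[symmetric] mult_ac)
    have "sqrt (real (?t choose i)) * sqrt (B * (2 * ?n)) ^ i * exp (- (rate i / (2 * (1 + rate i))) * (\<delta> * real i))
      \<le> sqrt 32 ^ i * sqrt (B * (2 * ?n)) ^ i * (?n powr (- (51 / 100))) ^ i"
      using RB n1 by (intro mult_mono 1 2) auto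
    also have "\<dots> = (sqrt 32 * sqrt (B * (2 * ?n)) * ?n powr (- (51 / 100))) ^ i"
      by (simp add: power_mult_distrib)
    also have "sqrt 32 * sqrt (B * (2 * ?n)) * ?n powr (- (51 / 100)) = 8 * sqrt B * (?n powr (1 / 2) * ?n powr (- (51 / 100)))"
    proof -
      have "sqrt 32 * sqrt (B * (2 * ?n)) = sqrt (64 * (B * ?n))" by (simp flip: real_sqrt_mult)
      also have "\<dots> = sqrt 64 * (sqrt B * sqrt ?n)" by (simp only: real_sqrt_mult)
      also have "sqrt 64 = (8::real)" by (rule real_sqrt_unique) auto
      finally show ?thesis using n1 by (simp add: powr_half_sqrt)
    qed
    also have "?n powr (1 / 2) * ?n powr (- (51 / 100)) = ?n powr (- (1 / 100))" unfolding powr_add[symmetric] by simp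
    finally show ?thesis .
  qed
  have "real (?t choose i) * (sqrt (underfit_coeff R B (2 * ?n) i) * exp (- (rate i / (2 * (1 + rate i))) * (\<delta> * real i)))
    = (real (?t choose i) * sqrt (underfit_coeff R B (2 * ?n) i)) * exp (- (rate i / (2 * (1 + rate i))) * (\<delta> * real i))" by simp
  also have "\<dots> \<le> sqrt (real (?t choose i) * (R * (B * (2 * ?n)) ^ i)) * exp (- (rate i / (2 * (1 + rate i))) * (\<delta> * real i))"
    using RB by (intro mult_right_mono choose_sqrt_underfit_coeff_le i n) auto
  also have "\<dots> = sqrt R * (sqrt (real (?t choose i)) * sqrt (B * (2 * ?n)) ^ i * exp (- (rate i / (2 * (1 + rate i))) * (\<delta> * real i)))"
    by (simp add: real_sqrt_mult real_sqrt_power power_mult_distrib mult_ac)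
  also have "\<dots> \<le> sqrt R * (8 * sqrt B * ?n powr (- (1 / 100))) ^ i"
    using RB key by (intro mult_left_mono) auto
  finally show ?thesis .
qed

lemma underfit_moment_sum_le:
  assumes n: "real (card T) \<le> 2 * real n" and RB: "0 \<le> R" "1 \<le> B"
    and \<delta>: "99 / 10 * ln (real n) \<le> \<delta>" and \<xi>: "8 * sqrt B * real n powr (- (1 / 100)) \<le> 1 / 2"
  shows "(\<Sum>A\<in>underfitting. sqrt (underfit_coeff R B (2 * real n) (card (T - A)))
      * exp (- (rate (card (T - A)) / (2 * (1 + rate (card (T - A))))) * (\<delta> * card (T - A))))
    \<le> 2 ^ N * sqrt R * (16 * sqrt B * real n powr (- (1 / 100)))"
proof -
  let ?h = "\<lambda>i. sqrt (underfit_coeff R B (2 * real n) i) * exp (- (rate i / (2 * (1 + rate i))) * (\<delta> * real i))"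
  let ?x = "8 * sqrt B * real n powr (- (1 / 100))"
  have "(\<Sum>A\<in>underfitting. ?h (card (T - A))) = 2 ^ N * (\<Sum>i=1..card T. real (card T choose i) * ?h i)"
    by (rule missing_sum)
  also have "\<dots> \<le> 2 ^ N * (\<Sum>i=1..card T. sqrt R * ?x ^ i)"
    by (intro mult_left_mono sum_mono underfit_moment_term_le n RB \<delta>) auto
  also have "\<dots> = 2 ^ N * (sqrt R * (\<Sum>i=1..card T. ?x ^ i))" by (simp add: sum_distrib_left)
  also have "\<dots> \<le> 2 ^ N * (sqrt R * (2 * ?x))"
    using RB \<xi> by (intro mult_left_mono geometric_tail_le) auto
  finally show ?thesis by (simp add: mult_ac)
qed

text \<open>Models whose misfit is beyond the level of the chord need no probability: their bounds are summable as they are.\<close>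

lemma underfit_level_sum_le:
  assumes n: "real (card T) \<le> real n" and RB: "0 \<le> R" "1 \<le> B"
    and t: "real (card T) * ln (B * (2 * real n)) \<le> 11 / 10 * real n"
  shows "(\<Sum>i=1..card T. real (card T choose i) * (underfit_coeff R B (2 * real n) i * exp (- rate i * (level i * real n))))
    \<le> R * real n * exp (- (5 / 100) * real n)"
proof -
  have n1: "1 \<le> real n" using n_pos by simp
  have Bn: "1 \<le> B * (2 * real n)" using mult_mono[of 1 B 1 "2 * real n"] RB n1 by simp
  have ln0: "0 \<le> ln (B * (2 * real n))" using Bn by simp
  have "real (card T choose i) * (underfit_coeff R B (2 * real n) i * exp (- rate i * (level i * real n))) \<le> R * exp (- (5 / 100) * real n)"
    if i: "i \<in> {1..card T}" for i
  proof -
    have "real (card T choose i) * underfit_coeff R B (2 * real n) i \<le> R * (B * (2 * real n)) ^ i"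
      using RB n i by (intro choose_underfit_coeff_le) auto
    also have "(B * (2 * real n)) ^ i = exp (real i * ln (B * (2 * real n)))"
      using Bn by (simp add: exp_of_nat_mult)
    finally have 1: "real (card T choose i) * underfit_coeff R B (2 * real n) i \<le> R * exp (real i * ln (B * (2 * real n)))" .
    have "real i * ln (B * (2 * real n)) - rate i * (level i * real n) \<le> - (5 / 100) * real n"
    proof (cases "5 * i \<le> card T")
      case True
      then have "5 * real i \<le> real (card T)" by simp
      then have "5 * (real i * ln (B * (2 * real n))) \<le> real (card T) * ln (B * (2 * real n))"
        using mult_right_mono[OF _ ln0, of "5 * real i" "real (card T)"] by simp
      then show ?thesis using t True n1 by (simp add: rate_def level_def)
    next
      case False
      have "real i * ln (B * (2 * real n)) \<le> real (card T) * ln (B * (2 * real n))"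
        using i ln0 by (intro mult_right_mono) auto
      then show ?thesis using t False n1 by (simp add: rate_def level_def)
    qed
    then have 2: "exp (real i * ln (B * (2 * real n))) * exp (- rate i * (level i * real n)) \<le> exp (- (5 / 100) * real n)"
      by (simp flip: exp_add)
    have "real (card T choose i) * (underfit_coeff R B (2 * real n) i * exp (- rate i * (level i * real n)))
      \<le> R * exp (real i * ln (B * (2 * real n))) * exp (- rate i * (level i * real n))"
      using mult_right_mono[OF 1, of "exp (- rate i * (level i * real n))"] by (simp add: mult_ac)
    also have "\<dots> = R * (exp (real i * ln (B * (2 * real n))) * exp (- rate i * (level i * real n)))" by simp
    also have "\<dots> \<le> R * exp (- (5 / 100) * real n)" using 2 RB by (intro mult_left_mono) auto
    finally show ?thesis .
  qed
  then have "(\<Sum>i=1..card T. real (card T choose i) * (underfit_coeff R B (2 * real n) i * exp (- rate i * (level i * real n))))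
    \<le> real (card {1..card T}) * (R * exp (- (5 / 100) * real n))"
    by (intro sum_bounded_above) auto
  also have "\<dots> \<le> real n * (R * exp (- (5 / 100) * real n))"
    using n RB by (intro mult_right_mono) auto
  finally show ?thesis by (simp add: mult_ac)
qed

lemma measurable_quadratic_response:
  assumes M: "M \<in> carrier_mat n n"
  shows "(\<lambda>e. resp e \<bullet> (M *\<^sub>v resp e)) \<in> borel_measurable noise"
proof -
  define m where "m = a \<cdot>\<^sub>v ones n + X *\<^sub>v b"
  have m: "dim_vec m = n" unfolding m_def by (rule carrier_vecD) simp
  have ri: "resp e $ i = m $ i + e i" if "i < n" for e i
    using that m unfolding resp_def m_def[symmetric] by simp
  have d: "dim_vec (resp e) = n" for e by (rule carrier_vecD) simp
  have "(M *\<^sub>v resp e) $ i = (\<Sum>j<n. M $$ (i, j) * (m $ j + e j))" if "i < n" for e i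
    using M that by (auto simp: scalar_prod_def lessThan_atLeast0 d ri intro!: sum.cong)
  then have "resp e \<bullet> (M *\<^sub>v resp e) = (\<Sum>i<n. (m $ i + e i) * (\<Sum>j<n. M $$ (i, j) * (m $ j + e j)))" for e
    using M by (auto simp: scalar_prod_def[of "resp e"] lessThan_atLeast0 ri simp del: index_mult_mat_vec intro!: sum.cong)
  then have "(\<lambda>e. resp e \<bullet> (M *\<^sub>v resp e)) = (\<lambda>e. \<Sum>i<n. (m $ i + e i) * (\<Sum>j<n. M $$ (i, j) * (m $ j + e j)))"
    by (rule ext)
  also have "\<dots> \<in> borel_measurable noise"
    by (intro borel_measurable_sum borel_measurable_times borel_measurable_add borel_measurable_const measurable_noise_component) auto
  finally show ?thesis .
qed

text \<open>The measure of a set that is not measurable is 0 by convention, so the event in the theorem needs this.\<close>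

lemma measurable_posterior:
  "(\<lambda>e. posterior_prob lam n p X (resp e) T) \<in> borel_measurable noise"
proof -
  have C: "proj1 A \<in> carrier_mat n n" if "A \<subseteq> {..<p}" for A
    by (rule orth_proj_carrier[OF finite_cols(2)[OF that] cols_carrier(2)])
  have [measurable]: "(\<lambda>e. R_squared n X (resp e) A) \<in> borel_measurable noise" if "A \<subseteq> {..<p}" for A
    unfolding R_squared_def proj_model_eq(2)[OF that] proj_model_eq(3)
    using C[OF that] C[of "{}"]
    by (intro borel_measurable_divide measurable_quadratic_response minus_carrier_mat) auto
  have "(\<lambda>e. weight lam A e) \<in> borel_measurable noise" if "A \<subseteq> {..<p}" for A
    unfolding weight_def bayes_factor_def using that T by measurable
  then show ?thesis unfolding posterior_eq by (intro borel_measurable_inverse borel_measurable_sum) auto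
qed

lemma weight_nonneg:
  assumes "lam > 0" "p + 2 < n" "A \<subseteq> {..<p}" "0 < rho {..<p} e" shows "0 \<le> weight lam A e"
proof -
  have "card A \<le> p" "card T \<le> p" using card_mono[OF _ assms(3)] card_mono[OF _ T] by auto
  then have "0 < size_factor n (card A)" "0 < size_factor n (card T)" using assms(2) by (auto intro!: size_factor_pos)
  then show ?thesis unfolding weight_eq[OF assms] using assms(1) by (intro mult_nonneg_nonneg) auto
qed

text \<open>The exceptional events are a large gain from extra predictors, too small a residual of the full model, too long a
noise vector, and a large sum over the models that miss a true predictor. Outside of them the sum of all
weights is at most \<open>1 + \<epsilon>\<close>, and \<open>1 / (1 + \<epsilon>) \<ge> 1 - \<epsilon>\<close>.\<close>

lemma posterior_concentration:
  fixes c lam C \<kappa> \<eta> :: real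
  assumes lam: "lam > 0" and n: "real p + 2 \<le> real n / 100"
    and \<kappa>: "real p / (real n - real p - 2) \<le> \<kappa>" "\<kappa> \<le> 1" and c: "0 \<le> c"
    and mean: "(X *\<^sub>v b) \<bullet> (X *\<^sub>v b) \<le> C * real n * s\<^sup>2" "0 \<le> C"
    and \<delta>: "99 / 10 * ln (real n) \<le> \<delta>" and \<eta>: "0 < \<eta>"
  defines "\<Lambda> \<equiv> max lam (1 / lam)"
  defines "R \<equiv> (exp (c / (196 / 100)) * \<Lambda> * 2) ^ N" and "B \<equiv> (3 * C + 5) * \<Lambda> * 2"
  assumes \<xi>: "8 * sqrt B * real n powr (- (1 / 100)) \<le> 1 / 2"
    and t: "real (card T) * ln (B * (2 * real n)) \<le> 11 / 10 * real n"
  shows "measure noise {e \<in> space noise. posterior_prob lam n p X (resp e) T \<ge>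
       1 - (exp (exp (c / (196 / 100)) * sqrt \<kappa> * lam) - 1 + \<eta> + 2 ^ N * (R * real n * exp (- (5 / 100) * real n)))}
    \<ge> 1 - (((1 + exp (- (47 / 100) * c) / sqrt (1 - 2 * (47 / 100))) ^ N - 1)
       + (exp (4 / 1000 * (99 / 100 * real n)) / sqrt (1 + 2 * (4 / 1000)) ^ n
          + exp (- (4 / 1000) * (1 / 100 * real n)) / sqrt (1 - 2 * (4 / 1000)) ^ (p + 1))
       + exp (- (4 / 1000) * (101 / 100 * real n)) / sqrt (1 - 2 * (4 / 1000)) ^ n
       + 2 ^ N * sqrt R * (16 * sqrt B * real n powr (- (1 / 100))) / sqrt \<eta>)"
    (is "measure noise ?G \<ge> 1 - (?P1 + ?P2 + ?P3 + ?P4)")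
proof -
  interpret prob_space noise by (rule prob_space_gaussian_noise[OF s_pos])
  let ?U = "underfit_coeff R B (2 * real n)"
  have \<Lambda>: "1 \<le> \<Lambda>" unfolding \<Lambda>_def by (rule one_le_max_inverse[OF lam])
  have B1: "1 \<le> B"
  proof -
    have "1 * 1 \<le> (3 * C + 5) * \<Lambda>" using \<Lambda> mean(2) by (intro mult_mono) auto
    then show ?thesis unfolding B_def by simp
  qed
  have R0: "0 \<le> R" using \<Lambda> by (simp add: R_def)
  have n': "p + 2 < n" using n by linarith
  have tn: "real (card T) \<le> real n" using card_T_N n by linarith
  let ?E1 = "{e \<in> space noise. \<exists>J. J \<subseteq> {..<p} - T \<and> J \<noteq> {} \<and> c * card J \<le> rho T e - rho (T \<union> J) e}"
  let ?E2 = "{e \<in> space noise. rho {..<p} e \<le> 99 / 100 * real n - 1 / 100 * real n}"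
  let ?E3 = "{e \<in> space noise. 101 / 100 * real n * s\<^sup>2 \<le> (\<Sum>i<n. (e i)\<^sup>2)}"
  let ?E4 = "{e \<in> space noise. \<eta> \<le> (\<Sum>A\<in>underfitting. ?U (card (T - A)) * exp (- rate (card (T - A)) * misfit A e))}"
  have p1: "prob ?E1 \<le> ?P1" using overfit_prob[of "47 / 100" c] by simp
  have p2: "prob ?E2 \<le> ?P2" by (rule rho_full_prob) auto
  have p3: "prob ?E3 \<le> ?P3" by (rule noise_sumsq_upper_tail[OF s_pos]) auto
  have p4: "prob ?E4 \<le> ?P4"
  proof -
    have "prob ?E4 \<le> (\<Sum>A\<in>underfitting. sqrt (?U (card (T - A)))
      * exp (- (rate (card (T - A)) / (2 * (1 + rate (card (T - A))))) * (\<delta> * card (T - A)))) / sqrt \<eta>"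
      by (rule underfit_prob) (use \<eta> R0 B1 in \<open>auto simp: underfit_coeff_def rate_def\<close>)
    also have "\<dots> \<le> ?P4"
      using tn by (intro divide_right_mono underfit_moment_sum_le R0 B1 \<delta> \<xi>) (use \<eta> in auto)
    finally show ?thesis .
  qed
  have rho_meas: "rho A \<in> borel_measurable noise" if A: "A \<subseteq> {..<p}" for A
    unfolding rho_def rss_def
    by (intro borel_measurable_divide measurable_quadratic_response borel_measurable_const minus_carrier_mat
      orth_proj_carrier[OF finite_cols(2)[OF A] cols_carrier(2)])
  have m1: "?E1 \<in> events"
  proof -
    have "?E1 = (\<Union>J\<in>{J. J \<subseteq> {..<p} - T \<and> J \<noteq> {}}. {e \<in> space noise. c * card J \<le> rho T e - rho (T \<union> J) e})"
      by blast
    also have "\<dots> \<in> events"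
    proof (rule sets.finite_UN)
      show "finite {J. J \<subseteq> {..<p} - T \<and> J \<noteq> {}}" by (rule finite_subset[of _ "Pow {..<p}"]) auto
      fix J assume "J \<in> {J. J \<subseteq> {..<p} - T \<and> J \<noteq> {}}"
      then have "T \<union> J \<subseteq> {..<p}" using T by auto
      then show "{e \<in> space noise. c * card J \<le> rho T e - rho (T \<union> J) e} \<in> events"
        by (intro borel_measurable_le borel_measurable_const borel_measurable_diff rho_meas T)
    qed
    finally show ?thesis .
  qed
  have m2: "?E2 \<in> events" by (intro borel_measurable_le borel_measurable_const rho_meas) simp
  have m3: "?E3 \<in> events" by measurable
  have m4: "?E4 \<in> events"
    by (intro borel_measurable_le borel_measurable_const borel_measurable_sum borel_measurable_times
       borel_measurable_exp[THEN measurable_compose[rotated]] measurable_misfit)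
  have mG: "?G \<in> events" by (intro borel_measurable_le borel_measurable_const measurable_posterior)
  let ?Bad = "?E1 \<union> ?E2 \<union> ?E3 \<union> ?E4"
  have "space noise - ?Bad \<subseteq> ?G"
  proof
    fix e assume e: "e \<in> space noise - ?Bad"
    have gain: "rho T e - rho (T \<union> J) e \<le> c * card J" if "J \<subseteq> {..<p} - T" "J \<noteq> {}" for J
      using e that by (auto simp: not_le intro: less_imp_le)
    have lo: "98 / 100 * real n \<le> rho {..<p} e" using e by (auto simp: not_le)
    have up: "(\<Sum>i<n. (e i)\<^sup>2) / s\<^sup>2 \<le> 101 / 100 * real n" using e s_pos by (auto simp: not_le divide_le_eq intro: less_imp_le)
    have hi: "rho {..<p} e \<le> 101 / 100 * real n" using rho_le_noise[OF T order_refl, of e] up by linarith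
    have under: "(\<Sum>A\<in>underfitting. ?U (card (T - A)) * exp (- rate (card (T - A)) * misfit A e)) \<le> \<eta>"
      using e by (auto simp: not_le)
    have pos: "0 < rho {..<p} e" using lo n_pos by (smt (verit) divide_pos_pos mult_pos_pos of_nat_0_less_iff)
    have K: "rho {} e \<le> (3 * C + 5) * rho T e"
    proof -
      have "rho {} e \<le> 2 * ((X *\<^sub>v b) \<bullet> (X *\<^sub>v b)) / s\<^sup>2 + 2 * ((\<Sum>i<n. (e i)\<^sup>2) / s\<^sup>2)"
        using rho_empty_le[of e] by simp
      also have "2 * ((X *\<^sub>v b) \<bullet> (X *\<^sub>v b)) / s\<^sup>2 \<le> 2 * C * real n" using mean(1) s_pos by (simp add: field_simps)
      also have "2 * C * real n + 2 * ((\<Sum>i<n. (e i)\<^sup>2) / s\<^sup>2) \<le> 2 * C * real n + 2 * (101 / 100 * real n)"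
        by (intro add_left_mono mult_left_mono up) simp
      also have "\<dots> \<le> (3 * C + 5) * (98 / 100 * real n)" using mean(2) n_pos by (simp add: field_simps)
      also have "\<dots> \<le> (3 * C + 5) * rho T e"
        using lo rho_antimono[OF T order_refl, of e] mean(2) by (intro mult_left_mono) auto
      finally show ?thesis by simp
    qed
    have "(\<Sum>A\<in>Pow {..<p}. weight lam A e) \<le> exp (exp (c / (196 / 100)) * sqrt \<kappa> * lam) + \<eta>
     + 2 ^ N * (\<Sum>i=1..card T. real (card T choose i) * (?U i * exp (- rate i * (level i * real n))))"
      unfolding R_def B_def \<Lambda>_def
      by (rule total_weight_le[OF lam n n_pos \<kappa> lo hi gain c K])
        (use under mean(2) in \<open>auto simp: R_def B_def \<Lambda>_def\<close>)
    also have "\<dots> \<le> exp (exp (c / (196 / 100)) * sqrt \<kappa> * lam) + \<eta> + 2 ^ N * (R * real n * exp (- (5 / 100) * real n))"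
      by (intro add_left_mono mult_left_mono underfit_level_sum_le tn R0 B1 t) auto
    finally have S: "(\<Sum>A\<in>Pow {..<p}. weight lam A e) \<le> 1 + (exp (exp (c / (196 / 100)) * sqrt \<kappa> * lam) - 1 + \<eta> + 2 ^ N * (R * real n * exp (- (5 / 100) * real n)))"
      (is "?S \<le> 1 + ?\<epsilon>") by simp
    have "weight lam T e \<le> ?S"
      using weight_nonneg[OF lam n' _ pos] T by (intro member_le_sum) auto
    then have S1: "1 \<le> ?S" using weight_true[OF lam n' pos] by simp
    have "1 - ?\<epsilon> \<le> inverse ?S"
    proof -
      have "(1 - ?\<epsilon>) * ?S \<le> 1"
      proof (cases "1 - ?\<epsilon> \<le> 0")
        case True
        then show ?thesis using S1 mult_nonpos_nonneg[of "1 - ?\<epsilon>" ?S] by linarith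
      next
        case False
        then have "(1 - ?\<epsilon>) * ?S \<le> (1 - ?\<epsilon>) * (1 + ?\<epsilon>)" using S by (intro mult_left_mono) auto
        also have "\<dots> = 1 - ?\<epsilon>\<^sup>2" by (simp add: algebra_simps power2_eq_square)
        also have "\<dots> \<le> 1" by simp
        finally show ?thesis .
      qed
      then show ?thesis using S1 by (simp add: field_simps)
    qed
    then show "e \<in> ?G" using e by (simp add: posterior_eq)
  qed
  then have "prob (space noise - ?Bad) \<le> prob ?G" by (intro finite_measure_mono mG)
  moreover have "prob (space noise - ?Bad) = 1 - prob ?Bad"
    using m1 m2 m3 m4 by (intro prob_compl sets.Un)
  moreover have "prob ?Bad \<le> prob ?E1 + prob ?E2 + prob ?E3 + prob ?E4"
    using m1 m2 m3 m4 by (intro order_trans[OF measure_Un_le] add_mono order_refl sets.Un)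
  ultimately show ?thesis using p1 p2 p3 p4 by linarith
qed

end

section \<open>Growth rates\<close>

text \<open>With \<open>x = ln (ln n)\<close>: multiplied by \<open>sqrt \<zeta>\<close>, the second inequality contradicts the correlation condition, whose right hand
side is \<open>sqrt \<zeta> * sqrt (x / 8)\<close>, because \<open>sqrt (1/8) < 354/1000\<close>.\<close>

lemma eventually_extra_bound:
  "\<forall>\<^sub>F x in at_top. 0 < 37 / 100 * sqrt x - ln 3 / (4 / 100 * sqrt x) \<and>
     354 / 1000 * sqrt x < (1 - 8 * exp (- (79 / 10000) * x)) * (37 / 100 * sqrt x - ln 3 / (4 / 100 * sqrt (x::real)))"
proof (rule eventually_conj)
  show "\<forall>\<^sub>F x in at_top. 0 < 37 / 100 * sqrt x - ln 3 / (4 / 100 * sqrt (x::real))" by real_asymp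
  show "\<forall>\<^sub>F x in at_top. 354 / 1000 * sqrt x < (1 - 8 * exp (- (79 / 10000) * x)) * (37 / 100 * sqrt x - ln 3 / (4 / 100 * sqrt (x::real)))" by real_asymp
qed

lemma eventually_sizes:
  "\<forall>\<^sub>F n in sequentially. real n / ln (real n) + 1 + ln (real n) powr (4 / 25) + 2 \<le> real n / 100"
  "\<forall>\<^sub>F n in sequentially. (real n / ln (real n) + 1 + ln (real n) powr (4 / 25)) / (99 / 100 * real n) \<le> 3 / ln (real n)"
  "\<forall>\<^sub>F n in sequentially. 3 / ln (real n) \<le> 1"
  "\<forall>\<^sub>F n in sequentially. 99 / 10 * ln (real n) \<le> 10 * real n / (real n / ln (real n) + 1)"
  "\<forall>\<^sub>F n in sequentially. (real n / ln (real n) + 1) * (ln (real n) + ln (ln (real n))) \<le> 11 / 10 * real n"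
  by real_asymp+

lemma eventually_ln_ln_ge: "\<forall>\<^sub>F n in sequentially. (K::real) \<le> ln (ln (real n))"
proof -
  have "filterlim (\<lambda>n::nat. ln (ln (real n))) at_top sequentially" by real_asymp
  then show ?thesis by (simp add: filterlim_at_top)
qed

text \<open>Grows more slowly than any power of \<open>n\<close> and dominates all factors that are paid per extra predictor.\<close>

definition subpoly :: "nat \<Rightarrow> real" where
  "subpoly n = exp (2 * (ln (real n) powr (4 / 25) * ln (ln (real n))))"

lemma eventually_rates:
  "\<forall>\<^sub>F n in sequentially. exp (ln (real n) powr (4 / 25) * (5 * exp (- (4418 / 10000) * ln (ln (real n))))) - 1 \<le> ln (real n) powr (- 1 / 4) / 8"
  "\<forall>\<^sub>F n in sequentially. (99999 / 100000) powr (real n / 2) \<le> ln (real n) powr (- 1 / 4) / 8"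
  "\<forall>\<^sub>F n in sequentially. exp (- (4 / 100000) * real n + 1 / 100 * (real n / ln (real n) + 1 + ln (real n) powr (4 / 25) + 1)) \<le> ln (real n) powr (- 1 / 4) / 8"
  "\<forall>\<^sub>F n in sequentially. subpoly n * (ln (ln (real n)) * real n powr (- (1 / 100))) / sqrt (real n powr (- (1 / 100))) \<le> ln (real n) powr (- 1 / 4) / 8"
  unfolding subpoly_def by real_asymp+

lemma error_tendsto_0:
  "(\<lambda>n. exp (exp (94 / 100 * ln (ln (real n)) / (196 / 100)) * sqrt (3 / ln (real n)) * lam) - 1
     + real n powr (- (1 / 100)) + subpoly n * (real n * exp (- (5 / 100) * real n))) \<longlonglongrightarrow> 0"
proof -
  have "(\<lambda>n. exp (94 / 100 * ln (ln (real n)) / (196 / 100)) * sqrt (3 / ln (real n))) \<longlonglongrightarrow> 0" by real_asymp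
  then have "(\<lambda>n. exp (exp (94 / 100 * ln (ln (real n)) / (196 / 100)) * sqrt (3 / ln (real n)) * lam) - 1) \<longlonglongrightarrow> exp (0 * lam) - 1"
    by (intro tendsto_intros)
  moreover have "(\<lambda>n. real n powr (- (1 / 100))) \<longlonglongrightarrow> 0" by real_asymp
  moreover have "(\<lambda>n. subpoly n * (real n * exp (- (5 / 100) * real n))) \<longlonglongrightarrow> 0" unfolding subpoly_def by real_asymp
  ultimately show ?thesis
    using tendsto_add[OF tendsto_add, of _ "exp (0 * lam) - 1" sequentially _ 0 _ 0] by simp
qed

text \<open>Chernoff's bounds for the squared length of the noise decay exponentially in \<open>n\<close>: with the parameter
\<open>q = 4/1000\<close> they are \<open>n\<close>-th powers of the numbers on the left.\<close>

lemma noise_rate_constants: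
  "exp (396 / 100000) / sqrt (1008 / 1000) \<le> (99999 / 100000) powr (1 / 2 :: real)"
  "exp (- (404 / 100000)) / sqrt (992 / 1000) \<le> (99999 / 100000) powr (1 / 2 :: real)"
  "1 / sqrt (992 / 1000) \<le> exp (1 / 100 :: real)"
proof -
  have "exp (- (792 / 100000)) \<ge> (1 - 792 / 100000 :: real)" using exp_ge_add_one_self[of "- (792 / 100000)"] by simp
  then have e1: "exp (792 / 100000) \<le> (99999 / 100000) * (1008 / 1000 :: real)" by (simp add: exp_minus field_simps)
  have "exp (396 / 100000 :: real) = sqrt (exp (792 / 100000))" by (rule real_sqrt_unique[symmetric]) (auto simp: power2_eq_square simp flip: exp_add)
  also have "\<dots> \<le> sqrt ((99999 / 100000) * (1008 / 1000))" using e1 by (rule real_sqrt_le_mono)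
  finally have "exp (396 / 100000) \<le> sqrt (99999 / 100000) * sqrt (1008 / 1000 :: real)" unfolding real_sqrt_mult .
  then show "exp (396 / 100000) / sqrt (1008 / 1000) \<le> (99999 / 100000) powr (1 / 2 :: real)"
    by (simp add: powr_half_sqrt pos_divide_le_eq)
  have "1 + 808 / 100000 + (808 / 100000)\<^sup>2 / 2 \<le> exp (808 / 100000 :: real)" by (rule exp_lower_Taylor_quadratic) simp
  then have e2: "exp (- (808 / 100000)) \<le> (99999 / 100000) * (992 / 1000 :: real)" by (simp add: exp_minus field_simps power2_eq_square)
  have "exp (- (404 / 100000) :: real) = sqrt (exp (- (808 / 100000)))" by (rule real_sqrt_unique[symmetric]) (auto simp: power2_eq_square simp flip: exp_add)
  also have "\<dots> \<le> sqrt ((99999 / 100000) * (992 / 1000))" using e2 by (rule real_sqrt_le_mono)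
  finally have "exp (- (404 / 100000)) \<le> sqrt (99999 / 100000) * sqrt (992 / 1000 :: real)" unfolding real_sqrt_mult .
  then show "exp (- (404 / 100000)) / sqrt (992 / 1000) \<le> (99999 / 100000) powr (1 / 2 :: real)"
    by (simp add: powr_half_sqrt pos_divide_le_eq)
  have "(100 / 101 :: real) \<le> sqrt (992 / 1000)" by (rule real_le_rsqrt) (simp add: power2_eq_square)
  then have "1 / sqrt (992 / 1000) \<le> 1 + (1 / 100 :: real)" by (simp add: field_simps)
  also have "\<dots> \<le> exp (1 / 100)" by (rule exp_ge_add_one_self)
  finally show "1 / sqrt (992 / 1000) \<le> exp (1 / 100 :: real)" .
qed

section \<open>Consistency\<close>

text \<open>With \<open>a = (39/100) sqrt x\<close> and \<open>b = (35/100) sqrt x\<close> the lower bound on the maximum is about \<open>(37/100) sqrt x\<close>, above the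
assumed \<open>sqrt (x / 8)\<close>. It holds as soon as \<open>N\<close> exceeds \<open>exp (a\<^sup>2)\<close>, and \<open>a\<^sup>2 = 0.1521 x\<close> is below \<open>(4/25) x\<close>.\<close>

lemma (in design) extra_predictors_le:
  fixes x :: real
  assumes T: "T \<subset> {..<p}" and x: "0 < x"
    and m: "0 < 37 / 100 * sqrt x - ln 3 / (4 / 100 * sqrt x)"
    and gap: "354 / 1000 * sqrt x < (1 - 8 * exp (- (79 / 10000) * x)) * (37 / 100 * sqrt x - ln 3 / (4 / 100 * sqrt x))"
    and corr: "(\<integral>z. (MAX B\<in>{B. T \<subseteq> B \<and> B \<subset> {..<p}}. MAX k\<in>{..<p} - B.
            \<bar>((1\<^sub>m n - proj_model n X B) *\<^sub>v col X k) \<bullet> Matrix.vec n z\<bar> / sqrt (real n))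
          \<partial>gaussian_noise n 1) \<le> 1 / 2 * sqrt (\<zeta> / 2 * x)"
  shows "real (card ({..<p} - T)) \<le> exp (4 / 25 * x)"
proof (rule ccontr)
  let ?N = "real (card ({..<p} - T))" and ?m = "37 / 100 * sqrt x - ln 3 / (4 / 100 * sqrt x)"
  assume "\<not> ?N \<le> exp (4 / 25 * x)"
  then have N: "exp (4 / 25 * x) < ?N" by simp
  let ?a = "39 / 100 * sqrt x" and ?b = "35 / 100 * sqrt x"
  have mab: "(?a + ?b) / 2 - ln 3 / (?a - ?b) = ?m" by (simp add: algebra_simps)
  have "(1 - 8 * exp (?a\<^sup>2) / ?N) * (sqrt \<zeta> * ?m) \<le> 1 / 2 * sqrt (\<zeta> / 2 * x)"
  proof (rule order_trans[OF _ corr])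
    have "0 \<le> ?b" "?b < ?a" using x by auto
    from expected_max_correlation_lower_bound[OF T this, unfolded mab, OF m]
    show "(1 - 8 * exp (?a\<^sup>2) / ?N) * (sqrt \<zeta> * ?m) \<le> (\<integral>z. (MAX B\<in>{B. T \<subseteq> B \<and> B \<subset> {..<p}}. MAX k\<in>{..<p} - B.
            \<bar>((1\<^sub>m n - proj_model n X B) *\<^sub>v col X k) \<bullet> Matrix.vec n z\<bar> / sqrt (real n)) \<partial>gaussian_noise n 1)" .
  qed
  moreover have "exp (?a\<^sup>2) / ?N \<le> exp (- (79 / 10000) * x)"
  proof -
    have "?a\<^sup>2 = 1521 / 10000 * x" using x by (simp add: power_mult_distrib power2_eq_square)
    then have "exp (?a\<^sup>2) = exp (- (79 / 10000) * x) * exp (4 / 25 * x)" by (simp flip: exp_add)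
    also have "\<dots> \<le> exp (- (79 / 10000) * x) * ?N" using N by (intro mult_left_mono) auto
    finally show ?thesis using N exp_gt_zero[of "4 / 25 * x"] by (subst pos_divide_le_eq) linarith+
  qed
  then have "(1 - 8 * exp (- (79 / 10000) * x)) * (sqrt \<zeta> * ?m) \<le> (1 - 8 * exp (?a\<^sup>2) / ?N) * (sqrt \<zeta> * ?m)"
    using m \<zeta>_pos by (intro mult_right_mono) auto
  moreover have "1 / 2 * sqrt (\<zeta> / 2 * x) \<le> sqrt \<zeta> * (354 / 1000 * sqrt x)"
  proof -
    have "sqrt (1 / 2) \<le> (708 / 1000 :: real)" by (rule real_le_lsqrt) (auto simp: power2_eq_square)
    then have "1 / 2 * (sqrt \<zeta> * sqrt (1 / 2) * sqrt x) \<le> 1 / 2 * (sqrt \<zeta> * (708 / 1000) * sqrt x)"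
      using \<zeta>_pos x by (intro mult_left_mono mult_right_mono) auto
    moreover have "sqrt (\<zeta> / 2 * x) = sqrt \<zeta> * sqrt (1 / 2) * sqrt x" by (simp flip: real_sqrt_mult)
    ultimately show ?thesis by simp
  qed
  moreover have "sqrt \<zeta> * (354 / 1000 * sqrt x) < (1 - 8 * exp (- (79 / 10000) * x)) * (sqrt \<zeta> * ?m)"
  proof -
    have "sqrt \<zeta> * (354 / 1000 * sqrt x) < sqrt \<zeta> * ((1 - 8 * exp (- (79 / 10000) * x)) * ?m)"
      using gap \<zeta>_pos by (intro mult_strict_left_mono) auto
    then show ?thesis by (simp only: mult.left_commute)
  qed
  ultimately show False by linarith
qed

context regression
begin

text \<open>The parameter of the gain from extra predictors is \<open>c = (94/100) ln L\<close>. Its Chernoff bound is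
\<open>L powr (-(47/100) (94/100)) = L powr (-0.4418)\<close>, which after multiplication by \<open>N \<le> L powr (4/25)\<close> is still below
\<open>L powr (-1/4)\<close>; and \<open>(94/100) / (2 * 98/100) < 1/2\<close> keeps the weights of larger models summable.\<close>

lemma posterior_concentration_rate:
  fixes lam C :: real
  defines "L \<equiv> ln (real n)" and "LL \<equiv> ln (ln (real n))"
  defines "\<Lambda> \<equiv> max lam (1 / lam)"
  defines "B \<equiv> (3 * C + 5) * \<Lambda> * 2"
  assumes lam: "lam > 0"
    and mean: "(X *\<^sub>v b) \<bullet> (X *\<^sub>v b) \<le> C * real n * s\<^sup>2" "0 \<le> C"
    and \<delta>: "99 / 10 * L \<le> \<delta>"
    and t: "real (card T) \<le> real n / L + 1"
    and N: "real N \<le> L powr (4 / 25)"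
    and LL: "0 \<le> LL" "ln (2 * B) \<le> LL" "16 * sqrt B \<le> LL" "4 * \<Lambda> \<le> exp LL"
    and \<xi>: "8 * sqrt B * real n powr (- (1 / 100)) \<le> 1 / 2"
    and s1: "real n / L + 1 + L powr (4 / 25) + 2 \<le> real n / 100"
    and s2: "(real n / L + 1 + L powr (4 / 25)) / (99 / 100 * real n) \<le> 3 / L"
    and s3: "3 / L \<le> 1"
    and s5: "(real n / L + 1) * (L + LL) \<le> 11 / 10 * real n"
    and r1: "exp (L powr (4 / 25) * (5 * exp (- (4418 / 10000) * LL))) - 1 \<le> L powr (- 1 / 4) / 8"
    and r2: "(99999 / 100000) powr (real n / 2) \<le> L powr (- 1 / 4) / 8"
    and r3: "exp (- (4 / 100000) * real n + 1 / 100 * (real n / L + 1 + L powr (4 / 25) + 1)) \<le> L powr (- 1 / 4) / 8"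
    and r4: "subpoly n * (LL * real n powr (- (1 / 100))) / sqrt (real n powr (- (1 / 100))) \<le> L powr (- 1 / 4) / 8"
  shows "measure noise {e \<in> space noise. posterior_prob lam n p X (resp e) T \<ge>
       1 - (exp (exp (94 / 100 * LL / (196 / 100)) * sqrt (3 / L) * lam) - 1 + real n powr (- (1 / 100))
         + subpoly n * (real n * exp (- (5 / 100) * real n)))} \<ge> 1 - L powr (- 1 / 4)"
proof -
  interpret prob_space noise by (rule prob_space_gaussian_noise[OF s_pos])
  let ?c = "94 / 100 * LL" and ?\<eta> = "real n powr (- (1 / 100))"
  define R where "R = (exp (?c / (196 / 100)) * \<Lambda> * 2) ^ N"
  have npos: "0 < real n" using n_pos by simp
  have pb: "real p \<le> real n / L + 1 + L powr (4 / 25)" using card_T_N t N by linarith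
  have \<Lambda>: "1 \<le> \<Lambda>" unfolding \<Lambda>_def by (rule one_le_max_inverse[OF lam])
  have B1: "1 \<le> B"
  proof -
    have "1 * 1 \<le> (3 * C + 5) * \<Lambda>" using \<Lambda> mean(2) by (intro mult_mono) auto
    then show ?thesis unfolding B_def by simp
  qed
  have base1: "1 \<le> exp (?c / (196 / 100)) * \<Lambda> * 2"
  proof -
    have "1 * 1 \<le> exp (?c / (196 / 100)) * \<Lambda>" using \<Lambda> LL by (intro mult_mono) auto
    then show ?thesis by simp
  qed
  have R1: "1 \<le> R" unfolding R_def using base1 by (rule one_le_power)
  have n1: "real p + 2 \<le> real n / 100" using pb s1 by linarith
  have \<kappa>: "real p / (real n - real p - 2) \<le> 3 / L"
  proof -
    have "real p / (real n - real p - 2) \<le> (real n / L + 1 + L powr (4 / 25)) / (99 / 100 * real n)"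
      using pb n1 npos by (intro frac_le) auto
    then show ?thesis using s2 by simp
  qed
  have tB: "real (card T) * ln (B * (2 * real n)) \<le> 11 / 10 * real n"
  proof -
    have "ln (B * (2 * real n)) = ln (2 * B) + L"
      using B1 npos ln_mult_pos[of "2 * B" "real n"] by (simp add: L_def mult_ac)
    then have "ln (B * (2 * real n)) \<le> L + LL" using LL by simp
    moreover have "0 \<le> ln (B * (2 * real n))"
    proof -
      have "1 * 1 \<le> B * (2 * real n)" using B1 n_pos by (intro mult_mono) auto
      then show ?thesis by simp
    qed
    ultimately have "real (card T) * ln (B * (2 * real n)) \<le> (real n / L + 1) * (L + LL)"
      using t by (intro mult_mono) auto
    then show ?thesis using s5 by (rule order_trans)
  qed
  have subpoly: "2 ^ N * R \<le> subpoly n"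
  proof -
    have "2 ^ N * R = (4 * \<Lambda> * exp (?c / (196 / 100))) ^ N" by (simp add: R_def power_mult_distrib[symmetric] mult_ac)
    also have "\<dots> \<le> (exp LL * exp LL) ^ N" using LL \<Lambda> by (intro power_mono mult_mono) auto
    also have "\<dots> = exp (real N * (2 * LL))" unfolding exp_of_nat_mult by (simp flip: exp_add)
    also have "\<dots> \<le> exp (L powr (4 / 25) * (2 * LL))" using N LL by (simp add: mult_right_mono)
    also have "\<dots> = subpoly n" by (simp add: subpoly_def L_def LL_def mult_ac)
    finally show ?thesis .
  qed
  have sqrtR: "2 ^ N * sqrt R \<le> subpoly n"
  proof -
    have "sqrt R \<le> R" using R1 by (intro real_le_lsqrt) (auto simp: power2_eq_square)
    then have "2 ^ N * sqrt R \<le> 2 ^ N * R" by simp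
    then show ?thesis using subpoly by linarith
  qed
  have P1: "(1 + exp (- (47 / 100) * ?c) / sqrt (1 - 2 * (47 / 100))) ^ N - 1 \<le> L powr (- 1 / 4) / 8"
  proof -
    let ?y = "exp (- (47 / 100) * ?c) / sqrt (1 - 2 * (47 / 100))"
    have s: "(1 / 5 :: real) \<le> sqrt (1 - 2 * (47 / 100))" by (rule real_le_rsqrt) (simp add: power2_eq_square)
    have "?y \<le> exp (- (47 / 100) * ?c) / (1 / 5)" by (rule divide_left_mono[OF s]) auto
    also have "\<dots> = 5 * exp (- (4418 / 10000) * LL)" by simp
    finally have y: "?y \<le> 5 * exp (- (4418 / 10000) * LL)" .
    have y0: "0 \<le> ?y" by simp
    have "(1 + ?y) ^ N \<le> exp ?y ^ N" using exp_ge_add_one_self[of ?y] y0 by (intro power_mono) auto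
    also have "\<dots> = exp (real N * ?y)" by (rule exp_of_nat_mult[symmetric])
    also have "\<dots> \<le> exp (L powr (4 / 25) * (5 * exp (- (4418 / 10000) * LL)))"
      unfolding exp_le_cancel_iff by (intro mult_mono N y y0) auto
    finally show ?thesis using r1 by linarith
  qed
  have powq: "x ^ n \<le> L powr (- 1 / 4) / 8" if "0 \<le> x" "x \<le> (99999 / 100000) powr (1 / 2)" for x :: real
  proof -
    have "x ^ n \<le> ((99999 / 100000) powr (1 / 2)) ^ n" using that by (intro power_mono)
    also have "\<dots> = (99999 / 100000) powr (real n / 2)" by (simp add: powr_powr flip: powr_realpow)
    finally show ?thesis using r2 by linarith
  qed
  have P2a: "exp (4 / 1000 * (99 / 100 * real n)) / sqrt (1 + 2 * (4 / 1000)) ^ n \<le> L powr (- 1 / 4) / 8"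
  proof -
    have "exp (4 / 1000 * (99 / 100 * real n)) / sqrt (1 + 2 * (4 / 1000)) ^ n = (exp (396 / 100000) / sqrt (1008 / 1000)) ^ n"
      by (simp add: power_divide exp_of_nat_mult[symmetric] mult.commute)
    then show ?thesis using powq[OF _ noise_rate_constants(1)] by simp
  qed
  have P3: "exp (- (4 / 1000) * (101 / 100 * real n)) / sqrt (1 - 2 * (4 / 1000)) ^ n \<le> L powr (- 1 / 4) / 8"
  proof -
    have "exp (- (4 / 1000) * (101 / 100 * real n)) / sqrt (1 - 2 * (4 / 1000)) ^ n = (exp (- (404 / 100000)) / sqrt (992 / 1000)) ^ n"
      by (simp add: power_divide exp_of_nat_mult[symmetric] mult.commute)
    then show ?thesis using powq[OF _ noise_rate_constants(2)] by simp
  qed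
  have P2b: "exp (- (4 / 1000) * (1 / 100 * real n)) / sqrt (1 - 2 * (4 / 1000)) ^ (p + 1) \<le> L powr (- 1 / 4) / 8"
  proof -
    have "exp (- (4 / 1000) * (1 / 100 * real n)) / sqrt (1 - 2 * (4 / 1000)) ^ (p + 1)
      = exp (- (4 / 100000) * real n) * (1 / sqrt (992 / 1000)) ^ (p + 1)"
      by (simp add: power_one_over)
    also have "\<dots> \<le> exp (- (4 / 100000) * real n) * exp (1 / 100) ^ (p + 1)"
      using noise_rate_constants(3) by (intro mult_left_mono power_mono) auto
    also have "\<dots> = exp (- (4 / 100000) * real n + 1 / 100 * (real p + 1))"
      unfolding exp_of_nat_mult[symmetric] by (simp add: field_simps flip: exp_add)
    also have "\<dots> \<le> exp (- (4 / 100000) * real n + 1 / 100 * (real n / L + 1 + L powr (4 / 25) + 1))"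
      unfolding exp_le_cancel_iff by (intro add_left_mono mult_left_mono add_right_mono pb) simp
    finally show ?thesis using r3 by linarith
  qed
  have P4: "2 ^ N * sqrt R * (16 * sqrt B * ?\<eta>) / sqrt ?\<eta> \<le> L powr (- 1 / 4) / 8"
  proof -
    have "2 ^ N * sqrt R * (16 * sqrt B * ?\<eta>) / sqrt ?\<eta> \<le> subpoly n * (LL * ?\<eta>) / sqrt ?\<eta>"
      using sqrtR LL R1 B1 by (intro divide_right_mono mult_mono mult_right_mono) (auto simp: subpoly_def)
    then show ?thesis using r4 by linarith
  qed
  let ?\<epsilon> = "exp (exp (?c / (196 / 100)) * sqrt (3 / L) * lam) - 1 + ?\<eta> + 2 ^ N * (R * real n * exp (- (5 / 100) * real n))"
  let ?\<epsilon>' = "exp (exp (94 / 100 * LL / (196 / 100)) * sqrt (3 / L) * lam) - 1 + ?\<eta> + subpoly n * (real n * exp (- (5 / 100) * real n))"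
  have main: "1 - (((1 + exp (- (47 / 100) * ?c) / sqrt (1 - 2 * (47 / 100))) ^ N - 1)
       + (exp (4 / 1000 * (99 / 100 * real n)) / sqrt (1 + 2 * (4 / 1000)) ^ n
          + exp (- (4 / 1000) * (1 / 100 * real n)) / sqrt (1 - 2 * (4 / 1000)) ^ (p + 1))
       + exp (- (4 / 1000) * (101 / 100 * real n)) / sqrt (1 - 2 * (4 / 1000)) ^ n
       + 2 ^ N * sqrt R * (16 * sqrt B * ?\<eta>) / sqrt ?\<eta>)
     \<le> prob {e \<in> space noise. posterior_prob lam n p X (resp e) T \<ge> 1 - ?\<epsilon>}"
    unfolding R_def B_def \<Lambda>_def
    by (rule posterior_concentration[OF lam n1 \<kappa> s3 _ mean \<delta>[unfolded L_def]])
      (use LL(1) npos \<xi> tB in \<open>auto simp: B_def \<Lambda>_def\<close>)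
  have "?\<epsilon> \<le> ?\<epsilon>'"
    using mult_right_mono[OF subpoly, of "real n * exp (- (5 / 100) * real n)"] by (simp add: mult_ac)
  then have "{e \<in> space noise. posterior_prob lam n p X (resp e) T \<ge> 1 - ?\<epsilon>} \<subseteq> {e \<in> space noise. posterior_prob lam n p X (resp e) T \<ge> 1 - ?\<epsilon>'}"
    by force
  then have "prob {e \<in> space noise. posterior_prob lam n p X (resp e) T \<ge> 1 - ?\<epsilon>} \<le> prob {e \<in> space noise. posterior_prob lam n p X (resp e) T \<ge> 1 - ?\<epsilon>'}"
    by (intro finite_measure_mono borel_measurable_le borel_measurable_const measurable_posterior)
  moreover have "0 \<le> L powr (- 1 / 4)" by simp
  ultimately show ?thesis using main P1 P2a P2b P3 P4 by linarith
qed

end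

text \<open>The locale assumptions hold with \<open>\<delta> = 10 n / t\<close> because \<open>\<zeta> C2 > 10\<close>, and the numerical conditions hold for large
\<open>n\<close>.\<close>

theorem theorem1:
  fixes p :: "nat \<Rightarrow> nat"
    and X :: "nat \<Rightarrow> real mat"
    and \<alpha> :: "nat \<Rightarrow> real"
    and \<beta> :: "nat \<Rightarrow> real Matrix.vec"
    and \<sigma>2 :: "nat \<Rightarrow> real"
    and T :: "nat \<Rightarrow> nat set"
    and lam \<zeta> C1 C2 C3 f :: real
  assumes X_dim: "\<And>n. X n \<in> carrier_mat n (p n)"
    and \<beta>_dim: "\<And>n. \<beta> n \<in> carrier_vec (p n)"
    and T_def: "\<And>n. T n = {i \<in> {..<p n}. \<beta> n $ i \<noteq> 0}"
    and \<sigma>2_pos: "\<And>n. \<sigma>2 n > 0"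
    and lam_pos: "lam > 0"
    and centered: "\<forall>\<^sub>F n in sequentially. \<forall>i<p n. ones n \<bullet> col (X n) i = 0"
    and normalized: "\<forall>\<^sub>F n in sequentially. \<forall>i<p n. col (X n) i \<bullet> col (X n) i = real n"
    and \<zeta>_pos: "\<zeta> > 0"
    and eigen: "\<forall>\<^sub>F n in sequentially. \<forall>A. A \<noteq> {} \<and> A \<subseteq> {..<p n} \<longrightarrow>
        min_eigenvalue ((1 / real n) \<cdot>\<^sub>m ((subcols (X n) A)\<^sup>T * subcols (X n) A)) \<ge> \<zeta>"
    and max_corr: "\<forall>\<^sub>F n in sequentially. T n \<noteq> {..<p n} \<longrightarrow>
        (\<integral>z. (MAX B\<in>{B. T n \<subseteq> B \<and> B \<subset> {..<p n}}. MAX k\<in>{..<p n} - B.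
            \<bar>((1\<^sub>m n - proj_model n (X n) B) *\<^sub>v col (X n) k) \<bullet> Matrix.vec n z\<bar> / sqrt (real n))
          \<partial>gaussian_noise n 1)
        \<le> 1 / 2 * sqrt (\<zeta> / 2 * ln (ln (real n)))"
    and C1_pos: "C1 > 0"
    and mean_structure:
      "(\<lambda>n. ((subcols (X n) (T n) *\<^sub>v subvec (\<beta> n) (T n)) \<bullet> (subcols (X n) (T n) *\<^sub>v subvec (\<beta> n) (T n)))
          / (real n * \<sigma>2 n)) \<longlonglongrightarrow> C1"
    and growth: "(\<lambda>n. real (p n) / real n) \<longlonglongrightarrow> f" "f < 1"
    and signal_bounded:
      "(\<lambda>n. (1 / \<sigma>2 n) * (subvec (\<beta> n) (T n) \<bullet> subvec (\<beta> n) (T n))) \<in> O(\<lambda>_. 1)"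
    and C2_pos: "C2 > 0" and C3_pos: "C3 > 0"
    and min_signal: "\<forall>\<^sub>F n in sequentially.
        C2 / real (card (T n)) \<le> (1 / \<sigma>2 n) * (MIN i\<in>T n. \<bar>\<beta> n $ i\<bar>)\<^sup>2 \<and>
        (1 / \<sigma>2 n) * (MIN i\<in>T n. \<bar>\<beta> n $ i\<bar>)\<^sup>2 \<le> C3 / real (card (T n))"
    and card_T: "\<forall>\<^sub>F n in sequentially. \<bar>real (card (T n)) - real n / ln (real n)\<bar> < 1"
    and C2_large: "C2 > 10 / \<zeta>"
  shows "\<exists>\<eta> :: nat \<Rightarrow> real. \<eta> \<longlonglongrightarrow> 0 \<and>
    (\<forall>\<^sub>F n in sequentially.
      \<P>(e in gaussian_noise n (sqrt (\<sigma>2 n)).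
        posterior_prob lam n (p n) (X n) (response n (X n) (T n) (\<alpha> n) (\<beta> n) e) (T n) \<ge> 1 - \<eta> n)
      \<ge> 1 - ln (real n) powr (- 1 / 4))"
proof (intro exI conjI)
  define C where "C = C1 + 1"
  define \<Lambda> where "\<Lambda> = max lam (1 / lam)"
  define B where "B = (3 * C + 5) * \<Lambda> * 2"
  let ?\<eta> = "\<lambda>n. exp (exp (94 / 100 * ln (ln (real n)) / (196 / 100)) * sqrt (3 / ln (real n)) * lam) - 1
     + real n powr (- (1 / 100)) + subpoly n * (real n * exp (- (5 / 100) * real n))"
  show "?\<eta> \<longlonglongrightarrow> 0" by (rule error_tendsto_0)
  have mean_bd: "\<forall>\<^sub>F n in sequentially. ((subcols (X n) (T n) *\<^sub>v subvec (\<beta> n) (T n)) \<bullet> (subcols (X n) (T n) *\<^sub>v subvec (\<beta> n) (T n)))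
          / (real n * \<sigma>2 n) < C"
    by (rule order_tendstoD(2)[OF mean_structure]) (simp add: C_def)
  have lnln: "filterlim (\<lambda>n::nat. ln (ln (real n))) at_top sequentially" by real_asymp
  note extra = eventually_compose_filterlim[OF eventually_extra_bound lnln]
  have "(\<lambda>n::nat. real n powr (- (1 / 100))) \<longlonglongrightarrow> 0" by real_asymp
  then have "(\<lambda>n::nat. 8 * sqrt B * real n powr (- (1 / 100))) \<longlonglongrightarrow> 8 * sqrt B * 0" by (intro tendsto_intros)
  then have \<xi>: "\<forall>\<^sub>F n in sequentially. 8 * sqrt B * real n powr (- (1 / 100)) < 1 / 2"
    by (rule order_tendstoD(2)) simp
  have lnpos: "\<forall>\<^sub>F n in sequentially. 2 \<le> real n / ln (real n) \<and> 0 < ln (real n)"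
    by (intro eventually_conj) real_asymp+
  show "\<forall>\<^sub>F n in sequentially.
      \<P>(e in gaussian_noise n (sqrt (\<sigma>2 n)).
        posterior_prob lam n (p n) (X n) (response n (X n) (T n) (\<alpha> n) (\<beta> n) e) (T n) \<ge> 1 - ?\<eta> n)
      \<ge> 1 - ln (real n) powr (- 1 / 4)"
    using eventually_gt_at_top[of 0] centered eigen max_corr min_signal card_T mean_bd extra \<xi> lnpos
      eventually_ln_ln_ge[of 1] eventually_ln_ln_ge[of "ln (2 * B)"] eventually_ln_ln_ge[of "16 * sqrt B"]
      eventually_ln_ln_ge[of "ln (4 * \<Lambda>)"] eventually_sizes eventually_rates
  proof eventually_elim
    case (elim n)
    note elims = elim
    have n: "0 < n" by (rule elims(1))
    let ?t = "card (T n)" and ?L = "ln (real n)" and ?LL = "ln (ln (real n))"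
    have Tsub: "T n \<subseteq> {..<p n}" using T_def by auto
    have tL: "real n / ?L - 1 < real ?t" "real ?t < real n / ?L + 1" using elims(6) by linarith+
    have t1: "1 < real ?t" using tL elims(10) by linarith
    then have Tne: "T n \<noteq> {}" by auto
    then have p: "0 < p n" using Tsub by auto
    have finT: "finite (T n)" using Tsub finite_subset by auto
    interpret design n "p n" "X n" \<zeta>
    proof
      have "\<zeta> \<le> min_eigenvalue ((1 / real n) \<cdot>\<^sub>m ((subcols (X n) {..<p n})\<^sup>T * subcols (X n) {..<p n}))"
        using p by (intro elims(3)[rule_format]) auto
      from gram_lower_bound[OF X_dim n p this]
      show "\<And>b. b \<in> carrier_vec (p n) \<Longrightarrow> \<zeta> * real n * (b \<bullet> b) \<le> (X n *\<^sub>v b) \<bullet> (X n *\<^sub>v b)" .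
      show "\<And>i. i < p n \<Longrightarrow> ones n \<bullet> col (X n) i = 0" by (rule elims(2)[rule_format])
    qed (rule X_dim n \<zeta>_pos)+
    interpret regression n "p n" "X n" \<zeta> "T n" "\<beta> n" "\<alpha> n" "sqrt (\<sigma>2 n)" "10 * real n / real ?t"
    proof
      show "supported (T n) (\<beta> n)" using \<beta>_dim T_def by (auto simp: supported_def)
      show "0 < 10 * real n / real ?t" using n t1 by simp
      fix i assume i: "i \<in> T n"
      let ?m = "MIN i\<in>T n. \<bar>\<beta> n $ i\<bar>"
      have "0 \<le> ?m" using finT Tne by (subst Min_ge_iff) auto
      moreover have "?m \<le> \<bar>\<beta> n $ i\<bar>" using finT i by (intro Min_le) auto
      ultimately have "?m\<^sup>2 \<le> (\<beta> n $ i)\<^sup>2" by (metis power_mono power2_abs)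
      then have "(1 / \<sigma>2 n) * ?m\<^sup>2 \<le> (1 / \<sigma>2 n) * (\<beta> n $ i)\<^sup>2" using \<sigma>2_pos[of n] by (intro mult_left_mono) auto
      then have "C2 / real ?t \<le> (\<beta> n $ i)\<^sup>2 / \<sigma>2 n" using elims(5) by simp
      then have "C2 / real ?t * \<sigma>2 n \<le> (\<beta> n $ i)\<^sup>2" using \<sigma>2_pos[of n] by (simp add: pos_le_divide_eq)
      then have "\<zeta> * real n * (C2 / real ?t * \<sigma>2 n) \<le> \<zeta> * real n * (\<beta> n $ i)\<^sup>2" using \<zeta>_pos by (intro mult_left_mono) auto
      moreover have "10 * (real n / real ?t * \<sigma>2 n) \<le> (\<zeta> * C2) * (real n / real ?t * \<sigma>2 n)"
        using C2_large \<zeta>_pos \<sigma>2_pos[of n] by (intro mult_right_mono) (auto simp: field_simps less_imp_le)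
      ultimately show "10 * real n / real ?t * (sqrt (\<sigma>2 n))\<^sup>2 \<le> \<zeta> * real n * (\<beta> n $ i)\<^sup>2"
        using \<sigma>2_pos[of n] by (simp add: field_simps)
    qed (use Tsub \<sigma>2_pos in auto)
    have LLpos: "1 \<le> ?LL" by (rule elims(11))
    have N: "real (card ({..<p n} - T n)) \<le> ?L powr (4 / 25)"
    proof (cases "T n = {..<p n}")
      case True
      then show ?thesis by simp
    next
      case False
      then have "T n \<subset> {..<p n}" using Tsub by auto
      then have "real (card ({..<p n} - T n)) \<le> exp (4 / 25 * ?LL)"
        using extra_predictors_le[of "T n" ?LL] elims(4,8) False LLpos by auto
      then show ?thesis using elims(10) by (simp add: powr_def)
    qed
    have mean: "(X n *\<^sub>v \<beta> n) \<bullet> (X n *\<^sub>v \<beta> n) \<le> C * real n * (sqrt (\<sigma>2 n))\<^sup>2"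
    proof -
      have "subcols (X n) (T n) *\<^sub>v subvec (\<beta> n) (T n) = X n *\<^sub>v \<beta> n"
        by (rule subcols_mult_subvec[OF X_dim Tsub \<beta>_dim]) (use T_def in auto)
      then have "(X n *\<^sub>v \<beta> n) \<bullet> (X n *\<^sub>v \<beta> n) / (real n * \<sigma>2 n) < C" using elims(7) by simp
      then show ?thesis using n \<sigma>2_pos[of n] by (simp add: pos_divide_less_eq mult.assoc)
    qed
    have \<delta>: "99 / 10 * ?L \<le> 10 * real n / real ?t"
    proof -
      have "10 * real n / (real n / ?L + 1) \<le> 10 * real n / real ?t"
        using tL t1 n by (intro divide_left_mono) (auto intro!: mult_pos_pos)
      then show ?thesis using elims(18) by linarith
    qed
    have \<Lambda>: "4 * \<Lambda> \<le> exp ?LL"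
    proof -
      have "0 < 4 * \<Lambda>" using one_le_max_inverse[OF lam_pos] by (simp add: \<Lambda>_def)
      moreover have "exp (ln (4 * \<Lambda>)) \<le> exp ?LL" unfolding exp_le_cancel_iff by (rule elims(14))
      ultimately show ?thesis by (simp only: exp_ln)
    qed
    have "1 - ?L powr (- 1 / 4) \<le> measure (gaussian_noise n (sqrt (\<sigma>2 n))) {e \<in> space (gaussian_noise n (sqrt (\<sigma>2 n))).
      posterior_prob lam n (p n) (X n) (resp e) (T n) \<ge> 1 - ?\<eta> n}"
      by (rule posterior_concentration_rate[OF lam_pos mean _ \<delta> _ N])
        (use elims LLpos tL \<Lambda> C1_pos in \<open>auto simp: B_def \<Lambda>_def C_def\<close>)
    then show ?case unfolding response_eq[symmetric] .
  qed
qed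

end
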